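(* Let $\{V_j\}_{j\in\mathbb{Z}}$ be a multiresolution analysis (MRA) of $L^2(\mathbb{R}^n)$ having a continuous scaling function $\phi$ such that $\lim_{|\mathbf{x}|\to\infty}|\mathbf{x}|^l\phi(\mathbf{x})=0$ for all $l\in\mathbb{N}$. Let $\mu$ be a (complex) Radon measure on $\mathbb{R}^n$ such that $\int_{\mathbb{R}^n}(1+|\mathbf{x}|)^{-k}\,d|\mu|(\mathbf{x})<\infty$ for some $k\ge0$. Then $$\lim_{j\to\infty}(q_j\mu)(\mathbf{x}_0)=\gamma_{\mathbf{x}_0}$$ at every Lebesgue density point $\mathbf{x}_0$ of $\mu$, where $\gamma_{\mathbf{x}_0}$ is the number such that $\lim_{\nu\to\infty}\mu(B_\nu)/m(B_\nu)=\gamma_{\mathbf{x}_0}$ for every sequence of Borel sets $B_\nu\to\mathbf{x}_0$ regularly. In particular, the limit $\lim_{j\to\infty}(q_j\mu)(\mathbf{x}_0)=\gamma_{\mathbf{x}_0}$ exists and $\gamma_{\mathbf{x}_0}=f(\mathbf{x}_0)$ for almost every $\mathbf{x}_0$ (with respect to Lebesgue measure), where $d\mu=f\,dm+d\mu_s$ is the Lebesgue decomposition of $\mu$ ($f\in L^1_{loc}(\mathbb{R}^n)$, $\mu_s$ singular with respect to $m$).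
   Context: MRA: an increasing sequence $\{V_j\}_{j\in\mathbb{Z}}$ of closed linear subspaces of $L^2(\mathbb{R}^n)$ such that (i) $f\in V_j\Leftrightarrow f(2\,\cdot)\in V_{j+1}$; (ii) $f\in V_0\Leftrightarrow f(\cdot-\mathbf{m})\in V_0$ for $\mathbf{m}\in\mathbb{Z}^n$; (iii) $\bigcap_jV_j=\{0\}$ and $\overline{\bigcup_jV_j}=L^2(\mathbb{R}^n)$; (iv) there is $\phi\in L^2(\mathbb{R}^n)$, called a scaling function, such that $\{\phi(\cdot-\mathbf{m})\}_{\mathbf{m}\in\mathbb{Z}^n}$ is an orthonormal basis of $V_0$. Let $q_0(\mathbf{x},\mathbf{y})=\sum_{\mathbf{m}\in\mathbb{Z}^n}\phi(\mathbf{x}-\mathbf{m})\overline{\phi(\mathbf{y}-\mathbf{m})}$ and $q_j(\mathbf{x},\mathbf{y})=2^{nj}q_0(2^j\mathbf{x},2^j\mathbf{y})$ (the kernel of the orthogonal projection onto $V_j$). For the measure $\mu$, $(q_j\mu)(\mathbf{x})=\int_{\mathbb{R}^n}q_j(\mathbf{x},\mathbf{y})\,d\mu(\mathbf{y})$. $m$ is Lebesgue measure on $\mathbb{R}^n$, $|\mu|$ is the total variation measure, and $B(\mathbf{x}_0,\varepsilon)$ is the Euclidean ball. A sequence of Borel sets $\{B_\nu\}_{\nu=0}^\infty$ shrinks regularly to $\mathbf{x}_0$ (written $B_\nu\to\mathbf{x}_0$ regularly) if there are radii $\varepsilon_\nu>0$ with $\varepsilon_\nu\to0$, $B_\nu\subseteq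 B(\mathbf{x}_0,\varepsilon_\nu)$ for all $\nu$, and a constant $a>0$ with $m(B_\nu)\ge a\varepsilon_\nu^n$ for all $\nu$. The point $\mathbf{x}_0$ is a Lebesgue density point of the (complex) Radon measure $\mu$ if there is a number $\gamma_{\mathbf{x}_0}$ with $\lim_{\nu\to\infty}\mu(B_\nu)/m(B_\nu)=\gamma_{\mathbf{x}_0}$ for every sequence $B_\nu\to\mathbf{x}_0$ regularly. *)

theory Defs
  imports "HOL-Analysis.Analysis"
begin

section \<open>The Hilbert space of square integrable functions\<close>

text \<open>
  Elements of \<open>L\<^sup>2(\<real>\<^sup>n)\<close> are represented by functions, and subspaces of \<open>L\<^sup>2(\<real>\<^sup>n)\<close> by sets of
  functions. A set satisfying \<open>closed_L2_subspace\<close> is automatically saturated under almost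
  everywhere equality (constant sequences converge in the \<open>L\<^sup>2\<close> seminorm to every
  representative of their limit).
\<close>

definition L2 :: "(real^'n \<Rightarrow> complex) set" where
  "L2 = {f. f \<in> borel_measurable lebesgue \<and> integrable lebesgue (\<lambda>x. (norm (f x))\<^sup>2)}"

definition L2_norm :: "(real^'n \<Rightarrow> complex) \<Rightarrow> real" where
  "L2_norm f = sqrt (LINT x|lebesgue. (norm (f x))\<^sup>2)"

definition L2_inner :: "(real^'n \<Rightarrow> complex) \<Rightarrow> (real^'n \<Rightarrow> complex) \<Rightarrow> complex" where
  "L2_inner f g = (LINT x|lebesgue. f x * cnj (g x))"

definition closed_L2_subspace :: "(real^'n \<Rightarrow> complex) set \<Rightarrow> bool" where
  "closed_L2_subspace W \<longleftrightarrow>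
     W \<subseteq> L2 \<and> (\<lambda>x. 0) \<in> W \<and>
     (\<forall>f\<in>W. \<forall>g\<in>W. (\<lambda>x. f x + g x) \<in> W) \<and>
     (\<forall>c. \<forall>f\<in>W. (\<lambda>x. c * f x) \<in> W) \<and>
     (\<forall>h f. (\<forall>i::nat. h i \<in> W) \<and> f \<in> L2 \<and> (\<lambda>i. L2_norm (\<lambda>x. h i x - f x)) \<longlonglongrightarrow> 0
        \<longrightarrow> f \<in> W)"

definition orthonormal_basis_of ::
    "'i set \<Rightarrow> ('i \<Rightarrow> real^'n \<Rightarrow> complex) \<Rightarrow> (real^'n \<Rightarrow> complex) set \<Rightarrow> bool" where
  "orthonormal_basis_of I e W \<longleftrightarrow>
     (\<forall>i\<in>I. e i \<in> W) \<and>
     (\<forall>i\<in>I. \<forall>j\<in>I. L2_inner (e i) (e j) = (if i = j then 1 else 0)) \<and>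
     (\<forall>f\<in>W. \<forall>\<delta>>0. \<exists>S c. finite S \<and> S \<subseteq> I \<and> L2_norm (\<lambda>x. f x - (\<Sum>i\<in>S. c i * e i x)) < \<delta>)"


section \<open>Multiresolution analyses\<close>

definition int_lattice :: "(real^'n) set" where
  "int_lattice = {m. \<forall>i. m $ i \<in> \<int>}"

definition scaling_function ::
    "(int \<Rightarrow> (real^'n \<Rightarrow> complex) set) \<Rightarrow> (real^'n \<Rightarrow> complex) \<Rightarrow> bool" where
  "scaling_function V \<phi> \<longleftrightarrow>
     \<phi> \<in> L2 \<and> orthonormal_basis_of int_lattice (\<lambda>m x. \<phi> (x - m)) (V 0)"

definition multiresolution_analysis :: "(int \<Rightarrow> (real^'n \<Rightarrow> complex) set) \<Rightarrow> bool" where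
  "multiresolution_analysis V \<longleftrightarrow>
     (\<forall>j. closed_L2_subspace (V j)) \<and> mono V \<and>
     (\<forall>j. \<forall>f\<in>L2. f \<in> V j \<longleftrightarrow> (\<lambda>x. f (2 *\<^sub>R x)) \<in> V (j + 1)) \<and>
     (\<forall>m\<in>int_lattice. \<forall>f\<in>L2. f \<in> V 0 \<longleftrightarrow> (\<lambda>x. f (x - m)) \<in> V 0) \<and>
     (\<Inter>j. V j) = {f \<in> L2. AE x in lebesgue. f x = 0} \<and>
     (\<forall>f\<in>L2. \<forall>\<delta>>0. \<exists>g\<in>(\<Union>j. V j). L2_norm (\<lambda>x. f x - g x) < \<delta>) \<and>
     (\<exists>\<phi>. scaling_function V \<phi>)"

definition q0_kernel :: "(real^'n \<Rightarrow> complex) \<Rightarrow> real^'n \<Rightarrow> real^'n \<Rightarrow> complex" where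
  "q0_kernel \<phi> x y = (\<Sum>\<^sub>\<infinity>m\<in>int_lattice. \<phi> (x - m) * cnj (\<phi> (y - m)))"

definition q_kernel :: "(real^'n \<Rightarrow> complex) \<Rightarrow> int \<Rightarrow> real^'n \<Rightarrow> real^'n \<Rightarrow> complex" where
  "q_kernel \<phi> j x y =
     2 powi (int CARD('n) * j) * q0_kernel \<phi> ((2 powi j) *\<^sub>R x) ((2 powi j) *\<^sub>R y)"


section \<open>Complex Radon measures\<close>

text \<open>
  A complex Radon measure may have infinite total variation, so it assigns a complex number only
  to bounded Borel sets; its values on other sets are irrelevant and never used. No separate
  regularity condition is needed, since every Borel measure on \<open>\<real>\<^sup>n\<close> that is finite on compact
  sets is regular.
\<close>

definition bounded_borel :: "(real^'n) set set" where
  "bounded_borel = {B. B \<in> sets borel \<and> bounded B}"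

text \<open>
  \<open>|\<mu>|(E)\<close> is the supremum of \<open>\<Sum>\<^sub>i |\<mu>(E\<^sub>i)|\<close> over the countable partitions of \<open>E\<close> into bounded
  Borel sets.
\<close>

definition total_variation :: "((real^'n) set \<Rightarrow> complex) \<Rightarrow> (real^'n) measure" where
  "total_variation \<mu> = measure_of UNIV (sets borel)
     (\<lambda>E. SUP A \<in> {A :: nat \<Rightarrow> (real^'n) set.
                     range A \<subseteq> bounded_borel \<and> disjoint_family A \<and> (\<Union>i. A i) = E}.
            (\<Sum>i. ennreal (norm (\<mu> (A i)))))"

definition complex_radon_measure :: "((real^'n) set \<Rightarrow> complex) \<Rightarrow> bool" where
  "complex_radon_measure \<mu> \<longleftrightarrow>
     (\<forall>A :: nat \<Rightarrow> (real^'n) set.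
        range A \<subseteq> bounded_borel \<and> disjoint_family A \<and> bounded (\<Union>i. A i)
          \<longrightarrow> (\<lambda>i. \<mu> (A i)) sums \<mu> (\<Union>i. A i)) \<and>
     (\<forall>K. compact K \<longrightarrow> emeasure (total_variation \<mu>) K < \<infinity>)"

text \<open>
  Integration against \<open>\<mu>\<close> uses the Jordan decompositions of \<open>Re \<mu>\<close> and \<open>Im \<mu>\<close>. The positive part
  of a real set function \<open>\<nu>\<close> is \<open>\<nu>\<^sup>+(E) = sup {\<nu>(A) | A \<subseteq> E}\<close>, with \<open>A\<close> ranging over bounded Borel
  sets; the negative part of \<open>\<nu>\<close> is the positive part of \<open>-\<nu>\<close>. Truncation by \<open>ennreal\<close>
  is harmless because \<open>A = {}\<close> contributes \<open>0\<close>.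
\<close>

definition jordan_pos_part :: "((real^'n) set \<Rightarrow> real) \<Rightarrow> (real^'n) measure" where
  "jordan_pos_part \<nu> = measure_of UNIV (sets borel)
     (\<lambda>E. SUP A \<in> {A \<in> bounded_borel. A \<subseteq> E}. ennreal (\<nu> A))"

definition signed_integral :: "((real^'n) set \<Rightarrow> real) \<Rightarrow> (real^'n \<Rightarrow> complex) \<Rightarrow> complex" where
  "signed_integral \<nu> f =
     (LINT y|jordan_pos_part \<nu>. f y) - (LINT y|jordan_pos_part (\<lambda>A. - \<nu> A). f y)"

definition radon_integral :: "((real^'n) set \<Rightarrow> complex) \<Rightarrow> (real^'n \<Rightarrow> complex) \<Rightarrow> complex" where
  "radon_integral \<mu> f =
     signed_integral (\<lambda>A. Re (\<mu> A)) f + \<i> * signed_integral (\<lambda>A. Im (\<mu> A)) f"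

definition q_measure ::
    "(real^'n \<Rightarrow> complex) \<Rightarrow> int \<Rightarrow> ((real^'n) set \<Rightarrow> complex) \<Rightarrow> real^'n \<Rightarrow> complex" where
  "q_measure \<phi> j \<mu> x = radon_integral \<mu> (\<lambda>y. q_kernel \<phi> j x y)"


section \<open>Lebesgue density points and Lebesgue decomposition\<close>

definition shrinks_regularly :: "(nat \<Rightarrow> (real^'n) set) \<Rightarrow> real^'n \<Rightarrow> bool" where
  "shrinks_regularly B x0 \<longleftrightarrow>
     (\<forall>\<nu>. B \<nu> \<in> sets borel) \<and>
     (\<exists>\<epsilon>. (\<forall>\<nu>. \<epsilon> \<nu> > 0) \<and> \<epsilon> \<longlonglongrightarrow> 0 \<and> (\<forall>\<nu>. B \<nu> \<subseteq> ball x0 (\<epsilon> \<nu>)) \<and>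
        (\<exists>a>0. \<forall>\<nu>. measure lebesgue (B \<nu>) \<ge> a * \<epsilon> \<nu> ^ CARD('n)))"

text \<open>
  \<open>x0\<close> is a Lebesgue density point of \<open>\<mu>\<close> iff \<open>has_lebesgue_density \<mu> x0 \<gamma>\<close> for some \<open>\<gamma>\<close>, which is
  then unique.
\<close>

definition has_lebesgue_density ::
    "((real^'n) set \<Rightarrow> complex) \<Rightarrow> real^'n \<Rightarrow> complex \<Rightarrow> bool" where
  "has_lebesgue_density \<mu> x0 \<gamma> \<longleftrightarrow>
     (\<forall>B. shrinks_regularly B x0
        \<longrightarrow> (\<lambda>\<nu>. \<mu> (B \<nu>) / of_real (measure lebesgue (B \<nu>))) \<longlonglongrightarrow> \<gamma>)"

definition locally_integrable :: "(real^'n \<Rightarrow> complex) \<Rightarrow> bool" where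
  "locally_integrable f \<longleftrightarrow> (\<forall>K. compact K \<longrightarrow> set_integrable lebesgue K f)"

definition lebesgue_singular :: "((real^'n) set \<Rightarrow> complex) \<Rightarrow> bool" where
  "lebesgue_singular \<mu> \<longleftrightarrow>
     (\<exists>N\<in>sets borel. emeasure lebesgue N = 0 \<and> emeasure (total_variation \<mu>) (- N) = 0)"

definition lebesgue_decomposition ::
    "((real^'n) set \<Rightarrow> complex) \<Rightarrow> (real^'n \<Rightarrow> complex) \<Rightarrow> ((real^'n) set \<Rightarrow> complex) \<Rightarrow> bool" where
  "lebesgue_decomposition \<mu> f \<mu>s \<longleftrightarrow>
     locally_integrable f \<and> complex_radon_measure \<mu>s \<and> lebesgue_singular \<mu>s \<and>
     (\<forall>B\<in>bounded_borel. \<mu> B = (LINT x:B|lebesgue. f x) + \<mu>s B)"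

end

theory Submission
  imports Defs
begin

text \<open>
  Orthonormality and rapid decay of the integer translates of \<open>\<phi>\<close> give \<open>|q\<^sub>0(x,y)| \<le> C\<^sub>l (1+|x-y|)\<^sup>-\<^sup>l\<close>
  for all \<open>l\<close>. Moreover \<open>\<integral> q\<^sub>0(x,y) dy = 1\<close>: this integral is continuous and periodic in \<open>x\<close>, and
  density of \<open>\<Union>\<^sub>j V\<^sub>j\<close>, rescaled to \<open>V\<^sub>0\<close>, shows that it is close to \<open>1\<close> in mean square over large balls.
  Now let \<open>x\<^sub>0\<close> be a density point with value \<open>\<gamma>\<close>. The density condition, which is uniform over regularly
  shrinking sets, implies \<open>|\<mu> - \<gamma>m|(B(x\<^sub>0,r)) = o(r\<^sup>n)\<close>. Splitting \<open>\<integral> q\<^sub>j(x\<^sub>0,y) d(\<mu> - \<gamma>m)(y)\<close> into dyadic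
  shells near \<open>x\<^sub>0\<close> and a tail controlled by the growth condition yields the convergence.

  The Lebesgue decomposition comes from densities with respect to \<open>|\<mu>| + m\<close>. A Vitali covering argument
  shows that a Radon measure \<open>\<lambda>\<close> with \<open>\<lambda>(A) = 0\<close> satisfies \<open>\<lambda>(B(x,r)) = o(r\<^sup>n)\<close> for almost every \<open>x \<in> A\<close>;
  applied to the singular part, and to \<open>|f - q| m\<close> restricted to \<open>{|f - q| \<ge> \<epsilon>}\<close> for \<open>q\<close> in a countable
  dense set, it shows that almost every point is a density point with value \<open>f(x)\<close>.
\<close>

section \<open>Variations and Jordan parts of complex Radon measures\<close>

text \<open>The obstacle is that \<open>\<mu>\<close> is only a set function on bounded Borel sets
  and may have infinite total variation, so it has no global complex measure behind it. Lebesgue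
  measure and the four Jordan parts all lie below \<open>|\<mu>| + m\<close> and therefore have real
  densities with respect to it. Then \<open>\<mu> - \<gamma> m\<close> has a density
  \<open>h - \<gamma> \<sigma>\<close>, its variation is an honest measure with density
  \<open>|h - \<gamma> \<sigma>|\<close>, and every estimate at a density point is made against that
  measure. Two exponents meet there: decay of order n + 1 matches the growth o(r^n) near the point,
  while the tail needs an exponent of at least \<open>k\<close>, which rapid decay supplies for
  every \<open>k\<close>. For the normalisation of the kernel the obstacle is that the constant 1 is
  not square integrable. Approximation from the \<open>V j\<close> can be tested only on indicators
  of balls and only in mean square; lattice periodicity is what turns this into a pointwise
  identity.\<close>

text \<open>\<open>measure_of\<close> yields \<open>F\<close> itself only for a countably additive
  \<open>F\<close>. For suprema it is easy to see superadditivity on two sets and subadditivity on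
  sequences; the former gives monotonicity and bounds the partial sums, so both together give
  additivity.\<close>

lemma emeasure_measure_of_superadditive:
  fixes F :: "'a::topological_space set \<Rightarrow> ennreal"
  assumes empty: "F {} = 0"
    and super: "\<And>A B. A \<in> sets borel \<Longrightarrow> B \<in> sets borel \<Longrightarrow> A \<inter> B = {} \<Longrightarrow> F A + F B \<le> F (A \<union> B)"
    and sub: "\<And>A :: nat \<Rightarrow> 'a set. range A \<subseteq> sets borel \<Longrightarrow> disjoint_family A \<Longrightarrow> F (\<Union>i. A i) \<le> (\<Sum>i. F (A i))"
    and E: "E \<in> sets borel"
  shows "emeasure (measure_of UNIV (sets borel) F) E = F E"
proof (rule emeasure_measure_of)
  show "measure_of UNIV (sets borel) F = measure_of UNIV (sets borel) F" ..
  show "sets borel \<subseteq> Pow UNIV" by simp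
  have mono: "F A \<le> F B" if "A \<in> sets borel" "B \<in> sets borel" "A \<subseteq> B" for A B
  proof -
    have "F A \<le> F A + F (B - A)" by simp
    also have "\<dots> \<le> F (A \<union> (B - A))" using that by (intro super) auto
    also have "A \<union> (B - A) = B" using that by auto
    finally show ?thesis .
  qed
  let ?M = "measure_of UNIV (sets borel) F"
  have sets: "sets ?M = sets borel"
    by (metis sets.sets_measure_of_eq space_borel)
  show "E \<in> sets ?M" using E sets by simp
  show "positive (sets ?M) F" using empty by (simp add: positive_def)
  show "countably_additive (sets ?M) F"
  proof (rule countably_additiveI)
    fix A :: "nat \<Rightarrow> 'a set"
    assume A: "range A \<subseteq> sets ?M" "disjoint_family A"
    have fin: "(\<Sum>i<n. F (A i)) \<le> F (\<Union>i<n. A i)" for n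
    proof (induction n)
      case 0 then show ?case by simp
    next
      case (Suc n)
      have "(\<Sum>i<Suc n. F (A i)) \<le> F (\<Union>i<n. A i) + F (A n)"
        using Suc by (simp add: add_right_mono)
      also have "\<dots> \<le> F ((\<Union>i<n. A i) \<union> A n)"
      proof (intro super)
        show "(\<Union>i<n. A i) \<inter> A n = {}"
          by (auto dest: disjoint_family_onD[OF A(2) UNIV_I UNIV_I less_imp_neq])
      qed (use A sets in auto)
      also have "(\<Union>i<n. A i) \<union> A n = (\<Union>i<Suc n. A i)" by (auto simp: less_Suc_eq)
      finally show ?case .
    qed
    show "(\<Sum>i. F (A i)) = F (\<Union>i. A i)"
    proof (rule antisym)
      show "(\<Sum>i. F (A i)) \<le> F (\<Union>i. A i)"
      proof (rule suminf_le_const)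
        fix n
        have "F (\<Union>i<n. A i) \<le> F (\<Union>i. A i)"
          using A sets by (intro mono) auto
        with fin[of n] show "(\<Sum>i<n. F (A i)) \<le> F (\<Union>i. A i)" by simp
      qed simp
      show "F (\<Union>i. A i) \<le> (\<Sum>i. F (A i))"
        by (rule sub[OF A(1)[unfolded sets] A(2)])
    qed
  qed
qed

text \<open>The first clause of \<open>complex_radon_measure\<close>, with a general range so that
  it also covers real and imaginary parts.\<close>

definition sigma_additive_bounded :: "((real^'n) set \<Rightarrow> 'b::{topological_space,comm_monoid_add}) \<Rightarrow> bool" where
  "sigma_additive_bounded \<mu> \<longleftrightarrow>
     (\<forall>A :: nat \<Rightarrow> (real^'n) set.
        range A \<subseteq> bounded_borel \<and> disjoint_family A \<and> bounded (\<Union>i. A i)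
          \<longrightarrow> (\<lambda>i. \<mu> (A i)) sums \<mu> (\<Union>i. A i))"

lemma bounded_borelI: "A \<in> sets borel \<Longrightarrow> bounded A \<Longrightarrow> A \<in> bounded_borel"
  unfolding bounded_borel_def by (rule CollectI) (rule conjI)

lemma bounded_borel_borel: "A \<in> bounded_borel \<Longrightarrow> A \<in> sets borel"
  and bounded_borel_bounded: "A \<in> bounded_borel \<Longrightarrow> bounded A"
  unfolding bounded_borel_def by (erule CollectE, erule conjE, assumption)+

lemma bounded_borel_subset: "A \<in> bounded_borel \<Longrightarrow> B \<in> sets borel \<Longrightarrow> B \<subseteq> A \<Longrightarrow> B \<in> bounded_borel"
  by (rule bounded_borelI, assumption, rule bounded_subset[OF bounded_borel_bounded])

lemma bounded_borel_empty [simp]: "{} \<in> bounded_borel"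
  by (rule bounded_borelI) simp_all

lemma bounded_borel_Un [intro]: "A \<in> bounded_borel \<Longrightarrow> B \<in> bounded_borel \<Longrightarrow> A \<union> B \<in> bounded_borel"
  by (rule bounded_borelI) (simp_all add: bounded_borel_borel bounded_borel_bounded sets.Un)

lemma bounded_borel_Int [intro]:
  "A \<in> bounded_borel \<Longrightarrow> B \<in> sets borel \<Longrightarrow> A \<inter> B \<in> bounded_borel"
  by (rule bounded_borelI) (simp_all add: bounded_borel_borel bounded_borel_bounded sets.Int bounded_Int)

lemma bounded_borel_Diff [intro]:
  "A \<in> bounded_borel \<Longrightarrow> B \<in> sets borel \<Longrightarrow> A - B \<in> bounded_borel"
  by (rule bounded_borelI) (simp_all add: bounded_borel_borel bounded_borel_bounded sets.Diff bounded_diff)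

declare bounded_borel_borel [simp]

lemma sigma_additive_bounded_empty:
  fixes \<mu> :: "(real^'n) set \<Rightarrow> 'b::real_normed_vector"
  assumes "sigma_additive_bounded \<mu>" shows "\<mu> {} = 0"
proof -
  have "(\<lambda>i::nat. \<mu> {}) sums \<mu> (\<Union>i::nat. {})"
    using assms unfolding sigma_additive_bounded_def
    by (elim allE[of _ "\<lambda>_. {}"]) (auto simp: disjoint_family_on_def)
  then have "summable (\<lambda>i::nat. \<mu> {})" by (simp add: sums_iff)
  then show ?thesis by (simp add: summable_const_iff)
qed

lemma sigma_additive_bounded_Un:
  fixes \<mu> :: "(real^'n) set \<Rightarrow> 'b::real_normed_vector"
  assumes s: "sigma_additive_bounded \<mu>" and AB: "A \<in> bounded_borel" "B \<in> bounded_borel" "A \<inter> B = {}"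
  shows "\<mu> (A \<union> B) = \<mu> A + \<mu> B"
proof -
  let ?A = "binaryset A B"
  have "(\<lambda>i. \<mu> (?A i)) sums \<mu> (\<Union>i. ?A i)"
  proof -
    have "range ?A \<subseteq> bounded_borel" using AB by (auto simp: range_binaryset_eq)
    moreover have "disjoint_family ?A"
      using AB(3) by (auto simp: disjoint_family_on_def binaryset_def)
    moreover have "bounded (\<Union>i. ?A i)"
      using AB by (auto simp: UN_binaryset_eq bounded_borel_bounded)
    ultimately show ?thesis using s by (auto simp: sigma_additive_bounded_def)
  qed
  moreover have "(\<lambda>i. \<mu> (?A i)) sums (\<mu> A + \<mu> B)"
    by (rule binaryset_sums) (rule sigma_additive_bounded_empty[OF s])
  ultimately show ?thesis by (metis UN_binaryset_eq sums_unique2)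
qed

lemma sigma_additive_bounded_Diff:
  fixes \<mu> :: "(real^'n) set \<Rightarrow> 'b::real_normed_vector"
  assumes s: "sigma_additive_bounded \<mu>" and AB: "A \<in> bounded_borel" "B \<in> sets borel" "B \<subseteq> A"
  shows "\<mu> (A - B) = \<mu> A - \<mu> B"
proof -
  have "\<mu> (A - B \<union> B) = \<mu> (A - B) + \<mu> B"
    by (rule sigma_additive_bounded_Un[OF s]) (use AB bounded_borel_subset[OF AB] in auto)
  moreover have "A - B \<union> B = A" using AB by auto
  ultimately show ?thesis by simp
qed

text \<open>Only \<open>C\<close> is bounded; cutting the \<open>A i\<close> down to
  \<open>C\<close> turns a possibly unbounded family into one to which sigma-additivity
  applies.\<close>

lemma sigma_additive_bounded_sums_Int:
  fixes \<mu> :: "(real^'n) set \<Rightarrow> 'b::real_normed_vector"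
  assumes s: "sigma_additive_bounded \<mu>" and A: "range A \<subseteq> sets borel" "disjoint_family A"
    and C: "C \<in> bounded_borel" "C \<subseteq> (\<Union>i. A i)"
  shows "(\<lambda>i::nat. \<mu> (C \<inter> A i)) sums \<mu> C"
proof -
  have "(\<lambda>i. \<mu> (C \<inter> A i)) sums \<mu> (\<Union>i. C \<inter> A i)"
  proof -
    have "range (\<lambda>i. C \<inter> A i) \<subseteq> bounded_borel" using A C by auto
    moreover have "disjoint_family (\<lambda>i. C \<inter> A i)"
      using A(2) unfolding disjoint_family_on_def by blast
    moreover have "bounded (\<Union>i. C \<inter> A i)"
      by (rule bounded_subset[of C]) (use C in \<open>auto simp: bounded_borel_bounded\<close>)
    ultimately show ?thesis using s unfolding sigma_additive_bounded_def by blast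
  qed
  moreover have "(\<Union>i. C \<inter> A i) = C" using C by auto
  ultimately show ?thesis by simp
qed

section \<open>Jordan parts of real set functions\<close>

definition pos_variation :: "((real^'n) set \<Rightarrow> real) \<Rightarrow> (real^'n) set \<Rightarrow> ennreal" where
  "pos_variation \<nu> E = (SUP A \<in> {A \<in> bounded_borel. A \<subseteq> E}. ennreal (\<nu> A))"

text \<open>Truncation at 0 by \<open>ennreal\<close> can only increase the partial sums, so terms
  of either sign are allowed.\<close>

lemma ennreal_le_suminf:
  assumes "f sums (a::real)" shows "ennreal a \<le> (\<Sum>i. ennreal (f i))"
proof (rule LIMSEQ_le_const2)
  show "(\<lambda>n. ennreal (\<Sum>i<n. f i)) \<longlonglongrightarrow> ennreal a"
    using assms by (intro tendsto_ennrealI) (simp add: sums_def)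
  have "ennreal (\<Sum>i<n. f i) \<le> (\<Sum>i. ennreal (f i))" for n
  proof -
    have "ennreal (\<Sum>i<n. f i) \<le> ennreal (\<Sum>i<n. max 0 (f i))"
      by (intro ennreal_leI sum_mono) auto
    also have "\<dots> = (\<Sum>i<n. ennreal (f i))"
      by (subst sum_ennreal[symmetric]) (auto simp: ennreal_max_0)
    also have "\<dots> \<le> (\<Sum>i. ennreal (f i))" by (rule sum_le_suminf) auto
    finally show ?thesis .
  qed
  then show "\<exists>N. \<forall>n\<ge>N. ennreal (\<Sum>i<n. f i) \<le> (\<Sum>i. ennreal (f i))" by blast
qed

lemma ennreal_add_le:
  assumes "0 \<le> b" shows "ennreal (a + b) \<le> ennreal a + ennreal b"
proof (cases "0 \<le> a")
  case True with assms show ?thesis by simp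
next
  case False
  then have "ennreal (a + b) \<le> ennreal b" by (intro ennreal_leI) simp
  with False show ?thesis by (simp add: ennreal_neg)
qed

text \<open>Subsets of disjoint sets can be united, which gives superadditivity; a subset of a union
  splits into its pieces, which gives countable subadditivity.\<close>

lemma emeasure_jordan_pos_part:
  fixes \<nu> :: "(real^'n) set \<Rightarrow> real"
  assumes s: "sigma_additive_bounded \<nu>" and E: "E \<in> sets borel"
  shows "emeasure (jordan_pos_part \<nu>) E = pos_variation \<nu> E"
proof -
  note e = sigma_additive_bounded_empty[OF s]
  have "emeasure (measure_of UNIV (sets borel) (pos_variation \<nu>)) E = pos_variation \<nu> E"
  proof (rule emeasure_measure_of_superadditive[OF _ _ _ E])
    have "{A \<in> bounded_borel. A \<subseteq> {}} = {{} :: (real^'n) set}" by auto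
    then show "pos_variation \<nu> {} = 0" using e by (simp add: pos_variation_def)
  next
    fix A B :: "(real^'n) set"
    assume AB: "A \<in> sets borel" "B \<in> sets borel" "A \<inter> B = {}"
    show "pos_variation \<nu> A + pos_variation \<nu> B \<le> pos_variation \<nu> (A \<union> B)"
    proof -
      have key: "ennreal (\<nu> C) + ennreal (\<nu> D) \<le> pos_variation \<nu> (A \<union> B)"
        if "C \<in> bounded_borel" "C \<subseteq> A" "D \<in> bounded_borel" "D \<subseteq> B" for C D
      proof -
        \<comment> \<open>Replacing a set of negative value by the empty set does not change its
          truncated value, and on nonnegative values \<open>ennreal\<close> is additive.\<close>
        define C' where "C' = (if \<nu> C \<ge> 0 then C else {})"
        define D' where "D' = (if \<nu> D \<ge> 0 then D else {})"
        have "ennreal (\<nu> C) + ennreal (\<nu> D) = ennreal (\<nu> C') + ennreal (\<nu> D')"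
          by (auto simp: C'_def D'_def e ennreal_neg)
        also have "\<dots> = ennreal (\<nu> C' + \<nu> D')"
          by (rule ennreal_plus[symmetric]) (auto simp: C'_def D'_def e)
        also have "\<nu> C' + \<nu> D' = \<nu> (C' \<union> D')"
          using that AB by (intro sigma_additive_bounded_Un[OF s, symmetric]) (auto simp: C'_def D'_def)
        also have "ennreal (\<nu> (C' \<union> D')) \<le> pos_variation \<nu> (A \<union> B)"
          unfolding pos_variation_def
          using that by (intro SUP_upper) (auto simp: C'_def D'_def)
        finally show ?thesis .
      qed
      have ne: "{A \<in> bounded_borel. A \<subseteq> E} \<noteq> {}" for E :: "(real^'n) set"
    using bounded_borel_empty by blast
      have "pos_variation \<nu> A + pos_variation \<nu> B
          = (SUP C \<in> {C \<in> bounded_borel. C \<subseteq> A}. SUP D \<in> {C \<in> bounded_borel. C \<subseteq> B}. ennreal (\<nu> C) + ennreal (\<nu> D))"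
        unfolding pos_variation_def
        by (subst ennreal_SUP_add_left[OF ne, symmetric], subst ennreal_SUP_add_right[OF ne, symmetric]) simp
      also have "\<dots> \<le> pos_variation \<nu> (A \<union> B)"
        using key by (intro SUP_least) auto
      finally show ?thesis .
    qed
  next
    fix A :: "nat \<Rightarrow> (real^'n) set"
    assume A: "range A \<subseteq> sets borel" "disjoint_family A"
    show "pos_variation \<nu> (\<Union>i. A i) \<le> (\<Sum>i. pos_variation \<nu> (A i))"
      unfolding pos_variation_def[of _ "\<Union>i. A i"]
    proof (rule SUP_least)
      fix C assume "C \<in> {C \<in> bounded_borel. C \<subseteq> (\<Union>i. A i)}"
      then have C: "C \<in> bounded_borel" "C \<subseteq> (\<Union>i. A i)" by auto
      have "ennreal (\<nu> C) \<le> (\<Sum>i. ennreal (\<nu> (C \<inter> A i)))"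
        by (intro ennreal_le_suminf sigma_additive_bounded_sums_Int[OF s A C])
      also have "\<dots> \<le> (\<Sum>i. pos_variation \<nu> (A i))"
        unfolding pos_variation_def using A C by (intro suminf_le SUP_upper) auto
      finally show "ennreal (\<nu> C) \<le> (\<Sum>i. pos_variation \<nu> (A i))" .
    qed
  qed
  then show ?thesis by (simp add: jordan_pos_part_def pos_variation_def[abs_def])
qed

lemma sets_jordan_pos_part [simp, measurable_cong]: "sets (jordan_pos_part \<nu>) = sets borel"
  unfolding jordan_pos_part_def using sets.sets_measure_of_eq[of borel] by simp

lemma sets_total_variation [simp, measurable_cong]: "sets (total_variation \<nu>) = sets borel"
  unfolding total_variation_def using sets.sets_measure_of_eq[of borel] by simp

text \<open>The Jordan identity, arranged as an equality of sums so that nothing is subtracted in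
  \<open>ennreal\<close>. Passing from \<open>C\<close> to \<open>E - C\<close> turns
  \<open>- \<nu> C\<close> into \<open>\<nu> (E - C) - \<nu> E\<close>, which gives one inequality;
  the other is the same argument for \<open>- \<nu>\<close>.\<close>

lemma emeasure_jordan_pos_part_diff:
  fixes \<nu> :: "(real^'n) set \<Rightarrow> real"
  assumes s: "sigma_additive_bounded \<nu>" and E: "E \<in> bounded_borel"
  shows "emeasure (jordan_pos_part (\<lambda>A. - \<nu> A)) E + ennreal (\<nu> E) 
       = emeasure (jordan_pos_part \<nu>) E + ennreal (- \<nu> E)"
proof -
  have s': "sigma_additive_bounded (\<lambda>A. - \<nu> A)"
    using s unfolding sigma_additive_bounded_def by (auto intro: sums_minus)
  note e = sigma_additive_bounded_empty[OF s]
  have ne: "{A \<in> bounded_borel. A \<subseteq> E} \<noteq> {}" for E :: "(real^'n) set"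
    using bounded_borel_empty by blast
  have half: "pos_variation (\<lambda>A. - \<rho> A) E + ennreal (\<rho> E) \<le> pos_variation \<rho> E + ennreal (- \<rho> E)"
    if s: "sigma_additive_bounded \<rho>" for \<rho> :: "(real^'n) set \<Rightarrow> real"
  proof -
    have "ennreal (- \<rho> C) + ennreal (\<rho> E) \<le> pos_variation \<rho> E + ennreal (- \<rho> E)"
      if C: "C \<in> bounded_borel" "C \<subseteq> E" for C
    proof -
      have d: "\<rho> (E - C) = \<rho> E - \<rho> C" using C E by (intro sigma_additive_bounded_Diff[OF s]) auto
      have up: "ennreal (\<rho> D) \<le> pos_variation \<rho> E" if "D \<in> bounded_borel" "D \<subseteq> E" for D
        unfolding pos_variation_def using that by (intro SUP_upper) auto
      show ?thesis
      proof (cases "\<rho> C \<ge> 0")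
        case True
        then have "ennreal (- \<rho> C) + ennreal (\<rho> E) = ennreal (\<rho> E)" by (simp add: ennreal_neg)
        also have "\<dots> \<le> pos_variation \<rho> E" using up[of E] E by auto
        finally show ?thesis by (simp add: add_increasing2)
      next
        case F: False
        show ?thesis
        proof (cases "\<rho> E \<ge> 0")
          case True
          then have "ennreal (- \<rho> C) + ennreal (\<rho> E) = ennreal (\<rho> (E - C))"
            using F d by (subst ennreal_plus[symmetric]) auto
          also have "\<dots> \<le> pos_variation \<rho> E" using up[of "E - C"] E C by (simp add: bounded_borel_Diff)
          finally show ?thesis by (simp add: add_increasing2)
        next
          case False
          then have "ennreal (- \<rho> C) + ennreal (\<rho> E) = ennreal (\<rho> (E - C) + (- \<rho> E))"
            using d by (simp add: ennreal_neg)
          also have "\<dots> \<le> ennreal (\<rho> (E - C)) + ennreal (- \<rho> E)"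
            using False by (intro ennreal_add_le) auto
          also have "\<dots> \<le> pos_variation \<rho> E + ennreal (- \<rho> E)" using up[of "E - C"] E C by (simp add: bounded_borel_Diff add_right_mono)
          finally show ?thesis .
        qed
      qed
    qed
    then show ?thesis
      unfolding pos_variation_def[of "\<lambda>A. - \<rho> A"]
      by (subst ennreal_SUP_add_left[OF ne, symmetric]) (auto intro!: SUP_least)
  qed
  from half[OF s] half[OF s'] show ?thesis
    using emeasure_jordan_pos_part[OF s] emeasure_jordan_pos_part[OF s'] E
    by (intro antisym) auto
qed

section \<open>Total variation of complex set functions\<close>

lemma suminf_commute_ennreal:
  fixes a :: "nat \<Rightarrow> nat \<Rightarrow> ennreal"
  shows "(\<Sum>j. \<Sum>i. a i j) = (\<Sum>i. \<Sum>j. a i j)"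
proof -
  have "(\<Sum>j. \<Sum>i. a i j) = (\<integral>\<^sup>+j. (\<Sum>i. a i j) \<partial>count_space UNIV)"
    by (rule nn_integral_count_space_nat[symmetric])
  also have "\<dots> = (\<Sum>i. \<integral>\<^sup>+j. a i j \<partial>count_space UNIV)"
    by (rule nn_integral_suminf) simp
  finally show ?thesis by (simp add: nn_integral_count_space_nat)
qed

lemma norm_le_suminf_norm:
  fixes f :: "nat \<Rightarrow> 'a::real_normed_vector"
  assumes "f sums a" shows "ennreal (norm a) \<le> (\<Sum>i. ennreal (norm (f i)))"
proof (rule LIMSEQ_le_const2)
  show "(\<lambda>n. ennreal (norm (\<Sum>i<n. f i))) \<longlonglongrightarrow> ennreal (norm a)"
    using assms by (intro tendsto_ennrealI tendsto_norm) (simp add: sums_def)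
  have "ennreal (norm (\<Sum>i<n. f i)) \<le> (\<Sum>i. ennreal (norm (f i)))" for n
  proof -
    have "ennreal (norm (\<Sum>i<n. f i)) \<le> ennreal (\<Sum>i<n. norm (f i))"
      by (intro ennreal_leI norm_sum)
    also have "\<dots> = (\<Sum>i<n. ennreal (norm (f i)))" by simp
    also have "\<dots> \<le> (\<Sum>i. ennreal (norm (f i)))" by (rule sum_le_suminf) auto
    finally show ?thesis .
  qed
  then show "\<exists>N. \<forall>n\<ge>N. ennreal (norm (\<Sum>i<n. f i)) \<le> (\<Sum>i. ennreal (norm (f i)))" by blast
qed

definition bounded_partitions :: "(real^'n) set \<Rightarrow> (nat \<Rightarrow> (real^'n) set) set" where
  "bounded_partitions E = {A. range A \<subseteq> bounded_borel \<and> disjoint_family A \<and> (\<Union>i. A i) = E}"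

definition variation :: "((real^'n) set \<Rightarrow> complex) \<Rightarrow> (real^'n) set \<Rightarrow> ennreal" where
  "variation \<mu> E = (SUP A \<in> bounded_partitions E. (\<Sum>i. ennreal (norm (\<mu> (A i)))))"

text \<open>Disjointed concentric balls cut any Borel set into bounded pieces. Nonemptiness permits
  constants to be moved into the supremum over partitions.\<close>

lemma bounded_partitions_nonempty:
  fixes E :: "(real^'n) set"
  assumes "E \<in> sets borel" shows "bounded_partitions E \<noteq> {}"
proof -
  let ?A = "\<lambda>i. E \<inter> disjointed (\<lambda>k. ball (0::real^'n) (real k)) i"
  have "range ?A \<subseteq> bounded_borel"
  proof safe
    fix i
    have "disjointed (\<lambda>k. ball (0::real^'n) (real k)) i \<in> bounded_borel"
    proof (rule bounded_borelI)
      show "disjointed (\<lambda>k. ball (0::real^'n) (real k)) i \<in> sets borel"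
        unfolding disjointed_def by (intro sets.Diff sets.finite_UN) auto
      show "bounded (disjointed (\<lambda>k. ball (0::real^'n) (real k)) i)"
        by (rule bounded_subset[OF bounded_ball disjointed_subset])
    qed
    then show "?A i \<in> bounded_borel"
      using assms by (subst Int_commute) (rule bounded_borel_Int)
  qed
  moreover have "disjoint_family ?A"
    using disjoint_family_disjointed[of "\<lambda>k. ball (0::real^'n) (real k)"]
    unfolding disjoint_family_on_def by blast
  moreover have "(\<Union>i. ?A i) = E"
  proof -
    have "(\<Union>i. disjointed (\<lambda>k. ball (0::real^'n) (real k)) i) = UNIV"
      unfolding UN_disjointed_eq using reals_Archimedean2 by auto
    then show ?thesis by blast
  qed
  ultimately have "?A \<in> bounded_partitions E" by (simp add: bounded_partitions_def)
  then show ?thesis by blast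
qed

text \<open>Models the merging of two partitions indexed by the naturals: even indices for the
  first, odd ones for the second.\<close>

lemma suminf_add_interleave:
  fixes f g :: "nat \<Rightarrow> ennreal"
  shows "(\<Sum>i. f i) + (\<Sum>i. g i) \<le> (\<Sum>k. if even k then f (k div 2) else g (k div 2))"
proof -
  let ?h = "\<lambda>k. if even k then f (k div 2) else g (k div 2)"
  have "(\<Sum>i<n. f i + g i) = (\<Sum>k<2*n. ?h k)" for n
    by (induction n) (simp_all add: add.assoc)
  then have "(\<Sum>i<n. f i + g i) \<le> (\<Sum>k. ?h k)" for n
    using sum_le_suminf[of ?h "{..<2*n}"] by simp
  then show ?thesis by (simp add: suminf_add suminf_le_const)
qed

text \<open>Partitions of two disjoint sets interleave to a partition of the union, which gives
  superadditivity. For subadditivity a partition of the union is refined by the \<open>A i\<close>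
  and the double sum is taken in the other order.\<close>

lemma emeasure_total_variation:
  fixes \<mu> :: "(real^'n) set \<Rightarrow> complex"
  assumes s: "sigma_additive_bounded \<mu>" and E: "E \<in> sets borel"
  shows "emeasure (total_variation \<mu>) E = variation \<mu> E"
proof -
  note e = sigma_additive_bounded_empty[OF s]
  have "emeasure (measure_of UNIV (sets borel) (variation \<mu>)) E = variation \<mu> E"
  proof (rule emeasure_measure_of_superadditive[OF _ _ _ E])
    have "(\<Sum>i. ennreal (norm (\<mu> (A i)))) \<le> 0" if "A \<in> bounded_partitions {}" for A
    proof -
      have "A i = {}" for i using that by (auto simp: bounded_partitions_def)
      then show ?thesis by (simp add: e)
    qed
    then have "variation \<mu> {} \<le> 0" unfolding variation_def by (rule SUP_least)
    then show "variation \<mu> {} = 0" by simp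
  next
    fix A B :: "(real^'n) set"
    assume AB: "A \<in> sets borel" "B \<in> sets borel" "A \<inter> B = {}"
    have key: "(\<Sum>i. ennreal (norm (\<mu> (C i)))) + (\<Sum>i. ennreal (norm (\<mu> (D i)))) \<le> variation \<mu> (A \<union> B)"
      if C: "C \<in> bounded_partitions A" and D: "D \<in> bounded_partitions B" for C D
    proof -
      define G where "G k = (if even k then C (k div 2) else D (k div 2))" for k :: nat
      have "G \<in> bounded_partitions (A \<union> B)"
      proof -
        have "range G \<subseteq> bounded_borel"
          using C D by (auto simp: bounded_partitions_def G_def)
        moreover have "disjoint_family G"
          unfolding disjoint_family_on_def
        proof safe
          fix i j x assume *: "i \<noteq> j" "x \<in> G i" "x \<in> G j"
          have CA: "C k \<subseteq> A" "D k \<subseteq> B" for k using C D by (auto simp: bounded_partitions_def)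
          have dC: "C k \<inter> C l = {}" "D k \<inter> D l = {}" if "k \<noteq> l" for k l
            using C D that by (auto simp: bounded_partitions_def disjoint_family_on_def)
          have "even i = even j"
            using *(2,3) CA[of "i div 2"] CA[of "j div 2"] AB(3) unfolding G_def
            by (cases "even i"; cases "even j") auto
          then have "i div 2 \<noteq> j div 2"
            using \<open>i \<noteq> j\<close> by (metis bit_eq_rec)
          then show "x \<in> {}"
            using * dC[of "i div 2" "j div 2"] \<open>even i = even j\<close> by (auto simp: G_def split: if_splits)
        qed
        moreover have "(\<Union>i. G i) = A \<union> B"
        proof -
          have "C i \<subseteq> (\<Union>i. G i)" "D i \<subseteq> (\<Union>i. G i)" for i
          proof -
            have "C i = G (2 * i)" "D i = G (2 * i + 1)" by (auto simp: G_def)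
            then show "C i \<subseteq> (\<Union>i. G i)" "D i \<subseteq> (\<Union>i. G i)" by blast+
          qed
          then have "(\<Union>i. C i) \<union> (\<Union>i. D i) \<subseteq> (\<Union>i. G i)" by (intro Un_least UN_least)
          moreover have "(\<Union>i. G i) \<subseteq> (\<Union>i. C i) \<union> (\<Union>i. D i)"
            by (rule UN_least) (auto simp: G_def)
          ultimately have "(\<Union>i. G i) = (\<Union>i. C i) \<union> (\<Union>i. D i)" by (rule equalityI[rotated])
          then show ?thesis using C D by (simp add: bounded_partitions_def)
        qed
        ultimately show ?thesis by (simp add: bounded_partitions_def)
      qed
      then have le: "(\<Sum>i. ennreal (norm (\<mu> (G i)))) \<le> variation \<mu> (A \<union> B)"
        unfolding variation_def by (rule SUP_upper)
      have eq: "ennreal (norm (\<mu> (G k)))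
          = (if even k then ennreal (norm (\<mu> (C (k div 2)))) else ennreal (norm (\<mu> (D (k div 2)))))" for k
        by (simp add: G_def)
      show ?thesis
        by (rule order_trans[OF suminf_add_interleave]) (rule le[unfolded eq])
    qed
    show "variation \<mu> A + variation \<mu> B \<le> variation \<mu> (A \<union> B)"
      unfolding variation_def[of _ A] variation_def[of _ B]
      by (subst ennreal_SUP_add_left[OF bounded_partitions_nonempty[OF AB(1)], symmetric], rule SUP_least,
          subst ennreal_SUP_add_right[OF bounded_partitions_nonempty[OF AB(2)]], rule SUP_least)
         (rule key)
  next
    fix A :: "nat \<Rightarrow> (real^'n) set"
    assume A: "range A \<subseteq> sets borel" "disjoint_family A"
    show "variation \<mu> (\<Union>i. A i) \<le> (\<Sum>i. variation \<mu> (A i))"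
      unfolding variation_def[of _ "\<Union>i. A i"]
    proof (rule SUP_least)
      fix C assume "C \<in> bounded_partitions (\<Union>i. A i)"
      then have C: "C j \<in> bounded_borel" "disjoint_family C" "(\<Union>i. C i) = (\<Union>i. A i)" for j
        by (auto simp: bounded_partitions_def)
      have "C j \<subseteq> (\<Union>i. A i)" for j using C(3) by blast
      then have "(\<Sum>j. ennreal (norm (\<mu> (C j)))) \<le> (\<Sum>j. \<Sum>i. ennreal (norm (\<mu> (C j \<inter> A i))))"
        by (intro suminf_le norm_le_suminf_norm sigma_additive_bounded_sums_Int[OF s A] C) auto
      also have "\<dots> = (\<Sum>i. \<Sum>j. ennreal (norm (\<mu> (C j \<inter> A i))))"
        by (rule suminf_commute_ennreal)
      also have "\<dots> \<le> (\<Sum>i. variation \<mu> (A i))"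
      proof (rule suminf_le)
        fix i
        have "(\<lambda>j. C j \<inter> A i) \<in> bounded_partitions (A i)"
        proof -
          have "range (\<lambda>j. C j \<inter> A i) \<subseteq> bounded_borel" using C(1) A(1) by auto
          moreover have "disjoint_family (\<lambda>j. C j \<inter> A i)"
            using C(2) unfolding disjoint_family_on_def by blast
          moreover have "(\<Union>j. C j \<inter> A i) = A i" using C(3) by blast
          ultimately show ?thesis by (simp add: bounded_partitions_def)
        qed
        then show "(\<Sum>j. ennreal (norm (\<mu> (C j \<inter> A i)))) \<le> variation \<mu> (A i)"
          unfolding variation_def by (rule SUP_upper)
      qed auto
      finally show "(\<Sum>j. ennreal (norm (\<mu> (C j)))) \<le> (\<Sum>i. variation \<mu> (A i))" .
    qed
  qed
  then show ?thesis
    by (simp add: total_variation_def variation_def[abs_def] bounded_partitions_def)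
qed

lemma norm_le_total_variation:
  fixes \<mu> :: "(real^'n) set \<Rightarrow> complex"
  assumes s: "sigma_additive_bounded \<mu>" and A: "A \<in> bounded_borel"
  shows "ennreal (norm (\<mu> A)) \<le> emeasure (total_variation \<mu>) A"
proof -
  note e = sigma_additive_bounded_empty[OF s]
  let ?A = "\<lambda>i::nat. if i = 0 then A else {}"
  have "?A \<in> bounded_partitions A"
    using A by (auto simp: bounded_partitions_def disjoint_family_on_def)
  then have "(\<Sum>i. ennreal (norm (\<mu> (?A i)))) \<le> variation \<mu> A"
    unfolding variation_def by (rule SUP_upper)
  moreover have "(\<Sum>i. ennreal (norm (\<mu> (?A i)))) = (\<Sum>i\<in>{0}. ennreal (norm (\<mu> (?A i))))"
    by (rule suminf_finite) (auto simp: e)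
  ultimately show ?thesis using emeasure_total_variation[OF s, of A] A by simp
qed

text \<open>Each value competing in the supremum is bounded by the total variation of its own set.
  It is used with plus and minus the real and imaginary parts of \<open>\<mu>\<close>.\<close>

lemma jordan_pos_part_le_total_variation:
  fixes \<mu> :: "(real^'n) set \<Rightarrow> complex"
  assumes s: "sigma_additive_bounded \<mu>" and \<nu>: "sigma_additive_bounded \<nu>"
    and le: "\<And>A. \<nu> A \<le> norm (\<mu> A)"
  shows "jordan_pos_part \<nu> \<le> total_variation \<mu>"
proof -
  have "emeasure (jordan_pos_part \<nu>) E \<le> emeasure (total_variation \<mu>) E" if E: "E \<in> sets borel" for E
    unfolding emeasure_jordan_pos_part[OF \<nu> E] pos_variation_def
  proof (rule SUP_least)
    fix A assume A: "A \<in> {A \<in> bounded_borel. A \<subseteq> E}"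
    have "ennreal (\<nu> A) \<le> ennreal (norm (\<mu> A))" by (intro ennreal_leI le)
    also have "\<dots> \<le> emeasure (total_variation \<mu>) A" using A by (intro norm_le_total_variation[OF s]) auto
    also have "\<dots> \<le> emeasure (total_variation \<mu>) E" using A E by (intro emeasure_mono) auto
    finally show "ennreal (\<nu> A) \<le> emeasure (total_variation \<mu>) E" .
  qed
  then show ?thesis by (subst le_measure) auto
qed

lemma complex_radon_sigma_additive:
  "complex_radon_measure \<mu> \<Longrightarrow> sigma_additive_bounded \<mu>"
  unfolding complex_radon_measure_def sigma_additive_bounded_def by blast

section \<open>Densities with respect to a common base measure\<close>

lemma sigma_finite_borel_cball:
  fixes M :: "'a::euclidean_space measure"
  assumes "sets M = sets borel" "\<And>n::nat. emeasure M (cball 0 (real n)) < \<infinity>"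
  shows "sigma_finite_measure M"
proof
  have "(\<Union>n. cball (0::'a) (real n)) = UNIV"
    using real_arch_simple by auto
  then show "\<exists>A. countable A \<and> A \<subseteq> sets M \<and> \<Union>A = space M \<and> (\<forall>a\<in>A. emeasure M a \<noteq> \<infinity>)"
    using assms sets_eq_imp_space_eq[OF assms(1)]
    by (intro exI[of _ "range (\<lambda>n. cball (0::'a) (real n))"]) (auto simp: less_top)
qed

text \<open>Domination gives absolute continuity, and sigma-finiteness of \<open>N\<close> makes the
  Radon-Nikodym derivative finite almost everywhere, so that it has a real-valued version.\<close>

lemma real_density_of_le:
  assumes \<Lambda>: "sigma_finite_measure \<Lambda>" and N: "sigma_finite_measure N" and le: "N \<le> \<Lambda>" and sets: "sets N = sets \<Lambda>"
  obtains p :: "'a \<Rightarrow> real" where "p \<in> borel_measurable \<Lambda>" "\<And>x. 0 \<le> p x" "density \<Lambda> (\<lambda>x. ennreal (p x)) = N"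
proof -
  interpret sigma_finite_measure \<Lambda> by fact
  have le': "emeasure N A \<le> emeasure \<Lambda> A" for A
    using le sets by (metis le_measure emeasure_notin_sets order_refl)
  have ac: "absolutely_continuous \<Lambda> N"
    unfolding absolutely_continuous_def using le' sets
    by (auto simp: null_sets_def) (metis le_zero_eq)
  define p where "p x = enn2real (RN_deriv \<Lambda> N x)" for x
  have "density \<Lambda> (\<lambda>x. ennreal (p x)) = density \<Lambda> (RN_deriv \<Lambda> N)"
    using RN_deriv_finite[OF N ac sets] by (intro density_cong) (auto simp: p_def less_top)
  also have "\<dots> = N" by (rule density_RN_deriv[OF ac sets])
  finally show ?thesis using borel_measurable_enn2real[OF borel_measurable_RN_deriv[of \<Lambda> N]]
    by (intro that[of p]) (simp_all add: p_def[abs_def])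
qed

lemma emeasure_sum_measure:
  fixes M N :: "'a::topological_space measure"
  assumes [simp]: "sets M = sets borel" "sets N = sets borel" and E: "E \<in> sets borel"
  shows "emeasure (measure_of UNIV (sets borel) (\<lambda>E. emeasure M E + emeasure N E)) E = emeasure M E + emeasure N E"
proof (rule emeasure_measure_of_superadditive[OF _ _ _ E])
  fix A B :: "'a set" assume "A \<in> sets borel" "B \<in> sets borel" "A \<inter> B = {}"
  then show "emeasure M A + emeasure N A + (emeasure M B + emeasure N B) \<le> emeasure M (A \<union> B) + emeasure N (A \<union> B)"
    by (simp add: plus_emeasure[symmetric] algebra_simps)
next
  fix A :: "nat \<Rightarrow> 'a set" assume "range A \<subseteq> sets borel" "disjoint_family A"
  then show "emeasure M (\<Union> (range A)) + emeasure N (\<Union> (range A)) \<le> (\<Sum>i. emeasure M (A i) + emeasure N (A i))"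
    by (simp add: suminf_add[symmetric] suminf_emeasure)
qed simp

lemma emeasure_total_variation_bounded:
  fixes \<mu> :: "(real^'n) set \<Rightarrow> complex"
  assumes "complex_radon_measure \<mu>" "bounded A"
  shows "emeasure (total_variation \<mu>) A < \<infinity>"
proof -
  have "emeasure (total_variation \<mu>) A \<le> emeasure (total_variation \<mu>) (closure A)"
    by (intro emeasure_mono closure_subset) auto
  also have "\<dots> < \<infinity>"
    using assms by (auto simp: complex_radon_measure_def compact_closure)
  finally show ?thesis .
qed

lemma sigma_additive_bounded_Re_Im:
  fixes \<mu> :: "(real^'n) set \<Rightarrow> complex"
  assumes "sigma_additive_bounded \<mu>"
  shows "sigma_additive_bounded (\<lambda>A. Re (\<mu> A))" "sigma_additive_bounded (\<lambda>A. Im (\<mu> A))"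
    "sigma_additive_bounded (\<lambda>A. - Re (\<mu> A))" "sigma_additive_bounded (\<lambda>A. - Im (\<mu> A))"
  using assms unfolding sigma_additive_bounded_def by (auto intro!: sums_Re sums_Im sums_minus)

lemma measure_jordan_pos_part_diff:
  fixes \<nu> :: "(real^'n) set \<Rightarrow> real"
  assumes s: "sigma_additive_bounded \<nu>" and A: "A \<in> bounded_borel"
    and fin: "emeasure (jordan_pos_part \<nu>) A < \<infinity>" "emeasure (jordan_pos_part (\<lambda>A. - \<nu> A)) A < \<infinity>"
  shows "measure (jordan_pos_part \<nu>) A - measure (jordan_pos_part (\<lambda>A. - \<nu> A)) A = \<nu> A"
proof -
  from fin have e: "emeasure (jordan_pos_part \<nu>) A = ennreal (measure (jordan_pos_part \<nu>) A)"
    "emeasure (jordan_pos_part (\<lambda>A. - \<nu> A)) A = ennreal (measure (jordan_pos_part (\<lambda>A. - \<nu> A)) A)"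
    by (auto intro!: emeasure_eq_ennreal_measure simp: less_top)
  show ?thesis
  proof (cases "\<nu> A \<ge> 0")
    case True
    then have "ennreal (measure (jordan_pos_part (\<lambda>A. - \<nu> A)) A + \<nu> A) = ennreal (measure (jordan_pos_part \<nu>) A)"
      using emeasure_jordan_pos_part_diff[OF s A] by (simp add: e ennreal_neg)
    then show ?thesis using True by (subst (asm) ennreal_inj) auto
  next
    case False
    then have "ennreal (measure (jordan_pos_part (\<lambda>A. - \<nu> A)) A) = ennreal (measure (jordan_pos_part \<nu>) A + (- \<nu> A))"
      using emeasure_jordan_pos_part_diff[OF s A] by (subst ennreal_plus) (simp_all add: e ennreal_neg)
    moreover have "0 \<le> measure (jordan_pos_part \<nu>) A + (- \<nu> A)"
      using False by (intro add_nonneg_nonneg) auto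
    ultimately show ?thesis by (subst (asm) ennreal_inj) auto
  qed
qed

text \<open>Integrability is tested against the larger measure \<open>T\<close>, where the growth
  condition lives, and the integral is moved to the base measure. In the application
  \<open>T\<close> is the total variation and \<open>P\<close> a Jordan part.\<close>

lemma integral_density_of_le:
  fixes f :: "'a::topological_space \<Rightarrow> complex"
  assumes [measurable_cong, simp]: "sets \<Lambda> = sets borel" and p[measurable]: "p \<in> borel_measurable borel" "\<And>x. 0 \<le> p x"
    and P: "density \<Lambda> (\<lambda>x. ennreal (p x)) = P" and le: "P \<le> T" "sets T = sets borel"
    and f[measurable]: "f \<in> borel_measurable borel" and fin: "(\<integral>\<^sup>+x. ennreal (norm (f x)) \<partial>T) < \<infinity>"
  shows "integrable \<Lambda> (\<lambda>x. p x *\<^sub>R f x)" "integral\<^sup>L P f = (LINT x|\<Lambda>. p x *\<^sub>R f x)"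
proof -
  have setsP: "sets P = sets borel" using P by (metis assms(1) sets_density)
  have f': "f \<in> borel_measurable P" using f setsP by (simp cong: measurable_cong_sets)
  have p': "p \<in> borel_measurable \<Lambda>" "f \<in> borel_measurable \<Lambda>" by measurable
  have "(\<integral>\<^sup>+x. ennreal (norm (f x)) \<partial>P) \<le> (\<integral>\<^sup>+x. ennreal (norm (f x)) \<partial>T)"
    using le setsP by (intro nn_integral_mono_measure) auto
  then have "integrable P f" using f' fin by (auto simp: integrable_iff_bounded)
  then show "integrable \<Lambda> (\<lambda>x. p x *\<^sub>R f x)"
    using p' p(2) unfolding P[symmetric] by (subst (asm) integrable_density) auto
  show "integral\<^sup>L P f = (LINT x|\<Lambda>. p x *\<^sub>R f x)"
    using p' p(2) unfolding P[symmetric] by (intro integral_density) auto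
qed

text \<open>One base measure carries both Lebesgue measure, with density \<open>\<sigma>\<close>,
  and \<open>\<mu>\<close>, with density \<open>h\<close>. The factor 4 in
  \<open>nn_integral_h\<close> counts the Jordan parts, each dominated by the total
  variation.\<close>

locale radon_density =
  fixes \<mu> :: "(real^'n) set \<Rightarrow> complex" and \<Lambda> :: "(real^'n) measure"
    and \<sigma> :: "real^'n \<Rightarrow> real" and h :: "real^'n \<Rightarrow> complex"
  assumes sets_base [measurable_cong, simp]: "sets \<Lambda> = sets borel"
    and \<sigma>_borel [measurable]: "\<sigma> \<in> borel_measurable borel" and \<sigma>_nonneg: "\<And>x. 0 \<le> \<sigma> x"
    and density_\<sigma>: "density \<Lambda> (\<lambda>x. ennreal (\<sigma> x)) = lborel"
    and h_borel [measurable]: "h \<in> borel_measurable borel"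
    and nn_integral_h: "\<And>g. g \<in> borel_measurable borel \<Longrightarrow>
       (\<integral>\<^sup>+x. g x * ennreal (norm (h x)) \<partial>\<Lambda>) \<le> 4 * (\<integral>\<^sup>+x. g x \<partial>total_variation \<mu>)"
    and integral_h: "\<And>f. f \<in> borel_measurable borel \<Longrightarrow> (\<integral>\<^sup>+x. ennreal (norm (f x)) \<partial>total_variation \<mu>) < \<infinity> \<Longrightarrow>
       integrable \<Lambda> (\<lambda>x. f x * h x) \<and> radon_integral \<mu> f = (LINT x|\<Lambda>. f x * h x)"
    and \<mu>_h: "\<And>A. A \<in> bounded_borel \<Longrightarrow> set_integrable \<Lambda> A h \<and> \<mu> A = (LINT x:A|\<Lambda>. h x)"

text \<open>Lebesgue measure and each Jordan part lie below the sum of total variation and Lebesgue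
  measure, so all have densities with respect to it; \<open>h\<close> recombines the four Jordan
  densities.\<close>

lemma complex_radon_density:
  fixes \<mu> :: "(real^'n) set \<Rightarrow> complex"
  assumes \<mu>: "complex_radon_measure \<mu>"
  obtains \<Lambda> \<sigma> h where "radon_density \<mu> \<Lambda> \<sigma> h"
proof -
  define T where "T = total_variation \<mu>"
  define \<Lambda> where "\<Lambda> = measure_of UNIV (sets borel) (\<lambda>E. emeasure T E + emeasure lborel E)"
  have sT [measurable_cong, simp]: "sets T = sets borel" by (simp add: T_def)
  have s\<Lambda> [measurable_cong, simp]: "sets \<Lambda> = sets borel"
    unfolding \<Lambda>_def using sets.sets_measure_of_eq[of borel] by simp
  have e\<Lambda>: "emeasure \<Lambda> E = emeasure T E + emeasure lborel E" if "E \<in> sets borel" for E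
    unfolding \<Lambda>_def using that by (intro emeasure_sum_measure) auto
  note s = complex_radon_sigma_additive[OF \<mu>]
  note sri = sigma_additive_bounded_Re_Im[OF s]
  have Tfin: "emeasure T (cball 0 (real n)) < \<infinity>" for n
    unfolding T_def by (intro emeasure_total_variation_bounded[OF \<mu>]) auto
  have Lfin: "emeasure lborel (cball (0::real^'n) (real n)) < \<infinity>" for n
    by (intro emeasure_lborel_cball_finite)
  have sf\<Lambda>: "sigma_finite_measure \<Lambda>"
    using Tfin Lfin by (intro sigma_finite_borel_cball) (auto simp: e\<Lambda> less_top)
  have T\<Lambda>: "T \<le> \<Lambda>" by (subst le_measure) (auto simp: e\<Lambda>)
  have L\<Lambda>: "lborel \<le> \<Lambda>" by (subst le_measure) (auto simp: e\<Lambda>)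
  obtain \<sigma> where \<sigma>: "\<sigma> \<in> borel_measurable \<Lambda>" "\<And>x. 0 \<le> \<sigma> x" "density \<Lambda> (\<lambda>x. ennreal (\<sigma> x)) = lborel"
    using real_density_of_le[OF sf\<Lambda> sigma_finite_lborel L\<Lambda>] by (metis s\<Lambda> sets_lborel)
  have part: "\<exists>p. p \<in> borel_measurable borel \<and> (\<forall>x. 0 \<le> p x) \<and> density \<Lambda> (\<lambda>x. ennreal (p x)) = jordan_pos_part \<nu>"
    if le: "jordan_pos_part \<nu> \<le> T" for \<nu> :: "(real^'n) set \<Rightarrow> real"
  proof -
    have "emeasure (jordan_pos_part \<nu>) (cball 0 (real n)) \<le> emeasure T (cball 0 (real n))" for n
      using le by (subst (asm) le_measure) auto
    then have "sigma_finite_measure (jordan_pos_part \<nu>)"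
      using Tfin by (intro sigma_finite_borel_cball) (auto intro: le_less_trans)
    then show ?thesis
      using real_density_of_le[OF sf\<Lambda>, of "jordan_pos_part \<nu>"] order_trans[OF le T\<Lambda>] s\<Lambda>
      by (metis measurable_cong_sets sets_jordan_pos_part)
  qed
  have leT: "jordan_pos_part (\<lambda>A. Re (\<mu> A)) \<le> T" "jordan_pos_part (\<lambda>A. - Re (\<mu> A)) \<le> T"
    "jordan_pos_part (\<lambda>A. Im (\<mu> A)) \<le> T" "jordan_pos_part (\<lambda>A. - Im (\<mu> A)) \<le> T"
    unfolding T_def
    by (rule jordan_pos_part_le_total_variation[OF s];
        use sri abs_Re_le_cmod abs_Im_le_cmod abs_le_D1 abs_le_D2 in blast)+
  obtain p1 where p1: "p1 \<in> borel_measurable borel" "\<And>x. 0 \<le> p1 x" "density \<Lambda> (\<lambda>x. ennreal (p1 x)) = jordan_pos_part (\<lambda>A. Re (\<mu> A))"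
    using part[OF leT(1)] by auto
  obtain n1 where n1: "n1 \<in> borel_measurable borel" "\<And>x. 0 \<le> n1 x" "density \<Lambda> (\<lambda>x. ennreal (n1 x)) = jordan_pos_part (\<lambda>A. - Re (\<mu> A))"
    using part[OF leT(2)] by auto
  obtain p2 where p2: "p2 \<in> borel_measurable borel" "\<And>x. 0 \<le> p2 x" "density \<Lambda> (\<lambda>x. ennreal (p2 x)) = jordan_pos_part (\<lambda>A. Im (\<mu> A))"
    using part[OF leT(3)] by auto
  obtain n2 where n2: "n2 \<in> borel_measurable borel" "\<And>x. 0 \<le> n2 x" "density \<Lambda> (\<lambda>x. ennreal (n2 x)) = jordan_pos_part (\<lambda>A. - Im (\<mu> A))"
    using part[OF leT(4)] by auto
  note [measurable] = p1(1) n1(1) p2(1) n2(1)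
  define h where "h x = Complex (p1 x - n1 x) (p2 x - n2 x)" for x
  have h_eq: "h x = of_real (p1 x) - of_real (n1 x) + \<i> * (of_real (p2 x) - of_real (n2 x))" for x
    by (simp add: h_def complex_eq_iff)
  have h[measurable]: "h \<in> borel_measurable borel" unfolding h_eq[abs_def] by measurable
  have h_norm: "norm (h x) \<le> p1 x + n1 x + p2 x + n2 x" for x
    using norm_triangle_ineq[of "of_real (p1 x) - of_real (n1 x)" "\<i> * (of_real (p2 x) - of_real (n2 x))"]
      norm_triangle_ineq4[of "complex_of_real (p1 x)" "of_real (n1 x)"]
      norm_triangle_ineq4[of "complex_of_real (p2 x)" "of_real (n2 x)"] p1(2)[of x] n1(2)[of x] p2(2)[of x] n2(2)[of x]
    unfolding h_eq norm_mult by simp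
  have nn: "(\<integral>\<^sup>+x. g x * ennreal (p x) \<partial>\<Lambda>) \<le> (\<integral>\<^sup>+x. g x \<partial>T)"
    if "g \<in> borel_measurable borel" "p \<in> borel_measurable borel" "density \<Lambda> (\<lambda>x. ennreal (p x)) = jordan_pos_part \<nu>" "jordan_pos_part \<nu> \<le> T"
    for g p \<nu>
  proof -
    note [measurable] = that(1,2)
    have "(\<integral>\<^sup>+x. g x * ennreal (p x) \<partial>\<Lambda>) = (\<integral>\<^sup>+x. g x \<partial>density \<Lambda> (\<lambda>x. ennreal (p x)))"
      by (subst nn_integral_density) (auto simp: mult.commute)
    also have "\<dots> \<le> (\<integral>\<^sup>+x. g x \<partial>T)"
      unfolding that(3) using that(4) by (intro nn_integral_mono_measure) auto
    finally show ?thesis .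
  qed
  have 6: "(\<integral>\<^sup>+x. g x * ennreal (norm (h x)) \<partial>\<Lambda>) \<le> 4 * (\<integral>\<^sup>+x. g x \<partial>T)"
    if g[measurable]: "g \<in> borel_measurable borel" for g
  proof -
    have "(\<integral>\<^sup>+x. g x * ennreal (norm (h x)) \<partial>\<Lambda>)
        \<le> (\<integral>\<^sup>+x. g x * ennreal (p1 x) + g x * ennreal (n1 x) + g x * ennreal (p2 x) + g x * ennreal (n2 x) \<partial>\<Lambda>)"
    proof (rule nn_integral_mono)
      fix x
      have "ennreal (norm (h x)) \<le> ennreal (p1 x + n1 x + p2 x + n2 x)"
        by (intro ennreal_leI h_norm)
      also have "\<dots> = ennreal (p1 x) + ennreal (n1 x) + ennreal (p2 x) + ennreal (n2 x)"
        using p1(2) n1(2) p2(2) n2(2) by simp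
      finally have "g x * ennreal (norm (h x)) \<le> g x * (ennreal (p1 x) + ennreal (n1 x) + ennreal (p2 x) + ennreal (n2 x))"
        by (rule mult_left_mono) simp
      then show "g x * ennreal (norm (h x)) \<le> g x * ennreal (p1 x) + g x * ennreal (n1 x) + g x * ennreal (p2 x) + g x * ennreal (n2 x)"
        by (simp add: distrib_left)
    qed
    also have "\<dots> = (\<integral>\<^sup>+x. g x * ennreal (p1 x) \<partial>\<Lambda>) + (\<integral>\<^sup>+x. g x * ennreal (n1 x) \<partial>\<Lambda>)
        + (\<integral>\<^sup>+x. g x * ennreal (p2 x) \<partial>\<Lambda>) + (\<integral>\<^sup>+x. g x * ennreal (n2 x) \<partial>\<Lambda>)"
      by (simp add: nn_integral_add)
    also have "\<dots> \<le> (\<integral>\<^sup>+x. g x \<partial>T) + (\<integral>\<^sup>+x. g x \<partial>T) + (\<integral>\<^sup>+x. g x \<partial>T) + (\<integral>\<^sup>+x. g x \<partial>T)"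
      by (intro add_mono nn[OF g p1(1,3) leT(1)] nn[OF g n1(1,3) leT(2)] nn[OF g p2(1,3) leT(3)] nn[OF g n2(1,3) leT(4)])
    also have "\<dots> = (1 + 1 + 1 + 1) * (\<integral>\<^sup>+x. g x \<partial>T)"
      by (simp only: distrib_right mult_1)
    finally show ?thesis by simp
  qed
  have 7: "integrable \<Lambda> (\<lambda>x. f x * h x) \<and> radon_integral \<mu> f = (LINT x|\<Lambda>. f x * h x)"
    if f: "f \<in> borel_measurable borel" and fin: "(\<integral>\<^sup>+x. ennreal (norm (f x)) \<partial>T) < \<infinity>" for f
  proof -
    note i1 = integral_density_of_le[OF s\<Lambda> p1 leT(1) sT f fin]
    note j1 = integral_density_of_le[OF s\<Lambda> n1 leT(2) sT f fin]
    note i2 = integral_density_of_le[OF s\<Lambda> p2 leT(3) sT f fin]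
    note j2 = integral_density_of_le[OF s\<Lambda> n2 leT(4) sT f fin]
    have eq: "f x * h x = (p1 x *\<^sub>R f x - n1 x *\<^sub>R f x) + \<i> * (p2 x *\<^sub>R f x - n2 x *\<^sub>R f x)" for x
      unfolding h_eq by (simp add: algebra_simps scaleR_conv_of_real)
    show ?thesis
      unfolding eq radon_integral_def signed_integral_def i1(2) j1(2) i2(2) j2(2)
      using i1(1) j1(1) i2(1) j2(1) by simp
  qed
  have 8: "set_integrable \<Lambda> A h \<and> \<mu> A = (LINT x:A|\<Lambda>. h x)" if A: "A \<in> bounded_borel" for A
  proof -
    have [measurable]: "A \<in> sets borel" using A by simp
    have fA: "emeasure T A < \<infinity>"
      unfolding T_def using A by (intro emeasure_total_variation_bounded[OF \<mu>] bounded_borel_bounded)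
    have fin: "emeasure (jordan_pos_part \<nu>) A < \<infinity>" if "jordan_pos_part \<nu> \<le> T" for \<nu>
      using that fA A by (subst (asm) le_measure) (auto intro: le_less_trans)
    let ?f = "\<lambda>x. indicator A x :: complex"
    have "(\<integral>\<^sup>+x. ennreal (norm (?f x)) \<partial>T) = emeasure T A"
      proof -
      have "(\<lambda>x. ennreal (norm (?f x))) = indicator A" by (auto simp: indicator_def)
      then show ?thesis by simp
    qed
    then have *: "integrable \<Lambda> (\<lambda>x. ?f x * h x)" "radon_integral \<mu> ?f = (LINT x|\<Lambda>. ?f x * h x)"
      using 7[of ?f] fA by auto
    have int: "(LINT x|jordan_pos_part \<nu>. ?f x) = of_real (measure (jordan_pos_part \<nu>) A)" for \<nu> :: "(real^'n) set \<Rightarrow> real"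
    proof -
      have "(LINT x|jordan_pos_part \<nu>. ?f x) = (LINT x|jordan_pos_part \<nu>. of_real (indicator A x))"
        by (intro Bochner_Integration.integral_cong) (auto simp: indicator_def)
      also have "\<dots> = of_real (LINT x|jordan_pos_part \<nu>. indicator A x)"
        by (rule integral_complex_of_real)
      also have "(LINT x|jordan_pos_part \<nu>. indicator A x) = measure (jordan_pos_part \<nu>) A"
        using sets_eq_imp_space_eq[OF sets_jordan_pos_part[of \<nu>]] by simp
      finally show ?thesis .
    qed
    \<comment> \<open>\<open>radon_integral\<close> knows only the Jordan parts; tested on an
      indicator it returns \<open>\<mu> A\<close> by the Jordan identity, and this ties
      \<open>h\<close> to the values of \<open>\<mu>\<close>.\<close>
    have "radon_integral \<mu> ?f = of_real (Re (\<mu> A)) + \<i> * of_real (Im (\<mu> A))"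
      unfolding radon_integral_def signed_integral_def int
        measure_jordan_pos_part_diff[OF sri(1) A fin[OF leT(1)] fin[OF leT(2)], symmetric]
        measure_jordan_pos_part_diff[OF sri(2) A fin[OF leT(3)] fin[OF leT(4)], symmetric]
      by simp
    also have "\<dots> = \<mu> A" by (simp add: complex_eq[symmetric])
    finally have "\<mu> A = (LINT x|\<Lambda>. ?f x * h x)" using * by simp
    moreover have "?f x * h x = indicator A x *\<^sub>R h x" for x by (auto simp: indicator_def)
    ultimately show ?thesis using *(1) by (simp add: set_integrable_def set_lebesgue_integral_def)
  qed
  have \<sigma>': "\<sigma> \<in> borel_measurable borel" using \<sigma>(1) s\<Lambda> by (metis measurable_cong_sets)
  have "radon_density \<mu> \<Lambda> \<sigma> h"
    by (rule radon_density.intro[OF s\<Lambda> \<sigma>' \<sigma>(2,3) h 6[unfolded T_def] 7[unfolded T_def] 8])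
  then show thesis by (rule that)
qed

section \<open>Differentiation of Radon measures\<close>

lemma measure_lebesgue_cball:
  "0 \<le> r \<Longrightarrow> measure lebesgue (cball (x::real^'n) r) = unit_ball_vol CARD('n) * r ^ CARD('n)"
  using content_cball[of r x] by simp

text \<open>A bad point of \<open>A\<close> has arbitrarily small balls of mass more than c r^n.
  Disjoint balls of this kind inside an open set of small mass have small total volume, and Vitali
  covering transfers this to the bad points. Only outer measure is estimated, so measurability of
  the bad sets does not come up.\<close>

lemma AE_density_zero:
  fixes lam :: "(real^'n) measure"
  assumes sets[measurable_cong, simp]: "sets lam = sets borel"
    and fin: "\<And>r. emeasure lam (cball 0 r) < \<infinity>"
    and A[measurable]: "A \<in> sets borel" and zero: "emeasure lam A = 0"
  shows "AE x in lebesgue. x \<in> A \<longrightarrow>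
    (\<forall>e>0. \<exists>d>0. \<forall>r. 0 < r \<and> r < d \<longrightarrow> emeasure lam (cball x r) \<le> ennreal (e * r ^ CARD('n)))"
proof -
  let ?n = "CARD('n)"
  define bad where "bad c k = {x \<in> A \<inter> ball 0 (real k). \<forall>d>0. \<exists>r. 0 < r \<and> r < d \<and> emeasure lam (cball x r) > ennreal (c * r ^ ?n)}" for c :: real and k :: nat
  have neg: "negligible (bad c k)" if "c > 0" for c k
    unfolding negligible_outer_le
  proof (intro allI impI)
    fix e :: real assume "e > 0"
    define V where "V = unit_ball_vol (real ?n) * 5 ^ ?n"
    have "V > 0" by (simp add: V_def)
    \<comment> \<open>Makes the final bound \<open>V / c * \<epsilon>\<close> equal to
      \<open>e\<close>; \<open>V\<close> already contains the factor 5^n lost in the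
      covering.\<close>
    define \<epsilon> where "\<epsilon> = e * c / V"
    have "\<epsilon> > 0" using \<open>V > 0\<close> \<open>e > 0\<close> \<open>c > 0\<close> by (simp add: \<epsilon>_def)
    \<comment> \<open>Outer regularity is applied to a finite measure, so \<open>lam\<close> is cut
      down to a ball; this is why the bad points are sorted by \<open>k\<close>.\<close>
    define lam' where "lam' = density lam (indicator (ball 0 (real k)))"
    have [simp, measurable_cong]: "sets lam' = sets borel" by (simp add: lam'_def)
    have e': "emeasure lam' S = emeasure lam (S \<inter> ball 0 (real k))" if [measurable]: "S \<in> sets borel" for S
    proof -
      have "emeasure lam' S = (\<integral>\<^sup>+x. indicator (ball 0 (real k)) x * indicator S x \<partial>lam)"
        unfolding lam'_def by (rule emeasure_density) (simp_all add: borel_measurable_indicator that)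
      also have "\<dots> = (\<integral>\<^sup>+x. indicator (S \<inter> ball 0 (real k)) x \<partial>lam)"
        by (intro nn_integral_cong) (auto simp: indicator_def)
      finally show ?thesis using that by simp
    qed
    have "emeasure lam (ball 0 (real k)) \<le> emeasure lam (cball 0 (real k))"
      by (intro emeasure_mono) auto
    then have "emeasure lam (ball 0 (real k)) < \<infinity>"
      using fin by (rule le_less_trans)
    then have "emeasure lam' (space lam') \<noteq> \<infinity>"
      using sets_eq_imp_space_eq[of lam' borel] by (simp add: e' less_top)
    then have "emeasure lam' (A \<inter> ball 0 (real k)) = (INF U \<in> {U. A \<inter> ball 0 (real k) \<subseteq> U \<and> open U}. emeasure lam' U)"
      by (intro outer_regular) auto
    moreover have "emeasure lam' (A \<inter> ball 0 (real k)) = 0"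
    proof -
      have "emeasure lam' (A \<inter> ball 0 (real k)) \<le> emeasure lam A"
        by (subst e') (auto intro!: emeasure_mono)
      then show ?thesis by (simp add: zero)
    qed
    ultimately have "(INF U \<in> {U. A \<inter> ball 0 (real k) \<subseteq> U \<and> open U}. emeasure lam' U) < ennreal \<epsilon>"
      using \<open>\<epsilon> > 0\<close> by simp
    then obtain U0 where U0: "A \<inter> ball 0 (real k) \<subseteq> U0" "open U0" "emeasure lam' U0 < ennreal \<epsilon>"
      by (auto simp: INF_less_iff)
    define U where "U = U0 \<inter> ball 0 (real k)"
    have U: "A \<inter> ball 0 (real k) \<subseteq> U" "open U" "emeasure lam U < ennreal \<epsilon>"
      using U0 e'[of U0] by (auto simp: U_def)
    have "\<exists>r. 0 < r \<and> r \<le> 1 \<and> cball x r \<subseteq> U \<and> emeasure lam (cball x r) > ennreal (c * r ^ ?n)" if x: "x \<in> bad c k" for x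
    proof -
      have "x \<in> U" using x U(1) by (auto simp: bad_def)
      then obtain d where d: "d > 0" "cball x d \<subseteq> U" using U(2) open_contains_cball by blast
      then obtain r where r: "0 < r" "r < min d 1" "emeasure lam (cball x r) > ennreal (c * r ^ ?n)"
      proof -
        have "\<forall>d>0. \<exists>r. 0 < r \<and> r < d \<and> emeasure lam (cball x r) > ennreal (c * r ^ ?n)"
          using x by (simp add: bad_def)
        then show ?thesis using \<open>d > 0\<close> that by (elim allE[of _ "min d 1"]) auto
      qed
      then show ?thesis using d by (intro exI[of _ r]) auto
    qed
 
    then have "\<exists>r. \<forall>x\<in>bad c k. 0 < r x \<and> r x \<le> 1 \<and> cball x (r x) \<subseteq> U \<and> emeasure lam (cball x (r x)) > ennreal (c * r x ^ ?n)"
      by (intro bchoice) blast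
    then obtain r where r: "0 < r x" "r x \<le> 1" "cball x (r x) \<subseteq> U" "emeasure lam (cball x (r x)) > ennreal (c * r x ^ ?n)"
      if "x \<in> bad c k" for x
      by blast
    have cov: "bad c k \<subseteq> (\<Union>x\<in>bad c k. cball x (r x))" using r(1) by fastforce
    \<comment> \<open>The radii are at most 1, so Vitali's lemma yields disjoint balls whose
      fivefold enlargements still cover the bad points.\<close>
    obtain C where C: "countable C" "C \<subseteq> bad c k" "pairwise (\<lambda>i j. disjnt (cball i (r i)) (cball j (r j))) C"
      "bad c k \<subseteq> (\<Union>i\<in>C. cball i (5 * r i))"
      by (rule Vitali_covering_lemma_cballs[OF cov, of 1]) (use r in auto)
    have bound: "measure lebesgue (\<Union>i\<in>I. cball i (5 * r i)) \<le> e" if I: "I \<subseteq> C" "finite I" for I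
    proof -
      have Ib: "i \<in> bad c k" if "i \<in> I" for i using that I C by auto
      have fU: "emeasure lam S < \<infinity>" if "S \<subseteq> U" for S
      proof -
        have "emeasure lam S \<le> emeasure lam U" using that U(2) by (intro emeasure_mono) auto
        also have "\<dots> < \<infinity>" using U(3) by (metis infinity_ennreal_def less_trans ennreal_less_top)
        finally show ?thesis .
      qed
      have "measure lebesgue (\<Union>i\<in>I. cball i (5 * r i)) \<le> (\<Sum>i\<in>I. measure lebesgue (cball i (5 * r i)))"
        using I by (intro measure_UNION_le) auto
      also have "\<dots> = (\<Sum>i\<in>I. V * r i ^ ?n)"
      proof (intro sum.cong refl)
        fix i assume "i \<in> I"
        then have "0 < r i" by (intro r(1) Ib)
        then have "0 \<le> 5 * r i" by simp
        then show "measure lebesgue (cball i (5 * r i)) = V * r i ^ ?n"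
          by (subst measure_lebesgue_cball) (simp_all add: V_def power_mult_distrib)
      qed
      also have "\<dots> \<le> (\<Sum>i\<in>I. V / c * measure lam (cball i (r i)))"
      proof (rule sum_mono)
        fix i assume i: "i \<in> I"
        have "ennreal (c * r i ^ ?n) < ennreal (measure lam (cball i (r i)))"
          using r(4)[OF Ib[OF i]] fU[OF r(3)[OF Ib[OF i]]] by (simp add: emeasure_eq_ennreal_measure less_top)
        then have "c * r i ^ ?n \<le> measure lam (cball i (r i))"
          using \<open>c > 0\<close> r(1)[OF Ib[OF i]] by (subst (asm) ennreal_less_iff) auto
        then show "V * r i ^ ?n \<le> V / c * measure lam (cball i (r i))"
          using \<open>c > 0\<close> \<open>V > 0\<close> by (simp add: field_simps)
      qed
      also have "\<dots> = V / c * measure lam (\<Union>i\<in>I. cball i (r i))"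
      proof -
        have "measure lam (\<Union>i\<in>I. cball i (r i)) = (\<Sum>i\<in>I. measure lam (cball i (r i)))"
          using I C(3) fU[OF r(3)[OF Ib]]
          by (intro measure_UNION') (auto simp: fmeasurable_def intro: pairwise_subset)
        then show ?thesis by (simp add: sum_distrib_left)
      qed
      also have "\<dots> \<le> V / c * \<epsilon>"
      proof -
        have s: "(\<Union>i\<in>I. cball i (r i)) \<subseteq> U" using r(3)[OF Ib] by blast
        have "emeasure lam (\<Union>i\<in>I. cball i (r i)) \<le> emeasure lam U" using s U(2) by (intro emeasure_mono) auto
        then have "ennreal (measure lam (\<Union>i\<in>I. cball i (r i))) < ennreal \<epsilon>"
          using U(3) fU[OF s] by (simp add: emeasure_eq_ennreal_measure less_top)
        then show ?thesis using \<open>V > 0\<close> \<open>c > 0\<close> by (intro mult_left_mono) (auto simp: ennreal_less_iff)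
      qed
      also have "\<dots> = e" using \<open>V > 0\<close> \<open>c > 0\<close> by (simp add: \<epsilon>_def)
      finally show ?thesis .
    qed
    have m: "i \<in> C \<Longrightarrow> cball i (5 * r i) \<in> lmeasurable" for i by simp
    show "\<exists>T. bad c k \<subseteq> T \<and> T \<in> lmeasurable \<and> measure lebesgue T \<le> e"
      using C(4) fmeasurable_UN_bound[OF C(1) m bound] measure_UN_bound[OF C(1) m bound] by blast
  qed
  have "negligible (\<Union>k. \<Union>m. bad (1 / real (Suc m)) k)"
    by (intro negligible_countable_Union) (auto intro!: neg negligible_Union_nat)
  then have "AE x in lebesgue. x \<notin> (\<Union>k. \<Union>m. bad (1 / real (Suc m)) k)"
    unfolding negligible_iff_null_sets by (rule AE_not_in)
  then show ?thesis
  proof eventually_elim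
    case (elim x)
    show ?case
    proof (intro impI allI)
      fix e :: real assume x: "x \<in> A" "e > 0"
      obtain m where m: "1 / real (Suc m) < e" using nat_approx_posE[OF \<open>e > 0\<close>] by auto
      obtain k where k: "norm x < real k" using reals_Archimedean2 by blast
      have "x \<notin> bad (1 / real (Suc m)) k" using elim by blast
      then have "\<exists>d>0. \<forall>r. 0 < r \<and> r < d \<longrightarrow> \<not> emeasure lam (cball x r) > ennreal (1 / real (Suc m) * r ^ ?n)"
        using x(1) k unfolding bad_def mem_Collect_eq Int_iff mem_ball_0 by blast
      then obtain d where d: "d > 0" "\<And>r. 0 < r \<Longrightarrow> r < d \<Longrightarrow> emeasure lam (cball x r) \<le> ennreal (1 / real (Suc m) * r ^ ?n)"
        unfolding not_less by blast
      have "emeasure lam (cball x r) \<le> ennreal (e * r ^ ?n)" if "0 < r" "r < d" for r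
        using d(2)[OF that] m that(1)
        by (elim order_trans, intro ennreal_leI mult_right_mono) auto
      then show "\<exists>d>0. \<forall>r. 0 < r \<and> r < d \<longrightarrow> emeasure lam (cball x r) \<le> ennreal (e * r ^ ?n)"
        using d(1) by blast
    qed
  qed
qed

text \<open>For \<open>q\<close> close to \<open>g x\<close>, the part of the integral where |g - q|
  is small costs a small multiple of the volume. The rest is the mass of \<open>l q m\<close>, a
  measure vanishing on the set \<open>A q m\<close> that contains \<open>x\<close>, so
  \<open>AE_density_zero\<close> applies. Countability of \<open>D\<close> keeps the exceptional set
  null.\<close>

lemma AE_lebesgue_point:
  fixes g :: "real^'n \<Rightarrow> complex"
  assumes g[measurable]: "g \<in> borel_measurable borel"
    and fin: "\<And>r. (\<integral>\<^sup>+y\<in>cball 0 r. ennreal (norm (g y)) \<partial>lborel) < \<infinity>"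
  shows "AE x in lebesgue. \<forall>e>0. \<exists>d>0. \<forall>r. 0 < r \<and> r < d \<longrightarrow>
     (\<integral>\<^sup>+y\<in>cball x r. ennreal (norm (g y - g x)) \<partial>lborel) \<le> ennreal (e * r ^ CARD('n))"
proof -
  let ?n = "CARD('n)"
  have [measurable]: "cball x r \<in> sets borel" for x :: "real^'n" and r by simp
  obtain D :: "complex set" where D: "countable D" "\<And>Y. open Y \<Longrightarrow> Y \<noteq> {} \<Longrightarrow> \<exists>d\<in>D. d \<in> Y"
    by (rule countable_dense_setE) blast
  define A where "A q m = {x. norm (g x - q) < 1 / real (Suc m)}" for q m
  have A[measurable]: "A q m \<in> sets borel" for q m unfolding A_def by measurable
  define l where "l q m = density lborel (\<lambda>y. indicator (- A q m) y * ennreal (norm (g y - q)))" for q m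
  have el: "emeasure (l q m) S = (\<integral>\<^sup>+y\<in>S. indicator (- A q m) y * ennreal (norm (g y - q)) \<partial>lborel)" if "S \<in> sets borel" for q m S
    unfolding l_def using that by (subst emeasure_density) auto
  have "AE x in lebesgue. \<forall>q\<in>D. \<forall>m. x \<in> A q m \<longrightarrow>
    (\<forall>e>0. \<exists>d>0. \<forall>r. 0 < r \<and> r < d \<longrightarrow> emeasure (l q m) (cball x r) \<le> ennreal (e * r ^ ?n))"
  proof (intro AE_ball_countable[OF D(1), THEN iffD2] ballI AE_all_countable[THEN iffD2] allI AE_density_zero)
    fix q m r
    show "sets (l q m) = sets borel" by (simp add: l_def)
    have "emeasure (l q m) (cball 0 r) \<le> (\<integral>\<^sup>+y. ennreal (norm (g y)) * indicator (cball 0 r) y + ennreal (norm q) * indicator (cball 0 r) y \<partial>lborel)"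
      unfolding el[OF borel_closed[OF closed_cball]]
    proof (rule nn_integral_mono)
      fix y
      have "ennreal (norm (g y - q)) \<le> ennreal (norm (g y)) + ennreal (norm q)"
        using ennreal_leI[OF norm_triangle_ineq4[of "g y" q]] by simp
      then show "indicator (- A q m) y * ennreal (norm (g y - q)) * indicator (cball 0 r) y
          \<le> ennreal (norm (g y)) * indicator (cball 0 r) y + ennreal (norm q) * indicator (cball 0 r) y"
        by (auto simp: indicator_def)
    qed
    also have "\<dots> = (\<integral>\<^sup>+y\<in>cball 0 r. ennreal (norm (g y)) \<partial>lborel) + ennreal (norm q) * emeasure lborel (cball (0::real^'n) r)"
      by (subst nn_integral_add) (auto simp: nn_integral_cmult_indicator)
    also have "\<dots> < \<infinity>"
      using fin[of r] emeasure_lborel_cball_finite[of "0::real^'n" r] by (simp add: ennreal_mult_less_top)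
    finally show "emeasure (l q m) (cball 0 r) < \<infinity>" .
    show "emeasure (l q m) (A q m) = 0"
      unfolding el[OF A] by (subst nn_integral_0_iff_AE) (auto simp: indicator_def)
  qed simp
  then show ?thesis
  proof eventually_elim
    case (elim x)
    show ?case
    proof (intro allI impI)
      fix e :: real assume "e > 0"
      define V where "V = unit_ball_vol (real ?n)"
      have "V > 0" by (simp add: V_def)
      \<comment> \<open>The total error will be c (2 V + 1) r^n: 2 c on a ball of volume V r^n, plus
        c r^n from the restricted measure.\<close>
      then have "e / (2 * V + 1) > 0" using \<open>e > 0\<close> by simp
      then obtain m where m: "1 / real (Suc m) < e / (2 * V + 1)" using nat_approx_posE by metis
      define c where "c = 1 / real (Suc m)"
      have "c > 0" by (simp add: c_def)
      obtain q where q: "q \<in> D" "q \<in> ball (g x) c" using D(2)[of "ball (g x) c"] \<open>c > 0\<close> by auto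
      then have xA: "x \<in> A q m" "norm (q - g x) < c" by (auto simp: A_def c_def dist_norm norm_minus_commute)
      then obtain d where d: "d > 0" "\<And>r. 0 < r \<Longrightarrow> r < d \<Longrightarrow> emeasure (l q m) (cball x r) \<le> ennreal (c * r ^ ?n)"
        using elim[THEN bspec, OF q(1), THEN spec, THEN mp, OF xA(1), THEN spec, THEN mp, OF \<open>c > 0\<close>] by blast
      have "(\<integral>\<^sup>+y\<in>cball x r. ennreal (norm (g y - g x)) \<partial>lborel) \<le> ennreal (e * r ^ ?n)" if r: "0 < r" "r < d" for r
      proof -
        have "(\<integral>\<^sup>+y\<in>cball x r. ennreal (norm (g y - g x)) \<partial>lborel)
          \<le> (\<integral>\<^sup>+y. ennreal (2 * c) * indicator (cball x r) y + indicator (- A q m) y * ennreal (norm (g y - q)) * indicator (cball x r) y \<partial>lborel)"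
        proof (rule nn_integral_mono)
          fix y
          have 1: "norm (g y - g x) \<le> norm (g y - q) + c"
            using norm_triangle_ineq[of "g y - q" "q - g x"] xA(2) by simp
          have "ennreal (norm (g y - g x)) \<le> ennreal (2 * c) + indicator (- A q m) y * ennreal (norm (g y - q))"
          proof (cases "y \<in> A q m")
            case True
            then have "norm (g y - g x) \<le> 2 * c" using 1 by (simp add: A_def c_def)
            then show ?thesis using True by (simp add: ennreal_leI)
          next
            case False
            have "ennreal (norm (g y - g x)) \<le> ennreal (2 * c + norm (g y - q))"
              using 1 \<open>c > 0\<close> by (intro ennreal_leI) auto
            then show ?thesis using False \<open>c > 0\<close> by simp
          qed
          then show "ennreal (norm (g y - g x)) * indicator (cball x r) y
            \<le> ennreal (2 * c) * indicator (cball x r) y + indicator (- A q m) y * ennreal (norm (g y - q)) * indicator (cball x r) y"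
            by (auto simp: indicator_def)
        qed
        also have "\<dots> = ennreal (2 * c) * emeasure lborel (cball x r) + emeasure (l q m) (cball x r)"
          by (subst nn_integral_add) (auto simp: nn_integral_cmult_indicator el)
        also have "\<dots> \<le> ennreal (2 * c) * ennreal (V * r ^ ?n) + ennreal (c * r ^ ?n)"
          using d(2)[OF r] r(1) by (intro add_mono mult_left_mono) (auto simp: emeasure_cball V_def)
        also have "\<dots> = ennreal (c * (2 * V + 1) * r ^ ?n)"
          using \<open>V > 0\<close> \<open>c > 0\<close> r(1) by (simp add: ennreal_mult[symmetric] ennreal_plus[symmetric] algebra_simps del: ennreal_plus)
        also have "\<dots> \<le> ennreal (e * r ^ ?n)"
          using m \<open>V > 0\<close> r(1) unfolding c_def[symmetric]
          by (intro ennreal_leI mult_right_mono) (auto simp: field_simps)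
        finally show ?thesis .
      qed
      then show "\<exists>d>0. \<forall>r. 0 < r \<and> r < d \<longrightarrow>
          (\<integral>\<^sup>+y\<in>cball x r. ennreal (norm (g y - g x)) \<partial>lborel) \<le> ennreal (e * r ^ ?n)"
        using d(1) by blast
    qed
  qed
qed

section \<open>Density points and existence of the Lebesgue decomposition\<close>

text \<open>\<open>f\<close> is merely Lebesgue measurable, while the differentiation lemmas work
  with Borel functions; a Borel function equal to \<open>f\<close> almost everywhere has the same
  integrals over bounded sets.\<close>

lemma locally_integrable_borel_version:
  fixes f :: "real^'n \<Rightarrow> complex"
  assumes f: "locally_integrable f"
  obtains g where "g \<in> borel_measurable borel" "AE x in lebesgue. f x = g x"
    "\<And>B. B \<in> bounded_borel \<Longrightarrow> set_integrable lborel B g \<and> (LINT x:B|lebesgue. f x) = (LINT x:B|lborel. g x)"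
    "\<And>r. (\<integral>\<^sup>+y\<in>cball 0 r. ennreal (norm (g y)) \<partial>lborel) < \<infinity>"
proof -
  \<comment> \<open>Local integrability gives measurability of the truncations to balls, and
    \<open>f\<close> is their pointwise limit.\<close>
  have fm[measurable]: "f \<in> borel_measurable lebesgue"
  proof (rule borel_measurable_LIMSEQ_metric)
    fix i :: nat
    show "(\<lambda>x. indicator (cball 0 (real i)) x *\<^sub>R f x) \<in> borel_measurable lebesgue"
    proof (rule borel_measurable_integrable)
      show "integrable lebesgue (\<lambda>x. indicator (cball 0 (real i)) x *\<^sub>R f x)"
        using f compact_cball unfolding locally_integrable_def set_integrable_def by blast
    qed
  next
    fix x :: "real^'n"
    obtain k where k: "norm x \<le> real k" using real_arch_simple by blast
    have "\<forall>\<^sub>F i in sequentially. indicator (cball 0 (real i)) x *\<^sub>R f x = f x"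
      using eventually_ge_at_top[of k]
      by eventually_elim (use k in \<open>auto simp: indicator_def\<close>)
    then show "(\<lambda>i. indicator (cball 0 (real i)) x *\<^sub>R f x) \<longlonglongrightarrow> f x"
      by (rule tendsto_eventually)
  qed
  have ri: "(\<lambda>x. Re (f x)) \<in> borel_measurable lebesgue" "(\<lambda>x. Im (f x)) \<in> borel_measurable lebesgue"
    by measurable
  obtain u v where uv: "u \<in> borel_measurable lborel" "AE x in lborel. Re (f x) = u x"
    "v \<in> borel_measurable lborel" "AE x in lborel. Im (f x) = v x"
    using completion_ex_borel_measurable_real[OF ri(1)] completion_ex_borel_measurable_real[OF ri(2)] by blast
  define g where "g x = of_real (u x) + \<i> * of_real (v x)" for x
  have [measurable]: "u \<in> borel_measurable borel" "v \<in> borel_measurable borel" using uv by auto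
  have g[measurable]: "g \<in> borel_measurable borel" unfolding g_def by measurable
  have "AE x in lborel. f x = g x"
    using uv(2,4) by eventually_elim (simp add: g_def complex_eq_iff)
  then have fg: "AE x in lebesgue. f x = g x" by (rule AE_completion)
  have B: "set_integrable lborel B g \<and> (LINT x:B|lebesgue. f x) = (LINT x:B|lborel. g x)" if B: "B \<in> bounded_borel" for B
  proof -
    have [measurable]: "B \<in> sets borel" using B by simp
    have [measurable]: "B \<in> sets lebesgue" by simp
    have gl[measurable]: "g \<in> borel_measurable lebesgue" by (simp add: measurable_completion)
    have "set_integrable lebesgue (closure B) f"
      using f bounded_borel_bounded[OF B] by (auto simp: locally_integrable_def compact_closure)
    then have "set_integrable lebesgue B f"
      by (rule set_integrable_subset) (auto simp: closure_subset)
    then have i: "integrable lebesgue (\<lambda>x. indicator B x *\<^sub>R f x)" by (simp add: set_integrable_def)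
    have ae: "AE x in lebesgue. indicator B x *\<^sub>R f x = indicator B x *\<^sub>R g x"
      using fg by eventually_elim simp
    have "integrable lebesgue (\<lambda>x. indicator B x *\<^sub>R g x)"
      using i integrable_cong_AE[OF _ _ ae] by simp
    moreover have "(LINT x|lebesgue. indicator B x *\<^sub>R f x) = (LINT x|lebesgue. indicator B x *\<^sub>R g x)"
      by (rule integral_cong_AE[OF _ _ ae]) measurable
    ultimately show ?thesis
      unfolding set_integrable_def set_lebesgue_integral_def
      by (simp add: integrable_completion integral_completion)
  qed
  have "(\<integral>\<^sup>+y\<in>cball 0 r. ennreal (norm (g y)) \<partial>lborel) < \<infinity>" for r
  proof -
    have "cball (0::real^'n) r \<in> bounded_borel" by (intro bounded_borelI) auto
    then have "integrable lborel (\<lambda>x. indicator (cball 0 r) x *\<^sub>R g x)"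
      using B by (simp add: set_integrable_def)
    then have "(\<integral>\<^sup>+x. ennreal (norm (indicator (cball 0 r) x *\<^sub>R g x)) \<partial>lborel) < \<infinity>"
      by (simp add: integrable_iff_bounded)
    moreover have "ennreal (norm (indicator (cball 0 r) x *\<^sub>R g x)) = ennreal (norm (g x)) * indicator (cball 0 r) x" for x
      by (simp add: indicator_def)
    ultimately show ?thesis by simp
  qed
  with g fg B show thesis using that by blast
qed

lemma AE_has_lebesgue_density:
  fixes f :: "real^'n \<Rightarrow> complex"
  assumes "lebesgue_decomposition \<mu> f \<mu>s"
  shows "AE x in lebesgue. has_lebesgue_density \<mu> x (f x)"
proof -
  let ?n = "CARD('n)"
  from assms have f: "locally_integrable f" and \<mu>s: "complex_radon_measure \<mu>s"
    and sing: "lebesgue_singular \<mu>s" and dec: "\<And>B. B \<in> bounded_borel \<Longrightarrow> \<mu> B = (LINT x:B|lebesgue. f x) + \<mu>s B"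
    by (auto simp: lebesgue_decomposition_def)
  obtain g where g[measurable]: "g \<in> borel_measurable borel" and fg: "AE x in lebesgue. f x = g x"
    and gB: "\<And>B. B \<in> bounded_borel \<Longrightarrow> set_integrable lborel B g \<and> (LINT x:B|lebesgue. f x) = (LINT x:B|lborel. g x)"
    and gfin: "\<And>r. (\<integral>\<^sup>+y\<in>cball 0 r. ennreal (norm (g y)) \<partial>lborel) < \<infinity>"
    by (rule locally_integrable_borel_version[OF f]) blast
  note s = complex_radon_sigma_additive[OF \<mu>s]
  define T where "T = total_variation \<mu>s"
  have sT: "sets T = sets borel" by (simp add: T_def)
  have Tfin: "emeasure T (cball 0 r) < \<infinity>" for r
    unfolding T_def by (intro emeasure_total_variation_bounded[OF \<mu>s]) auto
  obtain N where N: "N \<in> sets borel" "emeasure lebesgue N = 0" "emeasure T (- N) = 0"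
    using sing by (auto simp: lebesgue_singular_def T_def)
  have "N \<in> null_sets lebesgue" using N by (auto simp: null_sets_def)
  then have "AE x in lebesgue. x \<notin> N" by (rule AE_not_in)
  moreover have "AE x in lebesgue. x \<in> - N \<longrightarrow>
    (\<forall>e>0. \<exists>d>0. \<forall>r. 0 < r \<and> r < d \<longrightarrow> emeasure T (cball x r) \<le> ennreal (e * r ^ CARD('n)))"
    using N by (intro AE_density_zero[OF sT Tfin]) auto
  ultimately show ?thesis using AE_lebesgue_point[OF g gfin] fg
  proof eventually_elim
    case (elim x)
    then have T0: "\<And>e. e > 0 \<Longrightarrow> \<exists>d>0. \<forall>r. 0 < r \<and> r < d \<longrightarrow> emeasure T (cball x r) \<le> ennreal (e * r ^ CARD('n))"
      and g0: "\<And>e. e > 0 \<Longrightarrow> \<exists>d>0. \<forall>r. 0 < r \<and> r < d \<longrightarrow>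
          (\<integral>\<^sup>+y\<in>cball x r. ennreal (norm (g y - g x)) \<partial>lborel) \<le> ennreal (e * r ^ CARD('n))"
      and fgx: "f x = g x" by auto
    show ?case
      unfolding has_lebesgue_density_def fgx
    proof (intro allI impI tendstoI)
      fix B and e :: real assume "shrinks_regularly B x" and e: "e > 0"
      then obtain \<epsilon> a where Bb: "\<And>\<nu>. B \<nu> \<in> sets borel" and \<epsilon>: "\<And>\<nu>. \<epsilon> \<nu> > 0" "\<epsilon> \<longlonglongrightarrow> 0"
        and Bs: "\<And>\<nu>. B \<nu> \<subseteq> ball x (\<epsilon> \<nu>)" and a: "a > 0" "\<And>\<nu>. measure lebesgue (B \<nu>) \<ge> a * \<epsilon> \<nu> ^ ?n"
        unfolding shrinks_regularly_def by blast
      \<comment> \<open>Two errors of size e' r^n add up to (e / 2) a r^n, which by regular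
        shrinking is at most e / 2 times the measure of the set; the remaining half makes the
        inequality strict.\<close>
      define e' where "e' = e * a / 4"
      have e': "e' > 0" using e a by (simp add: e'_def)
      obtain d1 where d1: "d1 > 0" "\<And>r. 0 < r \<Longrightarrow> r < d1 \<Longrightarrow> emeasure T (cball x r) \<le> ennreal (e' * r ^ CARD('n))"
        using T0[OF e'] by blast
      obtain d2 where d2: "d2 > 0" "\<And>r. 0 < r \<Longrightarrow> r < d2 \<Longrightarrow> (\<integral>\<^sup>+y\<in>cball x r. ennreal (norm (g y - g x)) \<partial>lborel) \<le> ennreal (e' * r ^ CARD('n))"
        using g0[OF e'] by blast
      have "\<forall>\<^sub>F \<nu> in sequentially. \<epsilon> \<nu> < min d1 d2"
        using order_tendstoD(2)[OF \<epsilon>(2), of "min d1 d2"] d1 d2 by simp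
      then show "\<forall>\<^sub>F \<nu> in sequentially. dist (\<mu> (B \<nu>) / of_real (measure lebesgue (B \<nu>))) (g x) < e"
      proof eventually_elim
        case (elim \<nu>)
        define r where "r = \<epsilon> \<nu>"
        have r: "0 < r" "r < d1" "r < d2" using elim \<epsilon>(1) by (auto simp: r_def)
        define m where "m = measure lebesgue (B \<nu>)"
        have m: "m \<ge> a * r ^ ?n" using a(2) by (simp add: m_def r_def)
        have "m > 0" using m a(1) r(1) by (meson less_le_trans mult_pos_pos zero_less_power)
        have Bc: "B \<nu> \<subseteq> cball x r" using Bs[of \<nu>] ball_subset_cball by (auto simp: r_def)
        have BB: "B \<nu> \<in> bounded_borel" using Bb Bc by (intro bounded_borelI bounded_subset[OF bounded_cball]) auto
        have [measurable]: "B \<nu> \<in> sets borel" "cball x r \<in> sets borel" using Bb by auto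
        have fin: "emeasure lborel (B \<nu>) < \<infinity>"
          using emeasure_bounded_finite[OF bounded_borel_bounded[OF BB]] by simp
        have mB: "m = measure lborel (B \<nu>)" using Bb by (simp add: m_def)
        have ic: "set_integrable lborel (B \<nu>) (\<lambda>y. g x)"
          unfolding set_integrable_def using fin by simp
        have "(LINT y:B \<nu>|lborel. g y - g x) = (LINT y:B \<nu>|lborel. g y) - (LINT y:B \<nu>|lborel. g x)"
          using gB[OF BB] ic by (intro set_integral_diff) auto
        also have "(LINT y:B \<nu>|lborel. g x) = m * g x"
          unfolding set_lebesgue_integral_def using fin by (simp add: mB scaleR_conv_of_real)
        finally have eq: "\<mu> (B \<nu>) - m * g x = (LINT y:B \<nu>|lborel. g y - g x) + \<mu>s (B \<nu>)"
          using dec[OF BB] gB[OF BB] by simp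
        have "ennreal (norm (LINT y:B \<nu>|lborel. g y - g x)) \<le> (\<integral>\<^sup>+y. ennreal (norm (indicator (B \<nu>) y *\<^sub>R (g y - g x))) \<partial>lborel)"
          unfolding set_lebesgue_integral_def
          using set_integral_diff(1)[OF gB[OF BB, THEN conjunct1] ic]
          by (intro integral_norm_bound_ennreal) (simp add: set_integrable_def)
        also have "\<dots> \<le> (\<integral>\<^sup>+y\<in>cball x r. ennreal (norm (g y - g x)) \<partial>lborel)"
          using Bc by (intro nn_integral_mono) (auto simp: indicator_def)
        also have "\<dots> \<le> ennreal (e' * r ^ ?n)" using d2(2)[OF r(1,3)] .
        finally have 1: "norm (LINT y:B \<nu>|lborel. g y - g x) \<le> e' * r ^ ?n"
          using e' r by (subst (asm) ennreal_le_iff) auto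
        have "ennreal (norm (\<mu>s (B \<nu>))) \<le> emeasure T (B \<nu>)"
          unfolding T_def by (rule norm_le_total_variation[OF s BB])
        also have "\<dots> \<le> emeasure T (cball x r)" using Bc sT by (intro emeasure_mono) auto
        also have "\<dots> \<le> ennreal (e' * r ^ ?n)" using d1(2)[OF r(1,2)] .
        finally have 2: "norm (\<mu>s (B \<nu>)) \<le> e' * r ^ ?n"
          using e' r by (subst (asm) ennreal_le_iff) auto
        have "norm (\<mu> (B \<nu>) - m * g x) \<le> 2 * e' * r ^ ?n"
          unfolding eq using norm_triangle_ineq[of "LINT y:B \<nu>|lborel. g y - g x" "\<mu>s (B \<nu>)"] 1 2 by linarith
        also have "\<dots> = e / 2 * (a * r ^ ?n)" by (simp add: e'_def)
        also have "\<dots> \<le> e / 2 * m" using m e by (intro mult_left_mono) auto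
        also have "\<dots> < e * m" using e \<open>m > 0\<close> by simp
        finally have "norm (\<mu> (B \<nu>) - m * g x) / m < e" using \<open>m > 0\<close> by (simp add: divide_less_eq)
        moreover have "\<mu> (B \<nu>) / of_real m - g x = (\<mu> (B \<nu>) - m * g x) / of_real m"
          using \<open>m > 0\<close> by (simp add: field_simps)
        ultimately show ?case using \<open>m > 0\<close> by (simp add: dist_norm norm_divide m_def[symmetric])
      qed
    qed
  qed
qed

text \<open>The zero set of the density \<open>\<sigma>\<close> of Lebesgue measure is Lebesgue null
  and carries the singular part; off it one may divide, f = h / \<sigma>.\<close>

lemma lebesgue_decomposition_exists:
  fixes \<mu> :: "(real^'n) set \<Rightarrow> complex"
  assumes \<mu>: "complex_radon_measure \<mu>"
  shows "\<exists>f \<mu>s. lebesgue_decomposition \<mu> f \<mu>s"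
proof -
  obtain \<Lambda> \<sigma> h where "radon_density \<mu> \<Lambda> \<sigma> h" by (rule complex_radon_density[OF \<mu>])
  then interpret radon_density \<mu> \<Lambda> \<sigma> h .
  note s = complex_radon_sigma_additive[OF \<mu>]
  define N where "N = {x. \<sigma> x = 0}"
  have N[measurable]: "N \<in> sets borel" unfolding N_def by measurable
  define f where "f x = (if \<sigma> x = 0 then 0 else h x / of_real (\<sigma> x))" for x
  have f[measurable]: "f \<in> borel_measurable borel" unfolding f_def by measurable
  define \<mu>s where "\<mu>s B = \<mu> (B \<inter> N)" for B
  have N': "- N \<in> sets borel" using N by (rule borel_comp)
  have part: "set_integrable lborel B f \<and> (LINT x:B|lborel. f x) = \<mu> (B - N)" if B: "B \<in> bounded_borel" for B
  proof -
    have [measurable]: "B \<in> sets borel" using B by simp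
    have eq: "\<sigma> x *\<^sub>R (indicator B x *\<^sub>R f x) = indicator (B - N) x *\<^sub>R h x" for x
      by (auto simp: f_def N_def indicator_def scaleR_conv_of_real)
    have "B - N \<in> bounded_borel" using B N by (rule bounded_borel_Diff)
    note BN = \<mu>_h[OF this]
    let ?F = "\<lambda>x. indicator B x *\<^sub>R f x"
    have "integrable lborel ?F \<longleftrightarrow> integrable \<Lambda> (\<lambda>x. \<sigma> x *\<^sub>R ?F x)"
      unfolding density_\<sigma>[symmetric] by (rule integrable_density) (use \<sigma>_nonneg in auto)
    moreover have "(LINT x|lborel. ?F x) = (LINT x|\<Lambda>. \<sigma> x *\<^sub>R ?F x)"
      unfolding density_\<sigma>[symmetric] by (rule integral_density) (use \<sigma>_nonneg in auto)
    ultimately show ?thesis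
      using BN unfolding set_integrable_def set_lebesgue_integral_def eq by simp
  qed
  have Bs: "B \<inter> N \<in> bounded_borel" if "B \<in> bounded_borel" for B
    using that N by (rule bounded_borel_Int)
  have s': "sigma_additive_bounded \<mu>s"
    unfolding sigma_additive_bounded_def
  proof (intro allI impI)
    fix A :: "nat \<Rightarrow> (real^'n) set"
    assume A: "range A \<subseteq> bounded_borel \<and> disjoint_family A \<and> bounded (\<Union>i. A i)"
    have "(\<Union>i. A i) \<in> bounded_borel" using A by (intro bounded_borelI sets.countable_UN) auto
    then have "(\<lambda>i. \<mu> (((\<Union>i. A i) \<inter> N) \<inter> A i)) sums \<mu> ((\<Union>i. A i) \<inter> N)"
      using A by (intro sigma_additive_bounded_sums_Int[OF s] Bs) auto
    moreover have "((\<Union>i. A i) \<inter> N) \<inter> A i = A i \<inter> N" for i by blast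
    ultimately show "(\<lambda>i. \<mu>s (A i)) sums \<mu>s (\<Union>i. A i)" by (simp add: \<mu>s_def)
  qed
  \<comment> \<open>Cutting a partition of \<open>E\<close> by \<open>N\<close> gives a partition of
    \<open>E \<inter> N\<close> with the same sum. Taking \<open>E = - N\<close> yields singularity,
    compact \<open>E\<close> finiteness.\<close>
  have tv: "emeasure (total_variation \<mu>s) E \<le> emeasure (total_variation \<mu>) (E \<inter> N)" if E: "E \<in> sets borel" for E
  proof -
    have EN: "E \<inter> N \<in> sets borel" using E N by auto
    show ?thesis
      unfolding emeasure_total_variation[OF s' E] emeasure_total_variation[OF s EN] variation_def[of \<mu>s]
    proof (rule SUP_least)
      fix A assume A: "A \<in> bounded_partitions E"
      have "(\<lambda>i. A i \<inter> N) \<in> bounded_partitions (E \<inter> N)"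
      proof -
        have "range (\<lambda>i. A i \<inter> N) \<subseteq> bounded_borel" using A Bs by (auto simp: bounded_partitions_def)
        moreover have "disjoint_family (\<lambda>i. A i \<inter> N)"
          using A unfolding disjoint_family_on_def bounded_partitions_def by blast
        moreover have "(\<Union>i. A i \<inter> N) = E \<inter> N" using A by (auto simp: bounded_partitions_def)
        ultimately show ?thesis by (simp add: bounded_partitions_def)
      qed
      then show "(\<Sum>i. ennreal (norm (\<mu>s (A i)))) \<le> variation \<mu> (E \<inter> N)"
        unfolding variation_def \<mu>s_def by (rule SUP_upper2) simp
    qed
  qed
  have "lebesgue_decomposition \<mu> f \<mu>s"
    unfolding lebesgue_decomposition_def
  proof (intro conjI ballI)
    have li: "set_integrable lebesgue B f \<and> (LINT x:B|lebesgue. f x) = \<mu> (B - N)" if B: "B \<in> bounded_borel" for B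
    proof -
      have [measurable]: "B \<in> sets borel" using B by simp
      show ?thesis using part[OF B] unfolding set_integrable_def set_lebesgue_integral_def
        by (simp add: integrable_completion integral_completion)
    qed
    show "locally_integrable f"
      unfolding locally_integrable_def
    proof (intro allI impI)
      fix K :: "(real^'n) set" assume "compact K"
      then have "K \<in> bounded_borel"
        by (intro bounded_borelI borel_closed compact_imp_closed compact_imp_bounded)
      then show "set_integrable lebesgue K f" using li by blast
    qed
    show "complex_radon_measure \<mu>s"
      unfolding complex_radon_measure_def
    proof (intro conjI allI impI)
      fix K :: "(real^'n) set" assume K: "compact K"
      have "emeasure (total_variation \<mu>s) K \<le> emeasure (total_variation \<mu>) (K \<inter> N)"
        using K by (intro tv) (auto simp: compact_imp_closed)
      also have "\<dots> < \<infinity>"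
        using K by (intro emeasure_total_variation_bounded[OF \<mu>]) (auto simp: compact_imp_bounded bounded_Int)
      finally show "emeasure (total_variation \<mu>s) K < \<infinity>" .
    qed (use s' in \<open>auto simp: sigma_additive_bounded_def\<close>)
    show "lebesgue_singular \<mu>s"
      unfolding lebesgue_singular_def
    proof (intro bexI[of _ N] conjI)
      have "emeasure lborel N = (\<integral>\<^sup>+x. ennreal (\<sigma> x) * indicator N x \<partial>\<Lambda>)"
        unfolding density_\<sigma>[symmetric] by (rule emeasure_density) auto
      also have "\<dots> = (\<integral>\<^sup>+x. 0 \<partial>\<Lambda>)" by (intro nn_integral_cong) (auto simp: N_def indicator_def)
      finally show "emeasure lebesgue N = 0" using N by simp
      have "emeasure (total_variation \<mu>s) (- N) \<le> emeasure (total_variation \<mu>) (- N \<inter> N)"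
        using N' by (rule tv)
      then show "emeasure (total_variation \<mu>s) (- N) = 0" by simp
    qed (rule N)
    fix B :: "(real^'n) set" assume B: "B \<in> bounded_borel"
    have "\<mu> ((B - N) \<union> (B \<inter> N)) = \<mu> (B - N) + \<mu> (B \<inter> N)"
      using B N by (intro sigma_additive_bounded_Un[OF s] bounded_borel_Diff Bs) auto
    moreover have "(B - N) \<union> (B \<inter> N) = B" by blast
    ultimately show "\<mu> B = (LINT x:B|lebesgue. f x) + \<mu>s B"
      using li[OF B] by (simp add: \<mu>s_def)
  qed
  then show ?thesis by blast
qed

section \<open>Kernels with rapid decay\<close>

lemma lborel_integral_scale:
  fixes F :: "real^'n \<Rightarrow> 'b::{banach, second_countable_topology}"
  assumes F[measurable]: "F \<in> borel_measurable borel" and c: "c > 0"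
  shows "integral\<^sup>L lborel F = c ^ CARD('n) *\<^sub>R (LINT y|lborel. F (t + c *\<^sub>R y))"
proof -
  have eq: "(lborel :: (real^'n) measure) = density (distr lborel borel (\<lambda>y. t + c *\<^sub>R y)) (\<lambda>_. ennreal (c ^ CARD('n)))"
    using lborel_affine[of c t] c by simp
  show ?thesis
    using c by (subst eq, subst integral_density) (auto simp: integral_distr)
qed

lemma term_le_suminf: "f i \<le> (\<Sum>k. f k :: ennreal)"
  using sum_le_suminf[of f "{i}"] by simp

text \<open>On the i-th dyadic shell the integrand is of order 2^(-(n+1) i) and the ball has mass at
  most D (\<rho> 2^i)^n, so a geometric series of ratio 1/2 remains. The measure is general because
  the bound serves Lebesgue measure and also, with small \<open>D\<close>, the variation of
  \<open>\<mu> - \<gamma> m\<close> near a density point.\<close>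

lemma nn_integral_decay_le:
  fixes M :: "(real^'n) measure" and D \<rho> :: real
  assumes sets[measurable_cong, simp]: "sets M = sets borel" and D: "D \<ge> 0" and \<rho>: "\<rho> > 0"
    and M: "\<And>r. r > 0 \<Longrightarrow> emeasure M (cball x r) \<le> ennreal (D * r ^ CARD('n))"
  shows "(\<integral>\<^sup>+y. ennreal (1 / (1 + dist x y / \<rho>) ^ Suc CARD('n)) \<partial>M) \<le> ennreal (2 ^ (CARD('n) + 2) * D * \<rho> ^ CARD('n))"
proof -
  let ?n = "CARD('n)" and ?L = "Suc CARD('n)"
  \<comment> \<open>Beyond 2^(i-1) the integrand is at most 2^(-(n+1) (i-1)); the leading factor
    2^(n+1) makes up for this shift and also covers the innermost ball.\<close>
  define a :: "nat \<Rightarrow> real" where "a i = 2 ^ ?L * (1 / 2 ^ ?L) ^ i" for i :: nat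
  have a0: "a i \<ge> 0" for i by (simp add: a_def)
  have [measurable]: "cball x r \<in> sets borel" for r by simp
  have pt: "ennreal (1 / (1 + dist x y / \<rho>) ^ ?L) \<le> (\<Sum>i. ennreal (a i) * indicator (cball x (\<rho> * 2 ^ i)) y)" for y
  proof -
    define t where "t = dist x y / \<rho>"
    have t0: "t \<ge> 0" using \<rho> by (simp add: t_def)
    obtain j :: nat where "t < 2 ^ j" using real_arch_pow[of 2 t] by auto
    define i where "i = (LEAST i. t \<le> 2 ^ i)"
    have i: "t \<le> 2 ^ i" unfolding i_def using LeastI[of "\<lambda>i. t \<le> 2 ^ i" j] \<open>t < 2 ^ j\<close> by simp
    have "1 / (1 + t) ^ ?L \<le> a i"
    proof (cases i)
      case 0
      have "1 / (1 + t) ^ ?L \<le> 1" using t0 by (simp add: divide_le_eq_1 one_le_power del: power_Suc)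
      also have "\<dots> \<le> a i" using 0 by (simp add: a_def one_le_power del: power_Suc)
      finally show ?thesis .
    next
      case (Suc k)
      then have "\<not> t \<le> 2 ^ k" unfolding i_def using not_less_Least[of k "\<lambda>i. t \<le> 2 ^ i"] by simp
      then have "1 / (1 + t) ^ ?L \<le> 1 / (2 ^ k) ^ ?L"
        using t0 by (intro divide_left_mono power_mono mult_pos_pos zero_less_power) auto
      also have "\<dots> = a i"
      proof -
        have "a i = 2 ^ ?L * ((1 / 2 ^ ?L) * (1 / 2 ^ ?L) ^ k)" by (simp only: a_def Suc power_Suc)
        also have "\<dots> = (2 ^ ?L * (1 / 2 ^ ?L)) * (1 / 2 ^ ?L) ^ k" by (simp only: mult.assoc)
        also have "2 ^ ?L * (1 / 2 ^ ?L) = (1 :: real)" by simp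
        also have "1 * (1 / 2 ^ ?L) ^ k = (1 / 2 ^ ?L :: real) ^ k" by (simp only: mult_1_left)
        also have "\<dots> = 1 / (2 ^ k) ^ ?L" by (simp add: power_one_over power_mult[symmetric] mult.commute del: power_Suc)
        finally show ?thesis by simp
      qed
      finally show ?thesis .
    qed
    then have "ennreal (1 / (1 + t) ^ ?L) \<le> ennreal (a i) * indicator (cball x (\<rho> * 2 ^ i)) y"
      using i \<rho> by (auto simp: t_def field_simps indicator_def intro!: ennreal_leI)
    also have "\<dots> \<le> (\<Sum>i. ennreal (a i) * indicator (cball x (\<rho> * 2 ^ i)) y)"
      by (rule term_le_suminf)
    finally show ?thesis by (simp add: t_def)
  qed
  have half: "(\<lambda>i. 2 ^ ?L * D * \<rho> ^ ?n * (1 / 2 :: real) ^ i) sums (2 ^ ?L * D * \<rho> ^ ?n * 2)"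
    by (intro sums_mult) (use geometric_sums[of "1/2::real"] in simp)
  have "(\<integral>\<^sup>+y. ennreal (1 / (1 + dist x y / \<rho>) ^ ?L) \<partial>M) \<le> (\<integral>\<^sup>+y. (\<Sum>i. ennreal (a i) * indicator (cball x (\<rho> * 2 ^ i)) y) \<partial>M)"
    by (intro nn_integral_mono pt)
  also have "\<dots> = (\<Sum>i. \<integral>\<^sup>+y. ennreal (a i) * indicator (cball x (\<rho> * 2 ^ i)) y \<partial>M)"
    by (rule nn_integral_suminf) simp
  also have "\<dots> = (\<Sum>i. ennreal (a i) * emeasure M (cball x (\<rho> * 2 ^ i)))"
    by (simp add: nn_integral_cmult_indicator)
  also have "\<dots> \<le> (\<Sum>i. ennreal (2 ^ ?L * D * \<rho> ^ ?n * (1 / 2 :: real) ^ i))"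
  proof (intro suminf_le)
    fix i
    have "ennreal (a i) * emeasure M (cball x (\<rho> * 2 ^ i)) \<le> ennreal (a i) * ennreal (D * (\<rho> * 2 ^ i) ^ ?n)"
      using \<rho> by (intro mult_left_mono M) auto
    also have "\<dots> = ennreal (a i * (D * (\<rho> * 2 ^ i) ^ ?n))"
      using a0 by (simp add: ennreal_mult')
    also have "a i * (D * (\<rho> * 2 ^ i) ^ ?n) = 2 ^ ?L * D * \<rho> ^ ?n * ((1 / 2 ^ ?L) ^ i * (2 ^ i) ^ ?n)"
      by (simp add: a_def power_mult_distrib del: power_Suc)
    also have "(1 / 2 ^ ?L) ^ i * (2 ^ i) ^ ?n = (1 / 2 :: real) ^ i"
    proof -
      have "(2 ^ i) ^ ?n = ((2 :: real) ^ ?n) ^ i" by (simp add: power_mult[symmetric] mult.commute)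
      then have "(1 / 2 ^ ?L) ^ i * (2 ^ i) ^ ?n = ((1 / 2 ^ ?L) * (2 :: real) ^ ?n) ^ i" by (simp only: power_mult_distrib)
      also have "(1 / 2 ^ ?L) * (2 :: real) ^ ?n = 1 / 2" by simp
      finally show ?thesis .
    qed
    finally show "ennreal (a i) * emeasure M (cball x (\<rho> * 2 ^ i)) \<le> ennreal (2 ^ ?L * D * \<rho> ^ ?n * (1 / 2 :: real) ^ i)" .
  qed auto
  also have "\<dots> = ennreal (2 ^ ?L * D * \<rho> ^ ?n * 2)"
    using half D \<rho> by (intro suminf_ennreal_eq) auto
  finally show ?thesis by (simp add: mult_ac)
qed

lemma nn_integral_lborel_decay_finite:
  assumes "l \<ge> Suc CARD('n)"
  shows "(\<integral>\<^sup>+y. ennreal (1 / (1 + dist (x :: real^'n) y) ^ l) \<partial>lborel) < \<infinity>"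
proof -
  have "(\<integral>\<^sup>+y. ennreal (1 / (1 + dist x y) ^ l) \<partial>lborel) \<le> (\<integral>\<^sup>+y. ennreal (1 / (1 + dist x y / 1) ^ Suc CARD('n)) \<partial>lborel)"
  proof (intro nn_integral_mono ennreal_leI)
    fix y
    have "(1 + dist x y / 1) ^ Suc CARD('n) \<le> (1 + dist x y) ^ l"
      unfolding div_by_1 by (rule power_increasing[OF assms]) simp
    then show "1 / (1 + dist x y) ^ l \<le> 1 / (1 + dist x y / 1) ^ Suc CARD('n)"
      by (intro divide_left_mono mult_pos_pos zero_less_power) (auto simp: add_pos_nonneg)
  qed
  also have "\<dots> \<le> ennreal (2 ^ (CARD('n) + 2) * unit_ball_vol CARD('n) * 1 ^ CARD('n))"
    by (rule nn_integral_decay_le) (auto simp: emeasure_cball)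
  also have "\<dots> < \<infinity>" by simp
  finally show ?thesis .
qed

section \<open>From the values of a set function to its variation\<close>

text \<open>Either the set where \<open>u\<close> is positive or its complement carries at least
  half of the integral of the absolute value.\<close>

lemma exists_subset_integral_ge:
  fixes u :: "'a \<Rightarrow> real"
  assumes u: "integrable M u"
  shows "\<exists>A\<in>sets M. (LINT x|M. \<bar>u x\<bar>) \<le> 2 * \<bar>LINT x:A|M. u x\<bar>"
proof -
  define P where "P = {x\<in>space M. u x > 0}"
  define N where "N = {x\<in>space M. \<not> u x > 0}"
  have P: "P \<in> sets M" "N \<in> sets M" using borel_measurable_integrable[OF u] unfolding P_def N_def by measurable
  have i: "integrable M (\<lambda>x. indicator A x *\<^sub>R u x)" if "A \<in> sets M" for A
    using integrable_mult_indicator[OF that u] .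
  have "(LINT x|M. \<bar>u x\<bar>) = (LINT x|M. indicator P x *\<^sub>R u x - indicator N x *\<^sub>R u x)"
    by (intro Bochner_Integration.integral_cong) (auto simp: P_def N_def indicator_def)
  also have "\<dots> = (LINT x:P|M. u x) - (LINT x:N|M. u x)"
    unfolding set_lebesgue_integral_def by (intro Bochner_Integration.integral_diff i P)
  finally have "(LINT x|M. \<bar>u x\<bar>) \<le> 2 * \<bar>LINT x:P|M. u x\<bar> \<or> (LINT x|M. \<bar>u x\<bar>) \<le> 2 * \<bar>LINT x:N|M. u x\<bar>"
    by linarith
  then show ?thesis using P by blast
qed

text \<open>Splitting into real and imaginary parts loses a second factor 2. The lemma takes the
  place of a polar decomposition: it finds one set on which the set function is comparable to its
  variation.\<close>

lemma exists_subset_integral_ge_complex: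
  fixes u :: "'a \<Rightarrow> complex"
  assumes u: "set_integrable M B u" and B: "B \<in> sets M"
  shows "\<exists>A\<in>sets M. A \<subseteq> B \<and> (LINT x:B|M. norm (u x)) \<le> 4 * norm (LINT x:A|M. u x)"
proof -
  let ?v = "\<lambda>x. indicator B x *\<^sub>R u x"
  have v: "integrable M ?v" using u by (simp add: set_integrable_def)
  have "(LINT x|M. norm (?v x)) \<le> (LINT x|M. \<bar>Re (?v x)\<bar> + \<bar>Im (?v x)\<bar>)"
    by (intro integral_mono integrable_norm Bochner_Integration.integrable_add integrable_abs integrable_Re integrable_Im v cmod_le)
  also have "\<dots> = (LINT x|M. \<bar>Re (?v x)\<bar>) + (LINT x|M. \<bar>Im (?v x)\<bar>)"
    by (intro Bochner_Integration.integral_add integrable_abs integrable_Re integrable_Im v)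
  finally have le: "(LINT x|M. norm (?v x)) \<le> (LINT x|M. \<bar>Re (?v x)\<bar>) + (LINT x|M. \<bar>Im (?v x)\<bar>)" .
  have int: "integrable M (\<lambda>x. indicator A x *\<^sub>R ?v x)" if "A \<in> sets M" for A
    using integrable_mult_indicator[OF that v] .
  obtain A1 where A1: "A1 \<in> sets M" "(LINT x|M. \<bar>Re (?v x)\<bar>) \<le> 2 * \<bar>LINT x:A1|M. Re (?v x)\<bar>"
    using exists_subset_integral_ge[OF integrable_Re[OF v]] by blast
  obtain A2 where A2: "A2 \<in> sets M" "(LINT x|M. \<bar>Im (?v x)\<bar>) \<le> 2 * \<bar>LINT x:A2|M. Im (?v x)\<bar>"
    using exists_subset_integral_ge[OF integrable_Im[OF v]] by blast
  have r: "(LINT x:A|M. Re (?v x)) = Re (LINT x:A|M. ?v x)" "(LINT x:A|M. Im (?v x)) = Im (LINT x:A|M. ?v x)" if "A \<in> sets M" for A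
    unfolding set_lebesgue_integral_def
    using int[OF that] by (simp_all flip: integral_Re integral_Im add: mult.assoc)
  have e: "(LINT x:A|M. ?v x) = (LINT x:A \<inter> B|M. u x)" for A
    unfolding set_lebesgue_integral_def by (intro Bochner_Integration.integral_cong) (auto simp: indicator_def)
  have "(LINT x|M. norm (?v x)) \<le> 2 * norm (LINT x:A1 \<inter> B|M. u x) + 2 * norm (LINT x:A2 \<inter> B|M. u x)"
    using le A1(2) A2(2) abs_Re_le_cmod[of "LINT x:A1|M. ?v x"] abs_Im_le_cmod[of "LINT x:A2|M. ?v x"]
    unfolding r(1)[OF A1(1)] r(2)[OF A2(1)] e by linarith
  then have "(LINT x|M. norm (?v x)) \<le> 4 * norm (LINT x:A1 \<inter> B|M. u x) \<or> (LINT x|M. norm (?v x)) \<le> 4 * norm (LINT x:A2 \<inter> B|M. u x)"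
    by linarith
  moreover have "(LINT x|M. norm (?v x)) = (LINT x:B|M. norm (u x))"
    unfolding set_lebesgue_integral_def by (intro Bochner_Integration.integral_cong) (auto simp: indicator_def)
  ultimately show ?thesis using A1(1) A2(1) B by (metis inf_le2 sets.Int)
qed

context radon_density
begin

lemma integral_\<sigma>:
  fixes F :: "real^'n \<Rightarrow> complex"
  assumes [measurable]: "F \<in> borel_measurable borel"
  shows "integrable lborel F \<longleftrightarrow> integrable \<Lambda> (\<lambda>x. \<sigma> x *\<^sub>R F x)"
    and "(LINT x|lborel. F x) = (LINT x|\<Lambda>. \<sigma> x *\<^sub>R F x)"
  unfolding density_\<sigma>[symmetric]
  by (rule integrable_density integral_density; use \<sigma>_nonneg in simp)+

lemma diff_set_integral:
  assumes B: "B \<in> bounded_borel"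
  shows "set_integrable \<Lambda> B (\<lambda>y. h y - \<gamma> * of_real (\<sigma> y))"
    and "(LINT y:B|\<Lambda>. h y - \<gamma> * of_real (\<sigma> y)) = \<mu> B - \<gamma> * of_real (measure lborel B)"
proof -
  have [measurable]: "B \<in> sets borel" using B by simp
  let ?F = "\<lambda>x. indicator B x *\<^sub>R \<gamma>"
  have fin: "emeasure lborel B < \<infinity>"
    using emeasure_bounded_finite[OF bounded_borel_bounded[OF B]] by simp
  then have iF: "integrable lborel ?F" by simp
  have eq: "\<sigma> x *\<^sub>R ?F x = indicator B x *\<^sub>R (\<gamma> * of_real (\<sigma> x))" for x
    by (simp add: scaleR_conv_of_real)
  have i\<sigma>: "set_integrable \<Lambda> B (\<lambda>y. \<gamma> * of_real (\<sigma> y))"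
    using iF integral_\<sigma>(1)[of ?F] unfolding set_integrable_def eq by simp
  have "(LINT y:B|\<Lambda>. \<gamma> * of_real (\<sigma> y)) = (LINT x|lborel. ?F x)"
    unfolding set_lebesgue_integral_def by (subst integral_\<sigma>) (simp_all only: eq, measurable)
  also have "\<dots> = \<gamma> * of_real (measure lborel B)"
    using fin by (simp add: scaleR_conv_of_real)
  finally show "(LINT y:B|\<Lambda>. h y - \<gamma> * of_real (\<sigma> y)) = \<mu> B - \<gamma> * of_real (measure lborel B)"
    using \<mu>_h[OF B] i\<sigma> by (subst set_integral_diff) auto
  show "set_integrable \<Lambda> B (\<lambda>y. h y - \<gamma> * of_real (\<sigma> y))"
    using \<mu>_h[OF B] i\<sigma> by (intro set_integral_diff) auto
qed

text \<open>The variation measure of \<open>\<mu> - \<gamma> m\<close>, whose density with respect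
  to \<open>\<Lambda>\<close> is \<open>h - \<gamma> \<sigma>\<close>.\<close>

definition diff_variation :: "complex \<Rightarrow> (real^'n) measure" where
  "diff_variation \<gamma> = density \<Lambda> (\<lambda>y. ennreal (norm (h y - \<gamma> * of_real (\<sigma> y))))"

lemma sets_diff_variation [measurable_cong, simp]: "sets (diff_variation \<gamma>) = sets borel"
  by (simp add: diff_variation_def)

lemma emeasure_diff_variation:
  assumes B: "B \<in> bounded_borel"
  shows "emeasure (diff_variation \<gamma>) B = ennreal (LINT y:B|\<Lambda>. norm (h y - \<gamma> * of_real (\<sigma> y)))"
proof -
  have [measurable]: "B \<in> sets borel" using B by simp
  let ?u = "\<lambda>y. h y - \<gamma> * of_real (\<sigma> y)"
  have "emeasure (diff_variation \<gamma>) B = (\<integral>\<^sup>+y. ennreal (indicator B y * norm (?u y)) \<partial>\<Lambda>)"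
    unfolding diff_variation_def by (subst emeasure_density) (auto intro!: nn_integral_cong simp: indicator_def)
  also have "\<dots> = ennreal (LINT y|\<Lambda>. indicator B y * norm (?u y))"
  proof (rule nn_integral_eq_integral)
    have "integrable \<Lambda> (\<lambda>y. norm (indicator B y *\<^sub>R ?u y))"
      using diff_set_integral(1)[OF B] unfolding set_integrable_def by (rule integrable_norm)
    then show "integrable \<Lambda> (\<lambda>y. indicator B y * norm (?u y))" by simp
  qed simp
  finally show ?thesis by (simp add: set_lebesgue_integral_def)
qed

text \<open>A crude triangle inequality. It transfers the growth condition from the total variation
  of \<open>\<mu>\<close> to that of \<open>\<mu> - \<gamma> m\<close>, which controls the tail of
  the kernel integral.\<close>

lemma nn_integral_diff_variation_le:
  assumes g[measurable]: "g \<in> borel_measurable borel"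
  shows "(\<integral>\<^sup>+y. g y \<partial>diff_variation \<gamma>) \<le> 4 * (\<integral>\<^sup>+y. g y \<partial>total_variation \<mu>) + ennreal (norm \<gamma>) * (\<integral>\<^sup>+y. g y \<partial>lborel)"
proof -
  have "(\<integral>\<^sup>+y. g y \<partial>diff_variation \<gamma>) = (\<integral>\<^sup>+y. ennreal (norm (h y - \<gamma> * of_real (\<sigma> y))) * g y \<partial>\<Lambda>)"
    unfolding diff_variation_def by (subst nn_integral_density) auto
  also have "\<dots> \<le> (\<integral>\<^sup>+y. g y * ennreal (norm (h y)) + ennreal (norm \<gamma>) * (ennreal (\<sigma> y) * g y) \<partial>\<Lambda>)"
  proof (rule nn_integral_mono)
    fix y
    have "ennreal (norm (h y - \<gamma> * of_real (\<sigma> y))) \<le> ennreal (norm (h y) + norm \<gamma> * \<sigma> y)"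
      using norm_triangle_ineq4[of "h y" "\<gamma> * of_real (\<sigma> y)"] \<sigma>_nonneg[of y]
      by (intro ennreal_leI) (simp add: norm_mult)
    also have "\<dots> = ennreal (norm (h y)) + ennreal (norm \<gamma>) * ennreal (\<sigma> y)"
      using \<sigma>_nonneg[of y] by (simp add: ennreal_mult)
    finally have "ennreal (norm (h y - \<gamma> * of_real (\<sigma> y))) * g y \<le> (ennreal (norm (h y)) + ennreal (norm \<gamma>) * ennreal (\<sigma> y)) * g y"
      by (rule mult_right_mono) simp
    then show "ennreal (norm (h y - \<gamma> * of_real (\<sigma> y))) * g y \<le> g y * ennreal (norm (h y)) + ennreal (norm \<gamma>) * (ennreal (\<sigma> y) * g y)"
      by (simp add: distrib_left distrib_right mult_ac)
  qed
  also have "\<dots> = (\<integral>\<^sup>+y. g y * ennreal (norm (h y)) \<partial>\<Lambda>) + ennreal (norm \<gamma>) * (\<integral>\<^sup>+y. ennreal (\<sigma> y) * g y \<partial>\<Lambda>)"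
    by (simp add: nn_integral_add nn_integral_cmult)
  also have "(\<integral>\<^sup>+y. ennreal (\<sigma> y) * g y \<partial>\<Lambda>) = (\<integral>\<^sup>+y. g y \<partial>lborel)"
    unfolding density_\<sigma>[symmetric] by (rule nn_integral_density[symmetric]) auto
  finally show ?thesis using nn_integral_h[OF g] by (meson add_right_mono order_trans)
qed

text \<open>
  Among a Borel subset of a ball and its complement in the ball, at least one has half the measure
  of the ball, so it shrinks regularly; hence the density condition controls \<open>\<mu> - \<gamma> m\<close> uniformly on
  all Borel subsets of small balls, that is, it controls the variation of \<open>\<mu> - \<gamma> m\<close>.
\<close>

lemma diff_variation_small:
  assumes dens: "has_lebesgue_density \<mu> x \<gamma>" and e: "e > 0"
  shows "\<exists>d>0. \<forall>r. 0 < r \<and> r < d \<longrightarrow> emeasure (diff_variation \<gamma>) (cball x r) \<le> ennreal (e * r ^ CARD('n))"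
proof (rule ccontr)
  let ?n = "CARD('n)"
  define V where "V = unit_ball_vol (real ?n)"
  have V: "V > 0" by (simp add: V_def)
  assume "\<not> ?thesis"
  then have "\<exists>r. 0 < r \<and> r < d \<and> emeasure (diff_variation \<gamma>) (cball x r) > ennreal (e * r ^ ?n)" if "d > 0" for d
    using that by (force simp: not_le)
  \<comment> \<open>Density is a statement about sequences, so failure of the bound is turned into
    radii tending to 0; below, each ball gets a subset whose value is at least a quarter of the
    variation of the ball.\<close>
  then have "\<exists>r. \<forall>i. 0 < r i \<and> r i < inverse (real (Suc i)) \<and> emeasure (diff_variation \<gamma>) (cball x (r i)) > ennreal (e * r i ^ ?n)"
    by (intro choice allI) simp
  then obtain r where r: "\<And>i. 0 < r i" "\<And>i. r i < inverse (real (Suc i))"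
    and big: "\<And>i. emeasure (diff_variation \<gamma>) (cball x (r i)) > ennreal (e * r i ^ ?n)"
    by blast
  have r0: "r \<longlonglongrightarrow> 0"
    by (rule tendsto_sandwich[of "\<lambda>_. 0" _ _ "\<lambda>i. inverse (real (Suc i))"])
      (use r LIMSEQ_inverse_real_of_nat in \<open>auto intro!: always_eventually less_imp_le\<close>)
  define B where "B i = cball x (r i)" for i
  have BB: "B i \<in> bounded_borel" for i unfolding B_def by (intro bounded_borelI) auto
  have mB: "measure lborel (B i) = V * r i ^ ?n" for i
    using content_cball[of "r i" x] r(1)[of i] by (simp add: B_def V_def less_imp_le)
  define \<nu> where "\<nu> A = \<mu> A - \<gamma> * of_real (measure lborel A)" for A
  have "\<exists>A. A \<in> sets borel \<and> A \<subseteq> B i \<and> e * r i ^ ?n \<le> 4 * norm (\<nu> A)" for i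
  proof -
    obtain A where A: "A \<in> sets \<Lambda>" "A \<subseteq> B i"
      "(LINT y:B i|\<Lambda>. norm (h y - \<gamma> * of_real (\<sigma> y))) \<le> 4 * norm (LINT y:A|\<Lambda>. h y - \<gamma> * of_real (\<sigma> y))"
      using exists_subset_integral_ge_complex[OF diff_set_integral(1)[OF BB[of i]]] BB[of i] by auto
    have "A \<in> bounded_borel" using A(1,2) by (intro bounded_borel_subset[OF BB[of i]]) auto
    then have "(LINT y:A|\<Lambda>. h y - \<gamma> * of_real (\<sigma> y)) = \<nu> A"
      unfolding \<nu>_def by (rule diff_set_integral)
    moreover have "e * r i ^ ?n \<le> (LINT y:B i|\<Lambda>. norm (h y - \<gamma> * of_real (\<sigma> y)))"
      using big[of i] e r(1)[of i] unfolding emeasure_diff_variation[OF BB[of i, unfolded B_def]] B_def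
      by (subst (asm) ennreal_less_iff) auto
    ultimately show ?thesis using A by (intro exI[of _ A]) auto
  qed
  then obtain A where A: "\<And>i. A i \<in> sets borel" "\<And>i. A i \<subseteq> B i" "\<And>i. e * r i ^ ?n \<le> 4 * norm (\<nu> (A i))"
    by metis
  have AB: "A i \<in> bounded_borel" for i by (rule bounded_borel_subset[OF BB A(1,2)])
  have fin: "emeasure lborel S < \<infinity>" if "S \<in> bounded_borel" for S
    using emeasure_bounded_finite[OF bounded_borel_bounded[OF that]] by simp
  define C where "C i = (if measure lborel (A i) \<ge> measure lborel (B i) / 2 then A i else B i - A i)" for i
  have mdiff: "measure lborel (B i - A i) = measure lborel (B i) - measure lborel (A i)" for i
    using A(1,2)[of i] BB[of i] fin[OF BB[of i]] by (intro measure_Diff) auto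
  have CB: "C i \<in> bounded_borel" "C i \<subseteq> B i" for i
    using AB[of i] A(1,2)[of i] BB[of i] by (auto simp: C_def)
  have mC: "measure lborel (C i) \<ge> measure lborel (B i) / 2" for i
    by (auto simp: C_def mdiff not_le)
  have shrink: "shrinks_regularly D x"
    if D: "\<And>i. D i \<in> bounded_borel" "\<And>i. D i \<subseteq> B i" "\<And>i. measure lborel (D i) \<ge> measure lborel (B i) / 2" for D
    unfolding shrinks_regularly_def
  \<comment> \<open>The closed ball of radius r lies in the open ball of radius 2 r, which costs 2^n
    in the constant; having only half the volume costs another 2.\<close>
  proof (intro conjI allI exI[of _ "\<lambda>i. 2 * r i"] exI[of _ "V / (2 * 2 ^ ?n)"])
    fix i
    show "D i \<in> sets borel" using D(1) by simp
    show "2 * r i > 0" using r(1)[of i] by simp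
    have "B i \<subseteq> ball x (2 * r i)" using r(1)[of i] by (auto simp: B_def)
    then show "D i \<subseteq> ball x (2 * r i)" using D(2) by blast
    show "V / (2 * 2 ^ ?n) > 0" using V by simp
    show "V / (2 * 2 ^ ?n) * (2 * r i) ^ ?n \<le> measure lebesgue (D i)"
      using D(1)[of i] D(3)[of i] by (simp add: mB power_mult_distrib)
  next
    show "(\<lambda>i. 2 * r i) \<longlonglongrightarrow> 0" using tendsto_mult_right_zero[OF r0, of 2] by simp
  qed
  have lim: "(\<lambda>i. norm (\<nu> (D i)) / (V * r i ^ ?n)) \<longlonglongrightarrow> 0"
    if D: "\<And>i. D i \<in> bounded_borel" "\<And>i. D i \<subseteq> B i" "\<And>i. measure lborel (D i) \<ge> measure lborel (B i) / 2" for D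
  proof -
    have pos: "V * r i ^ ?n > 0" for i using V r(1)[of i] by simp
    have mD: "measure lborel (D i) > 0" "measure lborel (D i) \<le> V * r i ^ ?n" for i
    proof -
      show "measure lborel (D i) > 0" using D(3)[of i] pos[of i] by (simp add: mB)
      show "measure lborel (D i) \<le> V * r i ^ ?n"
        using D(1,2)[of i] BB[of i] fin[OF BB[of i]] unfolding mB[symmetric]
        by (intro measure_mono_fmeasurable) (auto simp: fmeasurable_def)
    qed
    have "(\<lambda>i. \<mu> (D i) / of_real (measure lebesgue (D i))) \<longlonglongrightarrow> \<gamma>"
      using dens shrink[OF D] by (auto simp: has_lebesgue_density_def)
    then have "(\<lambda>i. norm (\<mu> (D i) / of_real (measure lebesgue (D i)) - \<gamma>)) \<longlonglongrightarrow> 0"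
      by (intro tendsto_norm_zero) (simp add: LIM_zero)
    then show ?thesis
    proof (rule Lim_null_comparison[rotated], intro always_eventually allI)
      fix i
      have "norm (\<nu> (D i)) / (V * r i ^ ?n) \<le> norm (\<nu> (D i)) / measure lborel (D i)"
        using mD[of i] pos[of i] V r(1)[of i] by (intro divide_left_mono mult_pos_pos) auto
      also have "\<dots> = norm (\<nu> (D i) / of_real (measure lborel (D i)))" by (simp add: norm_divide)
      also have "\<nu> (D i) / of_real (measure lborel (D i)) = \<mu> (D i) / of_real (measure lebesgue (D i)) - \<gamma>"
        using mD(1)[of i] D(1)[of i] by (simp add: \<nu>_def field_simps)
      finally show "norm (norm (\<nu> (D i)) / (V * r i ^ ?n)) \<le> norm (\<mu> (D i) / of_real (measure lebesgue (D i)) - \<gamma>)"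
        using pos[of i] by simp
    qed
  qed
  \<comment> \<open>If \<open>A i\<close> is too small to shrink regularly, it is still the
    difference of two sets that do, the ball and \<open>C i\<close>.\<close>
  have \<nu>A: "norm (\<nu> (A i)) \<le> norm (\<nu> (C i)) + norm (\<nu> (B i))" for i
  proof (cases "measure lborel (A i) \<ge> measure lborel (B i) / 2")
    case True then show ?thesis by (simp add: C_def)
  next
    case False
    have "(LINT y:A i \<union> (B i - A i)|\<Lambda>. h y - \<gamma> * of_real (\<sigma> y))
        = (LINT y:A i|\<Lambda>. h y - \<gamma> * of_real (\<sigma> y)) + (LINT y:B i - A i|\<Lambda>. h y - \<gamma> * of_real (\<sigma> y))"
      using AB[of i] BB[of i] A(1)[of i] by (intro set_integral_Un diff_set_integral) auto
    moreover have "A i \<union> (B i - A i) = B i" using A(2)[of i] by blast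
    moreover have "B i - A i \<in> bounded_borel" using BB A(1) by (rule bounded_borel_Diff)
    ultimately have "\<nu> (A i) = \<nu> (B i) - \<nu> (C i)"
      using False AB[of i] BB[of i] by (simp add: diff_set_integral(2) C_def \<nu>_def[symmetric] eq_diff_eq)
    then show ?thesis using norm_triangle_ineq4[of "\<nu> (B i)" "\<nu> (C i)"] by simp
  qed
  have "(\<lambda>i. norm (\<nu> (C i)) / (V * r i ^ ?n) + norm (\<nu> (B i)) / (V * r i ^ ?n)) \<longlonglongrightarrow> 0 + 0"
    by (intro tendsto_add lim CB mC BB) (auto simp: mB V less_imp_le[OF r(1)] intro!: mult_nonneg_nonneg less_imp_le[OF V])
  moreover have "e / (4 * V) \<le> norm (\<nu> (C i)) / (V * r i ^ ?n) + norm (\<nu> (B i)) / (V * r i ^ ?n)" for i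
  proof -
    have p: "r i ^ ?n > 0" using r(1)[of i] by simp
    have "e * r i ^ ?n \<le> 4 * (norm (\<nu> (C i)) + norm (\<nu> (B i)))"
      by (rule order_trans[OF A(3)[of i] mult_left_mono[OF \<nu>A[of i]]]) simp
    then have "(e * r i ^ ?n / 4) / (V * r i ^ ?n) \<le> (norm (\<nu> (C i)) + norm (\<nu> (B i))) / (V * r i ^ ?n)"
      using V p by (intro divide_right_mono) auto
    moreover have "(e * r i ^ ?n / 4) / (V * r i ^ ?n) = e / (4 * V)" using r(1)[of i] by simp
    ultimately show ?thesis by (simp add: add_divide_distrib)
  qed
  ultimately have "e / (4 * V) \<le> 0" by (intro LIMSEQ_le_const[where a="e / (4 * V)"]) auto
  then show False using e V by (simp add: divide_le_0_iff)
qed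

end

section \<open>Rescaled kernels at a density point\<close>

text \<open>Since the kernel integrates to 1, the error is at most the integral of its modulus
  against the variation of \<open>\<mu> - \<gamma> m\<close>. Near \<open>x\<close> that variation
  has growth \<delta> r^n, which compensates the factor c^n exactly; away from \<open>x\<close> a
  power of \<open>c\<close> is left over, because c^n / c^l is at most 1 / c.\<close>

lemma (in radon_density) scaled_kernel_tendsto:
  fixes Q :: "real^'n \<Rightarrow> real^'n \<Rightarrow> complex" and k :: real
  assumes Q[measurable]: "\<And>x. Q x \<in> borel_measurable borel"
    and decay: "\<And>l::nat. \<exists>C\<ge>0. \<forall>x y. norm (Q x y) \<le> C / (1 + dist x y) ^ l"
    and int1: "\<And>x. (LINT y|lborel. Q x y) = 1"
    and k: "k \<ge> 0" and fin: "(\<integral>\<^sup>+x. ennreal ((1 + norm x) powr (- k)) \<partial>total_variation \<mu>) < \<infinity>"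
    and dens: "has_lebesgue_density \<mu> x \<gamma>"
  shows "((\<lambda>c::real. radon_integral \<mu> (\<lambda>y. of_real (c ^ CARD('n)) * Q (c *\<^sub>R x) (c *\<^sub>R y))) \<longlongrightarrow> \<gamma>) at_top"
proof -
  let ?n = "CARD('n)"
  \<comment> \<open>Above the dimension, for Lebesgue integrability of the weight and the gain of 1
    / c in the tail; at least \<open>k\<close>, for integrability against the total
    variation.\<close>
  define l :: nat where "l = max (Suc ?n) (nat \<lceil>k\<rceil>)"
  have l: "l \<ge> Suc ?n" "real l \<ge> k" unfolding l_def by linarith+
  define w :: "real^'n \<Rightarrow> real" where "w y = 1 / (1 + norm y) ^ l" for y
  have w0: "w y > 0" for y by (simp add: w_def add_pos_nonneg)
  have [measurable]: "w \<in> borel_measurable borel" unfolding w_def by measurable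
  have wT: "(\<integral>\<^sup>+y. ennreal (w y) \<partial>total_variation \<mu>) < \<infinity>"
  proof -
    have "w y \<le> (1 + norm y) powr (- k)" for y
    proof -
      have "w y = (1 + norm y) powr (- real l)"
        by (simp add: w_def powr_minus powr_realpow add_pos_nonneg divide_inverse)
      also have "\<dots> \<le> (1 + norm y) powr (- k)" using l(2) by (intro powr_mono) auto
      finally show ?thesis .
    qed
    then have "(\<integral>\<^sup>+y. ennreal (w y) \<partial>total_variation \<mu>) \<le> (\<integral>\<^sup>+x. ennreal ((1 + norm x) powr (- k)) \<partial>total_variation \<mu>)"
      by (intro nn_integral_mono ennreal_leI)
    then show ?thesis using fin by (rule le_less_trans)
  qed
  have wL: "(\<integral>\<^sup>+y. ennreal (w y) \<partial>lborel) < \<infinity>"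
    using nn_integral_lborel_decay_finite[OF l(1), of 0] by (simp add: w_def)
  define W where "W = enn2real (\<integral>\<^sup>+y. ennreal (w y) \<partial>diff_variation \<gamma>)"
  have W: "(\<integral>\<^sup>+y. ennreal (w y) \<partial>diff_variation \<gamma>) = ennreal W"
  proof -
    have "(\<integral>\<^sup>+y. ennreal (w y) \<partial>diff_variation \<gamma>) \<le> 4 * (\<integral>\<^sup>+y. ennreal (w y) \<partial>total_variation \<mu>) + ennreal (norm \<gamma>) * (\<integral>\<^sup>+y. ennreal (w y) \<partial>lborel)"
      by (rule nn_integral_diff_variation_le) measurable
    also have "\<dots> < \<infinity>" using wT wL by (simp add: ennreal_mult_less_top)
    finally show ?thesis by (simp add: W_def less_top)
  qed
  have W0: "W \<ge> 0" by (simp add: W_def)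
  define q where "q c y = of_real (c ^ ?n) * Q (c *\<^sub>R x) (c *\<^sub>R y)" for c :: real and y
  have [measurable]: "q c \<in> borel_measurable borel" for c unfolding q_def by measurable
  obtain C where C: "C \<ge> 0" "\<And>x y. norm (Q x y) \<le> C / (1 + dist x y) ^ l" using decay[of l] by blast
  obtain C' where C': "C' \<ge> 0" "\<And>x y. norm (Q x y) \<le> C' / (1 + dist x y) ^ Suc ?n" using decay[of "Suc ?n"] by blast
  have dist_scale: "dist (c *\<^sub>R x) (c *\<^sub>R y) = c * dist x y" if "c \<ge> 0" for c :: real and y
    using that by (simp add: dist_norm flip: scaleR_right_diff_distrib)
  have q_fin: "norm (q c y) \<le> c ^ ?n * C * (1 + norm x) ^ l * w y" if c: "c \<ge> 1" for c y
  proof -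
    \<comment> \<open>Peetre's inequality: it trades decay in the distance from \<open>x\<close> for
      decay at infinity, at the price of a factor depending on \<open>x\<close>.\<close>
    have "1 + norm y \<le> (1 + norm x) * (1 + c * dist x y)"
    proof -
      have "norm y \<le> norm x + dist x y" by (metis dist_commute dist_norm norm_triangle_sub)
      also have "dist x y \<le> c * dist x y" using c mult_right_mono[of 1 c "dist x y"] by simp
      also have "norm x + c * dist x y \<le> norm x + (c * dist x y + norm x * (c * dist x y))" using c by simp
      finally show ?thesis by (simp add: algebra_simps)
    qed
    then have "(1 + norm y) ^ l \<le> (1 + norm x) ^ l * (1 + c * dist x y) ^ l"
      unfolding power_mult_distrib[symmetric] by (intro power_mono) auto
    then have "1 / (1 + c * dist x y) ^ l \<le> (1 + norm x) ^ l * w y"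
      using c by (simp add: w_def field_simps add_pos_nonneg)
    then have "C * (1 / (1 + c * dist x y) ^ l) \<le> C * ((1 + norm x) ^ l * w y)"
      using C(1) by (rule mult_left_mono)
    moreover have "norm (Q (c *\<^sub>R x) (c *\<^sub>R y)) \<le> C * (1 / (1 + c * dist x y) ^ l)"
      using C(2)[of "c *\<^sub>R x" "c *\<^sub>R y"] c by (simp add: dist_scale)
    ultimately have "c ^ ?n * norm (Q (c *\<^sub>R x) (c *\<^sub>R y)) \<le> c ^ ?n * (C * ((1 + norm x) ^ l * w y))"
      using c by (intro mult_left_mono) auto
    then show ?thesis using c by (simp add: q_def norm_mult norm_power mult_ac)
  qed
  have intL: "integrable lborel (q c) \<and> (LINT y|lborel. q c y) = 1" if c: "c \<ge> 1" for c
  proof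
    have "(\<integral>\<^sup>+y. ennreal (norm (q c y)) \<partial>lborel) \<le> (\<integral>\<^sup>+y. ennreal (c ^ ?n * C * (1 + norm x) ^ l) * ennreal (w y) \<partial>lborel)"
      using q_fin[OF c] w0 c C(1) by (intro nn_integral_mono) (simp add: ennreal_mult[symmetric] less_imp_le)
    also have "\<dots> < \<infinity>" using wL by (simp add: nn_integral_cmult ennreal_mult_less_top)
    finally show "integrable lborel (q c)" by (simp add: integrable_iff_bounded)
    have "(LINT y|lborel. q c y) = of_real (c ^ ?n) * (LINT y|lborel. Q (c *\<^sub>R x) (0 + c *\<^sub>R y))"
      by (simp add: q_def)
    also have "\<dots> = (LINT y|lborel. Q (c *\<^sub>R x) y)"
      using lborel_integral_scale[of "Q (c *\<^sub>R x)" c 0] c by (simp add: scaleR_conv_of_real)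
    finally show "(LINT y|lborel. q c y) = 1" by (simp add: int1)
  qed
  \<comment> \<open>\<open>\<gamma>\<close> is itself written as an integral over
    \<open>\<Lambda>\<close>, since the kernel has Lebesgue integral 1; the two integrals then merge
    into one against \<open>h - \<gamma> \<sigma>\<close>.\<close>
  have diff: "ennreal (norm (radon_integral \<mu> (q c) - \<gamma>)) \<le> (\<integral>\<^sup>+y. ennreal (norm (q c y)) \<partial>diff_variation \<gamma>)" if c: "c \<ge> 1" for c
  proof -
    have "(\<integral>\<^sup>+y. ennreal (norm (q c y)) \<partial>total_variation \<mu>) \<le> (\<integral>\<^sup>+y. ennreal (c ^ ?n * C * (1 + norm x) ^ l) * ennreal (w y) \<partial>total_variation \<mu>)"
      using q_fin[OF c] w0 c C(1) by (intro nn_integral_mono) (simp add: ennreal_mult[symmetric] less_imp_le)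
    also have "\<dots> < \<infinity>" using wT by (simp add: nn_integral_cmult ennreal_mult_less_top)
    finally have r: "integrable \<Lambda> (\<lambda>y. q c y * h y)" "radon_integral \<mu> (q c) = (LINT y|\<Lambda>. q c y * h y)"
      using integral_h[of "q c"] by auto
    have g: "integrable \<Lambda> (\<lambda>y. \<gamma> * (\<sigma> y *\<^sub>R q c y))" "\<gamma> = (LINT y|\<Lambda>. \<gamma> * (\<sigma> y *\<^sub>R q c y))"
    proof -
      have i: "integrable \<Lambda> (\<lambda>y. \<sigma> y *\<^sub>R q c y)" "(LINT y|\<Lambda>. \<sigma> y *\<^sub>R q c y) = 1"
        using intL[OF c] integral_\<sigma>[of "q c"] by simp_all
      show "integrable \<Lambda> (\<lambda>y. \<gamma> * (\<sigma> y *\<^sub>R q c y))" using i(1) by (rule integrable_mult_right)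
      show "\<gamma> = (LINT y|\<Lambda>. \<gamma> * (\<sigma> y *\<^sub>R q c y))"
        by (subst Bochner_Integration.integral_mult_right[OF i(1)]) (simp only: i(2) mult_1_right)
    qed
    have "radon_integral \<mu> (q c) - \<gamma> = (LINT y|\<Lambda>. q c y * h y - \<gamma> * (\<sigma> y *\<^sub>R q c y))"
      using r g by (simp only: Bochner_Integration.integral_diff)
    then have "ennreal (norm (radon_integral \<mu> (q c) - \<gamma>)) \<le> (\<integral>\<^sup>+y. ennreal (norm (q c y * h y - \<gamma> * (\<sigma> y *\<^sub>R q c y))) \<partial>\<Lambda>)"
      using r(1) g(1) by (simp only:) (intro integral_norm_bound_ennreal Bochner_Integration.integrable_diff)
    also have "\<dots> = (\<integral>\<^sup>+y. ennreal (norm (h y - \<gamma> * of_real (\<sigma> y))) * ennreal (norm (q c y)) \<partial>\<Lambda>)"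
    proof (intro nn_integral_cong)
      fix y
      have "q c y * h y - \<gamma> * (\<sigma> y *\<^sub>R q c y) = (h y - \<gamma> * of_real (\<sigma> y)) * q c y"
        by (simp add: scaleR_conv_of_real algebra_simps)
      then show "ennreal (norm (q c y * h y - \<gamma> * (\<sigma> y *\<^sub>R q c y))) = ennreal (norm (h y - \<gamma> * of_real (\<sigma> y))) * ennreal (norm (q c y))"
        by (simp add: norm_mult ennreal_mult)
    qed
    also have "\<dots> = (\<integral>\<^sup>+y. ennreal (norm (q c y)) \<partial>diff_variation \<gamma>)"
      unfolding diff_variation_def by (rule nn_integral_density[symmetric]) auto
    finally show ?thesis .
  qed
  show ?thesis
    unfolding q_def[symmetric]
  proof (rule tendstoI)
    fix e :: real assume e: "e > 0"
    \<comment> \<open>The near part will be bounded by \<open>2 ^ (?n + 2) * C' * \<delta>\<close>;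
      the summand 1 keeps the denominator positive when \<open>C'\<close> is 0.\<close>
    define \<delta> where "\<delta> = e / (2 * (2 ^ (?n + 2) * C' + 1))"
    have K0: "2 ^ (?n + 2) * C' + 1 > 0" using C'(1) by (intro add_nonneg_pos) auto
    then have \<delta>: "\<delta> > 0" "2 ^ (?n + 2) * C' * \<delta> \<le> e / 2" using e C'(1) by (auto simp: \<delta>_def field_simps)
    obtain d where d: "d > 0" "\<And>r. 0 < r \<Longrightarrow> r < d \<Longrightarrow> emeasure (diff_variation \<gamma>) (cball x r) \<le> ennreal (\<delta> * r ^ ?n)"
      using diff_variation_small[OF dens \<delta>(1)] by blast
    define R where "R = d / 2"
    have R: "R > 0" "R < d" using d(1) by (auto simp: R_def)
    \<comment> \<open>\<open>nn_integral_decay_le\<close> asks for the growth bound at all radii,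
      but smallness is known only below \<open>d\<close>; restriction to a ball of radius
      \<open>R < d\<close> extends it to every radius.\<close>
    define M' where "M' = density (diff_variation \<gamma>) (indicator (cball x R))"
    have [measurable]: "cball x r \<in> sets borel" for r by simp
    have sM'[measurable_cong, simp]: "sets M' = sets borel" by (simp add: M'_def)
    have nM': "(\<integral>\<^sup>+y. g y \<partial>M') = (\<integral>\<^sup>+y. g y * indicator (cball x R) y \<partial>diff_variation \<gamma>)" if [measurable]: "g \<in> borel_measurable borel" for g
      unfolding M'_def by (subst nn_integral_density) (auto simp: mult.commute)
    have M': "emeasure M' (cball x r) \<le> ennreal (\<delta> * r ^ ?n)" if r: "r > 0" for r
    proof -
      have "emeasure M' (cball x r) = (\<integral>\<^sup>+y. indicator (cball x (min r R)) y \<partial>diff_variation \<gamma>)"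
      proof -
        have "emeasure M' (cball x r) = (\<integral>\<^sup>+y. indicator (cball x R) y * indicator (cball x r) y \<partial>diff_variation \<gamma>)"
          unfolding M'_def by (rule emeasure_density) auto
        also have "\<dots> = (\<integral>\<^sup>+y. indicator (cball x (min r R)) y \<partial>diff_variation \<gamma>)"
          by (intro nn_integral_cong) (auto simp: indicator_def)
        finally show ?thesis .
      qed
      also have "\<dots> = emeasure (diff_variation \<gamma>) (cball x (min r R))" by (rule nn_integral_indicator) simp
      also have "\<dots> \<le> ennreal (\<delta> * (min r R) ^ ?n)" using r R by (intro d(2)) auto
      also have "\<dots> \<le> ennreal (\<delta> * r ^ ?n)" using \<delta>(1) r R by (intro ennreal_leI mult_left_mono power_mono) auto
      finally show ?thesis .
    qed
    \<comment> \<open>Outside the ball \<open>dist x y\<close> exceeds \<open>R\<close>, so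
      \<open>1 + norm y\<close> is at most \<open>G * dist x y\<close>.\<close>
    define G where "G = (1 + norm x) / R + 1"
    have G: "G > 0" using R by (simp add: G_def add_pos_pos add_pos_nonneg)
    \<comment> \<open>Beyond this scale the tail \<open>C * G ^ l / c * W\<close> is below
      \<open>e / 2\<close>.\<close>
    define c0 where "c0 = max 1 (2 * (C * G ^ l * W) / e + 1)"
    show "\<forall>\<^sub>F c in at_top. dist (radon_integral \<mu> (q c)) \<gamma> < e"
      using eventually_ge_at_top[of c0]
    proof eventually_elim
      case (elim c)
      then have c: "c \<ge> 1" "c > 2 * (C * G ^ l * W) / e" by (auto simp: c0_def)
      have near: "(\<integral>\<^sup>+y. ennreal (norm (q c y)) \<partial>M') \<le> ennreal (e / 2)"
      proof -
        have "(\<integral>\<^sup>+y. ennreal (norm (q c y)) \<partial>M') \<le> (\<integral>\<^sup>+y. ennreal (c ^ ?n * C') * ennreal (1 / (1 + dist x y / (1 / c)) ^ Suc ?n) \<partial>M')"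
        proof (rule nn_integral_mono)
          fix y
          have "norm (Q (c *\<^sub>R x) (c *\<^sub>R y)) \<le> C' * (1 / (1 + c * dist x y) ^ Suc ?n)"
            using C'(2)[of "c *\<^sub>R x" "c *\<^sub>R y"] c by (simp add: dist_scale del: power_Suc)
          then have "c ^ ?n * norm (Q (c *\<^sub>R x) (c *\<^sub>R y)) \<le> c ^ ?n * (C' * (1 / (1 + c * dist x y) ^ Suc ?n))"
            using c by (intro mult_left_mono) auto
          then have "norm (q c y) \<le> c ^ ?n * C' * (1 / (1 + dist x y / (1 / c)) ^ Suc ?n)"
            using c by (simp add: q_def norm_mult norm_power mult_ac del: power_Suc)
          then show "ennreal (norm (q c y)) \<le> ennreal (c ^ ?n * C') * ennreal (1 / (1 + dist x y / (1 / c)) ^ Suc ?n)"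
            using c C'(1) by (subst ennreal_mult'[symmetric]) (auto intro!: ennreal_leI simp del: power_Suc)
        qed
        also have "\<dots> = ennreal (c ^ ?n * C') * (\<integral>\<^sup>+y. ennreal (1 / (1 + dist x y / (1 / c)) ^ Suc ?n) \<partial>M')"
          by (rule nn_integral_cmult) measurable
        also have "\<dots> \<le> ennreal (c ^ ?n * C') * ennreal (2 ^ (?n + 2) * \<delta> * (1 / c) ^ ?n)"
          using c \<delta>(1) by (intro mult_left_mono nn_integral_decay_le M') auto
        also have "\<dots> = ennreal (c ^ ?n * C' * (2 ^ (?n + 2) * \<delta> * (1 / c) ^ ?n))"
          using c C'(1) by (intro ennreal_mult'[symmetric]) auto
        also have "c ^ ?n * C' * (2 ^ (?n + 2) * \<delta> * (1 / c) ^ ?n) = 2 ^ (?n + 2) * C' * \<delta>"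
          using c by (simp add: field_simps)
        also have "ennreal \<dots> \<le> ennreal (e / 2)" by (intro ennreal_leI \<delta>(2))
        finally show ?thesis .
      qed
      have far: "norm (q c y) \<le> C * G ^ l / c * w y" if y: "y \<notin> cball x R" for y
      proof -
        have yR: "dist x y > R" using y by simp
        have "norm y \<le> norm x + dist x y" by (metis dist_commute dist_norm norm_triangle_sub)
        then have "1 + norm y \<le> (1 + norm x) * 1 + dist x y" by simp
        also have "\<dots> \<le> (1 + norm x) * (dist x y / R) + dist x y"
          using yR R by (intro add_right_mono mult_left_mono) auto
        also have "\<dots> = G * dist x y" by (simp add: G_def field_simps)
        finally have "(c * (1 + norm y)) ^ l \<le> (c * (G * dist x y)) ^ l" using c by (intro power_mono mult_left_mono) auto
        also have "\<dots> = G ^ l * (c * dist x y) ^ l" by (simp add: power_mult_distrib mult_ac)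
        also have "\<dots> \<le> G ^ l * (1 + c * dist x y) ^ l" using G c by (intro mult_left_mono power_mono) auto
        finally have "c ^ l * (1 + norm y) ^ l \<le> G ^ l * (1 + c * dist x y) ^ l" by (simp add: power_mult_distrib)
        moreover have "c ^ Suc ?n \<le> c ^ l" using c l by (intro power_increasing) auto
        then have "c ^ Suc ?n * (1 + norm y) ^ l \<le> c ^ l * (1 + norm y) ^ l" by (intro mult_right_mono) auto
        ultimately have *: "c ^ Suc ?n * (1 + norm y) ^ l \<le> G ^ l * (1 + c * dist x y) ^ l" by linarith
        have p: "(1 + norm y) ^ l > 0" "(1 + c * dist x y) ^ l > 0" using c by (auto intro!: zero_less_power simp: add_pos_nonneg)
        have "c ^ ?n * (1 / (1 + c * dist x y) ^ l) \<le> G ^ l / c * w y"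
          using * c p by (simp add: w_def field_simps)
        then have "C * (c ^ ?n * (1 / (1 + c * dist x y) ^ l)) \<le> C * (G ^ l / c * w y)" using C(1) by (rule mult_left_mono)
        moreover have "norm (q c y) \<le> c ^ ?n * (C * (1 / (1 + c * dist x y) ^ l))"
        proof -
          have "norm (Q (c *\<^sub>R x) (c *\<^sub>R y)) \<le> C * (1 / (1 + c * dist x y) ^ l)"
            using C(2)[of "c *\<^sub>R x" "c *\<^sub>R y"] c by (simp add: dist_scale)
          then have "c ^ ?n * norm (Q (c *\<^sub>R x) (c *\<^sub>R y)) \<le> c ^ ?n * (C * (1 / (1 + c * dist x y) ^ l))"
            using c by (intro mult_left_mono) auto
          then show ?thesis using c by (simp add: q_def norm_mult norm_power)
        qed
        ultimately show ?thesis by (simp add: mult_ac)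
      qed
      have "(\<integral>\<^sup>+y. ennreal (norm (q c y)) \<partial>diff_variation \<gamma>)
          \<le> (\<integral>\<^sup>+y. ennreal (norm (q c y)) * indicator (cball x R) y + ennreal (C * G ^ l / c) * ennreal (w y) \<partial>diff_variation \<gamma>)"
      proof (rule nn_integral_mono)
        fix y
        show "ennreal (norm (q c y)) \<le> ennreal (norm (q c y)) * indicator (cball x R) y + ennreal (C * G ^ l / c) * ennreal (w y)"
        proof (cases "y \<in> cball x R")
          case False
          have "ennreal (norm (q c y)) \<le> ennreal (C * G ^ l / c * w y)" by (intro ennreal_leI far False)
          also have "\<dots> = ennreal (C * G ^ l / c) * ennreal (w y)" using w0[of y] by (intro ennreal_mult'') simp
          finally show ?thesis using False by simp
        qed simp
      qed
      also have "\<dots> = (\<integral>\<^sup>+y. ennreal (norm (q c y)) \<partial>M') + ennreal (C * G ^ l / c) * ennreal W"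
        by (subst nn_integral_add) (auto simp: nn_integral_cmult W nM')
      also have "\<dots> \<le> ennreal (e / 2) + ennreal (C * G ^ l / c * W)"
        using near by (intro add_mono) (simp_all only: ennreal_mult''[OF W0] order_refl)
      also have "\<dots> = ennreal (e / 2 + C * G ^ l / c * W)"
        using e C(1) G c W0 by (intro ennreal_plus[symmetric]) auto
      finally have "ennreal (norm (radon_integral \<mu> (q c) - \<gamma>)) \<le> ennreal (e / 2 + C * G ^ l / c * W)"
        using diff[OF c(1)] by (rule order_trans[rotated])
      then have "norm (radon_integral \<mu> (q c) - \<gamma>) \<le> e / 2 + C * G ^ l / c * W"
        using e C(1) G c W0 by (subst (asm) ennreal_le_iff) auto
      moreover have "C * G ^ l / c * W < e / 2" using c e by (simp add: field_simps)
      ultimately have "norm (radon_integral \<mu> (q c) - \<gamma>) < e" by linarith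
      then show ?case by (simp add: dist_norm)
    qed
  qed
qed

section \<open>The lattice kernel of a rapidly decaying scaling function\<close>

lemma int_lattice_add: "m \<in> int_lattice \<Longrightarrow> m' \<in> int_lattice \<Longrightarrow> m + m' \<in> int_lattice"
  and int_lattice_diff: "m \<in> int_lattice \<Longrightarrow> m' \<in> int_lattice \<Longrightarrow> m - m' \<in> int_lattice"
  by (auto simp: int_lattice_def)

lemma int_lattice_separated:
  fixes m m' :: "real^'n"
  assumes "m \<in> int_lattice" "m' \<in> int_lattice" "m \<noteq> m'" shows "1 \<le> dist m m'"
proof -
  obtain i where i: "m $ i \<noteq> m' $ i" using assms(3) by (auto simp: vec_eq_iff)
  have "m $ i - m' $ i \<in> \<int>" using assms by (auto simp: int_lattice_def)
  then have "1 \<le> \<bar>(m - m') $ i\<bar>" using i Ints_nonzero_abs_ge1[of "m $ i - m' $ i"] by simp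
  also have "\<dots> \<le> norm (m - m')" by (rule component_le_norm_cart)
  finally show ?thesis by (simp add: dist_norm)
qed

lemma countable_int_lattice: "countable (int_lattice :: (real^'n) set)"
proof -
  have "(int_lattice :: (real^'n) set) \<subseteq> range (\<lambda>f :: int^'n. \<chi> i. of_int (f $ i))"
  proof
    fix m :: "real^'n" assume "m \<in> int_lattice"
    then have "m = (\<chi> i. of_int ((\<chi> i. \<lfloor>m $ i\<rfloor>) $ i))" by (auto simp: int_lattice_def vec_eq_iff)
    then show "m \<in> range (\<lambda>f :: int^'n. \<chi> i. of_int (f $ i))" by blast
  qed
  then show ?thesis by (rule countable_subset) simp
qed

text \<open>Together with countability this permits an enumeration by the naturals, which turns
  lattice sums into ordinary series.\<close>

lemma infinite_int_lattice: "infinite (int_lattice :: (real^'n) set)"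
proof
  assume "finite (int_lattice :: (real^'n) set)"
  then have "finite (range (\<lambda>k::nat. (\<chi> i. of_nat k) :: real^'n))"
    by (rule finite_subset[rotated]) (auto simp: int_lattice_def)
  moreover have "inj (\<lambda>k::nat. (\<chi> i. of_nat k) :: real^'n)" by (auto simp: inj_def vec_eq_iff)
  ultimately show False by (simp add: finite_image_iff)
qed

text \<open>Comparison with an integral: balls of radius 1/2 about distinct lattice points are
  disjoint, and on each of them the decay function varies only by a constant factor.\<close>

lemma int_lattice_sum_bounded:
  obtains K where "\<And>(x::real^'n) F. finite F \<Longrightarrow> F \<subseteq> int_lattice \<Longrightarrow> (\<Sum>m\<in>F. 1 / (1 + dist x m) ^ Suc CARD('n)) \<le> K"
proof
  let ?n = "CARD('n)" and ?L = "Suc CARD('n)"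
  define v where "v = unit_ball_vol (real ?n) * (1/2) ^ ?n"
  define I where "I = 2 ^ (?n + 2) * unit_ball_vol (real ?n) * 1 ^ ?n"
  have v: "v > 0" by (simp add: v_def)
  have I: "I \<ge> 0" by (simp add: I_def)
  fix x :: "real^'n" and F :: "(real^'n) set" assume F: "finite F" "F \<subseteq> int_lattice"
  define a where "a m = 1 / (1 + dist x m) ^ ?L" for m
  have a0: "a m \<ge> 0" for m by (simp add: a_def)
  have vb: "emeasure lborel (ball m (1/2)) = ennreal v" for m :: "real^'n"
    using emeasure_ball[of "1/2" m] by (simp add: v_def)
  have [measurable]: "ball m r \<in> sets borel" for m :: "real^'n" and r by simp
  \<comment> \<open>At most one of the balls contains \<open>y\<close>; going from \<open>y\<close>
    to its centre changes 1 + dist by a factor of at most 3/2.\<close>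
  have pt: "(\<Sum>m\<in>F. ennreal (a m) * indicator (ball m (1/2)) y) \<le> ennreal ((3/2) ^ ?L) * ennreal (1 / (1 + dist x y / 1) ^ ?L)" for y
  proof (cases "\<exists>m0\<in>F. y \<in> ball m0 (1/2)")
    case True
    then obtain m0 where m0: "m0 \<in> F" "dist m0 y < 1/2" by auto
    have other: "y \<notin> ball m (1/2)" if "m \<in> F" "m \<noteq> m0" for m
    proof -
      have "1 \<le> dist m m0" using that m0 F(2) by (intro int_lattice_separated) auto
      then show ?thesis using m0(2) dist_triangle[of m m0 y] by (simp add: dist_commute)
    qed
    have "(\<Sum>m\<in>F. ennreal (a m) * indicator (ball m (1/2)) y) = (\<Sum>m\<in>F. if m = m0 then ennreal (a m0) else 0)"
      using other m0 by (intro sum.cong refl) (auto simp: indicator_def)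
    also have "\<dots> = ennreal (a m0)" using F(1) m0(1) by simp
    also have "a m0 \<le> (3/2) ^ ?L * (1 / (1 + dist x y / 1) ^ ?L)"
    proof -
      have "1 + dist x y \<le> (3/2) * (1 + dist x m0)" using dist_triangle[of x y m0] m0(2) zero_le_dist[of x m0] unfolding distrib_left by linarith
      then have "(1 + dist x y) ^ ?L \<le> ((3/2) * (1 + dist x m0)) ^ ?L" by (intro power_mono) auto
      also have "\<dots> = (3/2) ^ ?L * (1 + dist x m0) ^ ?L" by (rule power_mult_distrib)
      finally have le: "(1 + dist x y) ^ ?L \<le> (3/2) ^ ?L * (1 + dist x m0) ^ ?L" .
      have p: "(1 + dist x y) ^ ?L > 0" "(1 + dist x m0) ^ ?L > 0" by (auto intro!: zero_less_power add_pos_nonneg simp del: power_Suc)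
      from le p show ?thesis unfolding a_def div_by_1 by (simp add: divide_le_eq le_divide_eq mult.commute del: power_Suc)
    qed
    finally show ?thesis by (subst ennreal_mult'[symmetric]) (auto intro: ennreal_leI)
  next
    case False
    then have "(\<Sum>m\<in>F. ennreal (a m) * indicator (ball m (1/2)) y) = 0" by (auto simp: indicator_def)
    then show ?thesis by simp
  qed
  have "ennreal ((\<Sum>m\<in>F. a m) * v) = (\<Sum>m\<in>F. ennreal (a m) * ennreal v)"
    using a0 v by (simp add: sum_distrib_right ennreal_mult[symmetric] sum_nonneg less_imp_le)
  also have "\<dots> = (\<integral>\<^sup>+y. (\<Sum>m\<in>F. ennreal (a m) * indicator (ball m (1/2)) y) \<partial>lborel)"
    by (subst nn_integral_sum) (auto simp: nn_integral_cmult_indicator vb)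
  also have "\<dots> \<le> (\<integral>\<^sup>+y. ennreal ((3/2) ^ ?L) * ennreal (1 / (1 + dist x y / 1) ^ ?L) \<partial>lborel)"
    by (intro nn_integral_mono pt)
  also have "\<dots> = ennreal ((3/2) ^ ?L) * (\<integral>\<^sup>+y. ennreal (1 / (1 + dist x y / 1) ^ ?L) \<partial>lborel)"
    by (rule nn_integral_cmult) measurable
  also have "\<dots> \<le> ennreal ((3/2) ^ ?L) * ennreal I"
    unfolding I_def by (intro mult_left_mono nn_integral_decay_le) (auto simp: emeasure_cball)
  also have "\<dots> = ennreal ((3/2) ^ ?L * I)" using I by (intro ennreal_mult[symmetric]) auto
  finally have "(\<Sum>m\<in>F. a m) * v \<le> (3/2) ^ ?L * I"
    using I by (subst (asm) ennreal_le_iff) auto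
  then show "(\<Sum>m\<in>F. 1 / (1 + dist x m) ^ ?L) \<le> (3/2) ^ ?L * I / v"
    using v unfolding a_def by (simp add: le_divide_eq)
qed

text \<open>Continuity bounds the function on a compact ball. Outside it, decay at the two exponents
  0 and \<open>l\<close> is enough because (1 + t)^l is at most 2^l (1 + t^l).\<close>

lemma rapid_decay_bound:
  fixes \<phi> :: "real^'n \<Rightarrow> complex"
  assumes cont: "continuous_on UNIV \<phi>"
    and decay: "\<And>l::nat. ((\<lambda>x. of_real (norm x ^ l) * \<phi> x) \<longlongrightarrow> 0) at_infinity"
  shows "\<exists>C>0. \<forall>x. norm (\<phi> x) \<le> C / (1 + norm x) ^ l"
proof -
  have "\<exists>b. \<forall>x. norm x \<ge> b \<longrightarrow> norm x ^ k * norm (\<phi> x) < 1" for k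
  proof -
    have "\<forall>\<^sub>F x in at_infinity. dist (of_real (norm x ^ k) * \<phi> x) 0 < 1"
      using decay[of k] by (rule tendstoD) simp
    then show ?thesis by (simp add: eventually_at_infinity norm_mult norm_power)
  qed
  then obtain b0 b1 where b0: "\<And>x. norm x \<ge> b0 \<Longrightarrow> norm x ^ 0 * norm (\<phi> x) < 1"
    and b1: "\<And>x. norm x \<ge> b1 \<Longrightarrow> norm x ^ l * norm (\<phi> x) < 1" by meson
  define b where "b = max b0 b1"
  have "compact ((\<lambda>x. (1 + norm x) ^ l * norm (\<phi> x)) ` cball 0 b)"
    using cont by (intro compact_continuous_image continuous_intros) (auto intro: continuous_on_subset)
  then have "bounded ((\<lambda>x. (1 + norm x) ^ l * norm (\<phi> x)) ` cball 0 b)" by (rule compact_imp_bounded)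
  then obtain B where B: "B > 0" "\<And>x. norm x \<le> b \<Longrightarrow> (1 + norm x) ^ l * norm (\<phi> x) \<le> B"
    unfolding bounded_pos by (auto simp: abs_le_iff)
  define C where "C = max B (2 ^ l * 2)"
  have "(1 + norm x) ^ l * norm (\<phi> x) \<le> C" for x
  proof (cases "norm x \<le> b")
    case True then show ?thesis using B(2)[of x] by (simp add: C_def)
  next
    case False
    have "(1 + norm x) ^ l \<le> (2 * max 1 (norm x)) ^ l" by (intro power_mono) auto
    also have "\<dots> \<le> 2 ^ l * (1 + norm x ^ l)" by (auto simp: power_mult_distrib max_def)
    finally have "(1 + norm x) ^ l * norm (\<phi> x) \<le> 2 ^ l * (1 + norm x ^ l) * norm (\<phi> x)" by (rule mult_right_mono) simp
    also have "\<dots> = 2 ^ l * (norm (\<phi> x) + norm x ^ l * norm (\<phi> x))" by (simp add: algebra_simps)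
    also have "\<dots> \<le> 2 ^ l * 2"
    proof (intro mult_left_mono)
      have "b0 \<le> norm x" "b1 \<le> norm x" using False by (simp_all add: b_def)
      then show "norm (\<phi> x) + norm x ^ l * norm (\<phi> x) \<le> 2" using b0[of x] b1[of x] by simp
    qed simp
    finally show ?thesis by (simp add: C_def)
  qed
  moreover have "C > 0" using B(1) by (simp add: C_def)
  moreover have "(1 + norm x) ^ l > 0" for x :: "real^'n" by (intro zero_less_power) (simp add: add_pos_nonneg)
  ultimately show ?thesis by (intro exI[of _ C]) (simp add: le_divide_eq mult.commute)
qed

lemma borel_measurable_cnj [measurable]:
  "f \<in> borel_measurable M \<Longrightarrow> (\<lambda>x. cnj (f x)) \<in> borel_measurable M"
  by (rule measurable_compose[OF _ borel_measurable_continuous_onI]) (auto intro: continuous_intros)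

section \<open>The kernel as a series of translates\<close>

text \<open>Only continuity and decay are kept; orthonormality and the multiresolution structure
  enter when the value of the integral is found. The enumeration \<open>e\<close> provides partial
  sums, and absolute convergence makes its choice immaterial.\<close>

locale scaling_kernel =
  fixes \<phi> :: "real^'n \<Rightarrow> complex" and e :: "nat \<Rightarrow> real^'n"
  assumes \<phi>_cont: "continuous_on UNIV \<phi>"
    and \<phi>_decay: "\<exists>C>0. \<forall>x. norm (\<phi> x) \<le> C / (1 + norm x) ^ l"
    and e_bij: "bij_betw e UNIV int_lattice"
begin

definition \<Phi> :: "nat \<Rightarrow> real^'n \<Rightarrow> complex" where "\<Phi> k x = \<phi> (x - e k)"

lemma \<Phi>_borel [measurable]: "\<Phi> k \<in> borel_measurable borel"
  unfolding \<Phi>_def by (intro borel_measurable_continuous_onI continuous_on_compose2[OF \<phi>_cont] continuous_intros) auto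

lemma \<Phi>_decay: "\<exists>C>0. \<forall>k x. norm (\<Phi> k x) \<le> C / (1 + dist x (e k)) ^ l"
  using \<phi>_decay[of l] unfolding \<Phi>_def dist_norm by blast

lemma lattice_sum_le: "\<exists>K. \<forall>x N. (\<Sum>k<N. 1 / (1 + dist x (e k)) ^ Suc CARD('n)) \<le> K"
proof -
  obtain K where K: "\<And>(x::real^'n) F. finite F \<Longrightarrow> F \<subseteq> int_lattice \<Longrightarrow> (\<Sum>m\<in>F. 1 / (1 + dist x m) ^ Suc CARD('n)) \<le> K"
    using int_lattice_sum_bounded by blast
  have "(\<Sum>k<N. 1 / (1 + dist x (e k)) ^ Suc CARD('n)) \<le> K" for x N
  proof -
    have inj: "inj_on e {..<N}" using e_bij by (auto simp: bij_betw_def intro: inj_on_subset)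
    have "(\<Sum>k<N. 1 / (1 + dist x (e k)) ^ Suc CARD('n)) = (\<Sum>m\<in>e ` {..<N}. 1 / (1 + dist x m) ^ Suc CARD('n))"
      by (simp only: sum.reindex[OF inj] o_def)
    also have "\<dots> \<le> K" using e_bij by (intro K) (auto simp: bij_betw_def)
    finally show ?thesis .
  qed
  then show ?thesis by blast
qed

text \<open>Because (1 + |x - m|) (1 + |y - m|) is at least 1 + |x - y|, \<open>l\<close> of the
  available powers pay for decay off the diagonal and the other n + 1 for summation over the
  lattice. Uniformity in \<open>N\<close> gives a dominating function.\<close>

lemma kernel_sum_le: "\<exists>C\<ge>0. \<forall>x y N. (\<Sum>k<N. norm (\<Phi> k x) * norm (\<Phi> k y)) \<le> C / (1 + dist x y) ^ l"
proof -
  obtain K where K: "\<And>x N. (\<Sum>k<N. 1 / (1 + dist x (e k)) ^ Suc CARD('n)) \<le> K"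
    using lattice_sum_le by blast
  have "K \<ge> 0" using K[where N=0] by simp
  obtain C where C: "C > 0" "\<And>k x. norm (\<Phi> k x) \<le> C / (1 + dist x (e k)) ^ (l + Suc CARD('n))"
    using \<Phi>_decay by blast
  have "(\<Sum>k<N. norm (\<Phi> k x) * norm (\<Phi> k y)) \<le> C * C * K / (1 + dist x y) ^ l" for x y N
  proof -
    have le: "norm (\<Phi> k x) * norm (\<Phi> k y) \<le> C * C / (1 + dist x y) ^ l * (1 / (1 + dist x (e k)) ^ Suc CARD('n))" for k
    proof -
      define a where "a = 1 + dist x (e k)"
      define b where "b = 1 + dist y (e k)"
      define d where "d = 1 + dist x y"
      have ab: "a \<ge> 1" "b \<ge> 1" "d \<ge> 1" by (auto simp: a_def b_def d_def)
      have "d \<le> a * b"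
      proof -
        have "0 \<le> dist x (e k) * dist y (e k)" by simp
        moreover have "a * b = 1 + dist x (e k) + dist y (e k) + dist x (e k) * dist y (e k)"
          by (simp add: a_def b_def algebra_simps)
        ultimately show ?thesis using dist_triangle2[of x y "e k"] unfolding d_def by linarith
      qed
      then have dl: "d ^ l \<le> a ^ l * b ^ l" using ab unfolding power_mult_distrib[symmetric] by (intro power_mono) auto
      have "norm (\<Phi> k x) * norm (\<Phi> k y) \<le> C / a ^ (l + Suc CARD('n)) * (C / b ^ (l + Suc CARD('n)))"
        unfolding a_def b_def using C(1) by (intro mult_mono C) (auto intro!: divide_nonneg_nonneg)
      also have "\<dots> \<le> C / a ^ (l + Suc CARD('n)) * (C / b ^ l)"
        using ab C(1) by (intro mult_left_mono divide_left_mono power_increasing mult_pos_pos zero_less_power divide_nonneg_nonneg) auto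
      also have "\<dots> = C * C / (a ^ l * b ^ l) * (1 / a ^ Suc CARD('n))"
        by (simp add: power_add)
      also have "\<dots> \<le> C * C / d ^ l * (1 / a ^ Suc CARD('n))"
        using ab C(1) dl by (intro mult_right_mono divide_left_mono mult_pos_pos zero_less_power) auto
      finally show ?thesis by (simp add: a_def d_def)
    qed
    have "(\<Sum>k<N. norm (\<Phi> k x) * norm (\<Phi> k y)) \<le> (\<Sum>k<N. C * C / (1 + dist x y) ^ l * (1 / (1 + dist x (e k)) ^ Suc CARD('n)))"
      by (intro sum_mono le)
    also have "\<dots> = C * C / (1 + dist x y) ^ l * (\<Sum>k<N. 1 / (1 + dist x (e k)) ^ Suc CARD('n))"
      by (simp only: sum_distrib_left)
    also have "\<dots> \<le> C * C / (1 + dist x y) ^ l * K" using C(1) by (intro mult_left_mono K) auto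
    finally show ?thesis by simp
  qed
  then show ?thesis using C(1) \<open>K \<ge> 0\<close> by (intro exI[of _ "C * C * K"]) auto
qed

lemma summable_kernel: "summable (\<lambda>k. norm (\<Phi> k x * cnj (\<Phi> k y)))"
proof -
  obtain C where C: "\<And>x y N. (\<Sum>k<N. norm (\<Phi> k x) * norm (\<Phi> k y)) \<le> C / (1 + dist x y) ^ 0"
    using kernel_sum_le by blast
  show ?thesis
    by (rule bounded_imp_summable[of _ "C / (1 + dist x y) ^ 0"])
      (use C[where N="Suc _" and x=x and y=y] in \<open>auto simp: norm_mult lessThan_Suc_atMost\<close>)
qed

text \<open>\<open>q0_kernel\<close> is an unordered sum, with default value 0 in case of
  divergence; absolute summability excludes this case and makes it the limit of partial
  sums.\<close>

lemma sums_q0_kernel: "(\<lambda>k. \<Phi> k x * cnj (\<Phi> k y)) sums q0_kernel \<phi> x y"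
proof -
  have "q0_kernel \<phi> x y = (\<Sum>\<^sub>\<infinity>k\<in>UNIV. \<phi> (x - e k) * cnj (\<phi> (y - e k)))"
    unfolding q0_kernel_def by (rule infsum_reindex_bij_betw[OF e_bij, symmetric])
  moreover have "((\<lambda>k. \<Phi> k x * cnj (\<Phi> k y)) has_sum (\<Sum>\<^sub>\<infinity>k\<in>UNIV. \<Phi> k x * cnj (\<Phi> k y))) UNIV"
    by (intro has_sum_infsum norm_summable_imp_summable_on summable_kernel)
  ultimately show ?thesis unfolding \<Phi>_def by (auto dest: has_sum_imp_sums)
qed

definition partial_kernel :: "nat \<Rightarrow> real^'n \<Rightarrow> real^'n \<Rightarrow> complex" where
  "partial_kernel N x y = (\<Sum>k<N. \<Phi> k x * cnj (\<Phi> k y))"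

lemma partial_kernel_tendsto: "(\<lambda>N. partial_kernel N x y) \<longlonglongrightarrow> q0_kernel \<phi> x y"
  using sums_q0_kernel by (simp add: sums_def partial_kernel_def)

lemma partial_kernel_borel [measurable]: "partial_kernel N x \<in> borel_measurable borel"
  unfolding partial_kernel_def by measurable

lemma q0_kernel_borel [measurable]: "q0_kernel \<phi> x \<in> borel_measurable borel"
  by (rule borel_measurable_LIMSEQ_metric[OF partial_kernel_borel partial_kernel_tendsto])

lemma partial_kernel_decay: "\<exists>C\<ge>0. \<forall>x y N. norm (partial_kernel N x y) \<le> C / (1 + dist x y) ^ l"
proof -
  obtain C where C: "C \<ge> 0" "\<And>x y N. (\<Sum>k<N. norm (\<Phi> k x) * norm (\<Phi> k y)) \<le> C / (1 + dist x y) ^ l"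
    using kernel_sum_le by blast
  have "norm (partial_kernel N x y) \<le> C / (1 + dist x y) ^ l" for x y N
    using norm_sum[of "\<lambda>k. \<Phi> k x * cnj (\<Phi> k y)" "{..<N}"] C(2)[where N=N and x=x and y=y]
    by (simp add: partial_kernel_def norm_mult)
  with C(1) show ?thesis by blast
qed

lemma q0_kernel_decay: "\<exists>C\<ge>0. \<forall>x y. norm (q0_kernel \<phi> x y) \<le> C / (1 + dist x y) ^ l"
proof -
  obtain C where C: "C \<ge> 0" "\<And>x y N. norm (partial_kernel N x y) \<le> C / (1 + dist x y) ^ l"
    using partial_kernel_decay by blast
  have "norm (q0_kernel \<phi> x y) \<le> C / (1 + dist x y) ^ l" for x y
    by (rule LIMSEQ_le_const2[OF tendsto_norm[OF partial_kernel_tendsto]]) (use C in auto)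
  with C(1) show ?thesis by blast
qed

lemma integrable_decay:
  fixes x :: "real^'n"
  shows "integrable lborel (\<lambda>y. C / (1 + dist x y) ^ Suc CARD('n))"
proof -
  have "integrable lborel (\<lambda>y. 1 / (1 + dist x y) ^ Suc CARD('n))"
    using nn_integral_lborel_decay_finite[of "Suc CARD('n)" x, OF order_refl]
    by (intro integrableI_nonneg) (auto simp del: power_Suc)
  from integrable_mult_right[OF this, of C] show ?thesis by simp
qed

text \<open>Dominated convergence, with decay of order n + 1 as the bound. The functions
  \<open>f\<close> of interest are the constant 1 and indicators of balls.\<close>

lemma integral_partial_kernel_tendsto:
  assumes f[measurable]: "f \<in> borel_measurable borel" and f1: "\<And>y. norm (f y) \<le> 1"
  shows "integrable lborel (\<lambda>y. q0_kernel \<phi> x y * f y)"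
    and "\<And>N. integrable lborel (\<lambda>y. partial_kernel N x y * f y)"
    and "(\<lambda>N. LINT y|lborel. partial_kernel N x y * f y) \<longlonglongrightarrow> (LINT y|lborel. q0_kernel \<phi> x y * f y)"
proof -
  obtain C where C: "C \<ge> 0" "\<And>x y N. norm (partial_kernel N x y) \<le> C / (1 + dist x y) ^ Suc CARD('n)"
    using partial_kernel_decay by blast
  have "norm (partial_kernel N x y * f y) \<le> C / (1 + dist x y) ^ Suc CARD('n)" for N y
    using mult_mono[OF C(2)[where N=N and x=x and y=y] f1[of y]] C(1) by (simp add: norm_mult del: power_Suc)
  note dc = this
  show "integrable lborel (\<lambda>y. q0_kernel \<phi> x y * f y)"
    "\<And>N. integrable lborel (\<lambda>y. partial_kernel N x y * f y)"
    "(\<lambda>N. LINT y|lborel. partial_kernel N x y * f y) \<longlonglongrightarrow> (LINT y|lborel. q0_kernel \<phi> x y * f y)"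
    by (rule integrable_dominated_convergence[where w="\<lambda>y. C / (1 + dist x y) ^ Suc CARD('n)" and s="\<lambda>N y. partial_kernel N x y * f y"]
        integrable_dominated_convergence2[where w="\<lambda>y. C / (1 + dist x y) ^ Suc CARD('n)" and s="\<lambda>N y. partial_kernel N x y * f y" and f="\<lambda>y. q0_kernel \<phi> x y * f y"]
        integral_dominated_convergence[where w="\<lambda>y. C / (1 + dist x y) ^ Suc CARD('n)"];
        (intro AE_I2 tendsto_mult partial_kernel_tendsto tendsto_const dc integrable_decay | measurable))+
qed

section \<open>The kernel integrated over its second variable\<close>

definition kernel_integral :: "real^'n \<Rightarrow> complex" where "kernel_integral x = (LINT y|lborel. q0_kernel \<phi> x y)"

lemma integral_\<Phi>: "(LINT y|lborel. \<Phi> k y) = (LINT y|lborel. \<phi> y)"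
proof -
  have "(LINT y|lborel. \<Phi> k y) = (LINT y|lborel. \<Phi> k (e k + 1 *\<^sub>R y))"
    using lborel_integral_scale[of "\<Phi> k" 1 "e k"] by simp
  then show ?thesis by (simp add: \<Phi>_def)
qed

lemma integrable_\<Phi>: "integrable lborel (\<lambda>y. \<Phi> k y)"
proof -
  obtain C where C: "C > 0" "\<And>k x. norm (\<Phi> k x) \<le> C / (1 + dist x (e k)) ^ Suc CARD('n)"
    using \<Phi>_decay by blast
  show ?thesis
    by (rule Bochner_Integration.integrable_bound[OF integrable_decay[of C "e k"]])
      (use C in \<open>auto simp: dist_commute simp del: power_Suc\<close>)
qed

text \<open>All translates have the same integral, so termwise integration leaves a series in
  \<open>x\<close> alone, from which continuity can be read off.\<close>

lemma kernel_integral_sums: "(\<lambda>k. \<Phi> k x * (LINT y|lborel. cnj (\<phi> y))) sums kernel_integral x"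
proof -
  have "(\<lambda>N. LINT y|lborel. partial_kernel N x y * 1) \<longlonglongrightarrow> (LINT y|lborel. q0_kernel \<phi> x y * 1)"
    by (rule integral_partial_kernel_tendsto) auto
  moreover have "(LINT y|lborel. partial_kernel N x y * 1) = (\<Sum>k<N. \<Phi> k x * (LINT y|lborel. cnj (\<phi> y)))" for N
    unfolding partial_kernel_def mult_1_right
    by (subst Bochner_Integration.integral_sum) (simp_all add: integral_\<Phi> integrable_\<Phi>)
  ultimately show ?thesis by (simp add: sums_def kernel_integral_def)
qed

text \<open>Weierstrass test on the unit ball about \<open>x\<close>: there 1 + dist x (e k) is at
  most twice 1 + dist z (e k), so one summable majorant serves all \<open>z\<close>.\<close>

lemma kernel_integral_continuous: "isCont kernel_integral x"
proof -
  define c where "c = (LINT y|lborel. cnj (\<phi> y))"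
  obtain K where K: "\<And>x N. (\<Sum>k<N. 1 / (1 + dist x (e k)) ^ Suc CARD('n)) \<le> K"
    using lattice_sum_le by blast
  obtain C where C: "C > 0" "\<And>k x. norm (\<Phi> k x) \<le> C / (1 + dist x (e k)) ^ Suc CARD('n)"
    using \<Phi>_decay by blast
  define M where "M k = C * 2 ^ Suc CARD('n) * norm c * (1 / (1 + dist x (e k)) ^ Suc CARD('n))" for k
  have "summable (\<lambda>k. 1 / (1 + dist x (e k)) ^ Suc CARD('n))"
    by (rule bounded_imp_summable[of _ K]) (use K[where x=x and N="Suc _"] in \<open>auto simp: lessThan_Suc_atMost simp del: power_Suc\<close>)
  then have sM: "summable M" unfolding M_def by (rule summable_mult)
  have "uniform_limit (ball x 1) (\<lambda>N x. \<Sum>k<N. \<Phi> k x * c) (\<lambda>x. \<Sum>k. \<Phi> k x * c) sequentially"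
  proof (rule Weierstrass_m_test[OF _ sM])
    fix k z assume z: "z \<in> ball x 1"
    have p: "1 + dist x (e k) > 0" "1 + dist z (e k) > 0" by (auto simp: add_pos_nonneg)
    have "1 + dist x (e k) \<le> 2 * (1 + dist z (e k))"
      using z dist_triangle[of x "e k" z] zero_le_dist[of z "e k"] unfolding distrib_left mem_ball by linarith
    then have "(1 + dist x (e k)) ^ Suc CARD('n) \<le> (2 * (1 + dist z (e k))) ^ Suc CARD('n)" using p by (intro power_mono) auto
    then have "(1 + dist x (e k)) ^ Suc CARD('n) \<le> 2 ^ Suc CARD('n) * (1 + dist z (e k)) ^ Suc CARD('n)"
      by (simp only: power_mult_distrib)
    then have "1 / (1 + dist z (e k)) ^ Suc CARD('n) \<le> 2 ^ Suc CARD('n) * (1 / (1 + dist x (e k)) ^ Suc CARD('n))"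
      using zero_less_power[OF p(1), of "Suc CARD('n)"] zero_less_power[OF p(2), of "Suc CARD('n)"]
      by (simp add: divide_le_eq le_divide_eq mult.commute del: power_Suc)
    then have "C * (1 / (1 + dist z (e k)) ^ Suc CARD('n)) \<le> C * (2 ^ Suc CARD('n) * (1 / (1 + dist x (e k)) ^ Suc CARD('n)))"
      using C(1) by (intro mult_left_mono) auto
    moreover have "norm (\<Phi> k z) \<le> C * (1 / (1 + dist z (e k)) ^ Suc CARD('n))" using C(2)[of k z] by simp
    ultimately have "norm (\<Phi> k z) * norm c \<le> C * (2 ^ Suc CARD('n) * (1 / (1 + dist x (e k)) ^ Suc CARD('n))) * norm c"
      by (intro mult_right_mono) auto
    then show "norm (\<Phi> k z * c) \<le> M k" by (simp only: norm_mult M_def mult_ac)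
  qed
  moreover have "(\<lambda>x. \<Sum>k. \<Phi> k x * c) = kernel_integral"
    using kernel_integral_sums by (auto simp: sums_iff c_def)
  ultimately have "uniform_limit (ball x 1) (\<lambda>N x. \<Sum>k<N. \<Phi> k x * c) kernel_integral sequentially" by simp
  then have "continuous_on (ball x 1) kernel_integral"
    by (rule uniform_limit_theorem[rotated])
      (auto intro!: always_eventually continuous_intros continuous_on_compose2[OF \<phi>_cont] simp: \<Phi>_def)
  then show ?thesis by (simp add: continuous_on_eq_continuous_at)
qed

text \<open>Shifting both arguments by a lattice vector permutes the terms of the kernel, and
  Lebesgue measure is translation invariant.\<close>

lemma kernel_integral_periodic:
  assumes m: "m \<in> int_lattice" shows "kernel_integral (x + m) = kernel_integral x"
proof -
  have "bij_betw (\<lambda>k. k + m) int_lattice int_lattice"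
    by (rule bij_betwI[where g="\<lambda>k. k - m"]) (use m in \<open>auto intro: int_lattice_add int_lattice_diff\<close>)
  then have "q0_kernel \<phi> (x + m) (y + m) = q0_kernel \<phi> x y" for y
    unfolding q0_kernel_def
    by (subst infsum_reindex_bij_betw[symmetric, where g="\<lambda>k. k + m" and A=int_lattice]) simp_all
  then have "(LINT y|lborel. q0_kernel \<phi> (x + m) (m + 1 *\<^sub>R y)) = kernel_integral x"
    by (simp add: kernel_integral_def add.commute)
  then show ?thesis using lborel_integral_scale[of "q0_kernel \<phi> (x + m)" 1 m] by (simp add: kernel_integral_def)
qed

end

section \<open>Best approximation and reproduction of constants\<close>

lemma L2_measurable [measurable_dest]: "f \<in> L2 \<Longrightarrow> f \<in> borel_measurable lebesgue"
  and L2_integrable: "f \<in> L2 \<Longrightarrow> integrable lebesgue (\<lambda>x. (norm (f x))\<^sup>2)"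
  by (auto simp: L2_def)

lemma norm_add_power2_le: "(norm (a + b))\<^sup>2 \<le> 2 * (norm a)\<^sup>2 + 2 * (norm (b :: 'a :: real_normed_vector))\<^sup>2"
proof -
  have "(norm (a + b))\<^sup>2 \<le> (norm a + norm b)\<^sup>2" by (intro power_mono norm_triangle_ineq) simp
  also have "\<dots> \<le> 2 * (norm a)\<^sup>2 + 2 * (norm b)\<^sup>2"
    using sum_squares_bound[of "norm a" "norm b"] by (simp add: power2_sum)
  finally show ?thesis .
qed

lemma L2_add: assumes f: "f \<in> L2" and g: "g \<in> L2" shows "(\<lambda>x. f x + g x) \<in> L2"
proof -
  note [measurable] = L2_measurable[OF f] L2_measurable[OF g]
  have "integrable lebesgue (\<lambda>x. (norm (f x + g x))\<^sup>2)"
    by (rule Bochner_Integration.integrable_bound[of _ "\<lambda>x. 2 * (norm (f x))\<^sup>2 + 2 * (norm (g x))\<^sup>2"])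
      (use L2_integrable[OF f] L2_integrable[OF g] in \<open>auto intro!: norm_add_power2_le order_trans[OF norm_add_power2_le]\<close>)
  then show ?thesis by (simp add: L2_def)
qed

lemma L2_cmult: assumes f: "f \<in> L2" shows "(\<lambda>x. c * f x) \<in> L2"
proof -
  note [measurable] = L2_measurable[OF f]
  show ?thesis using L2_integrable[OF f] by (simp add: L2_def norm_mult power_mult_distrib)
qed

lemma L2_zero: "(\<lambda>x. 0) \<in> L2" by (simp add: L2_def)

lemma L2_diff: assumes "f \<in> L2" "g \<in> L2" shows "(\<lambda>x. f x - g x) \<in> L2"
  using L2_add[OF assms(1) L2_cmult[OF assms(2), of "-1"]] by simp

lemma L2_sum:
  assumes "finite I" "\<And>i. i \<in> I \<Longrightarrow> u i \<in> L2" shows "(\<lambda>x. \<Sum>i\<in>I. c i * u i x) \<in> L2"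
  using assms
proof (induction I rule: finite_induct)
  case empty show ?case by (simp add: L2_zero)
next
  case (insert i I)
  then have "(\<lambda>x. c i * u i x + (\<Sum>i\<in>I. c i * u i x)) \<in> L2" by (intro L2_add L2_cmult) auto
  with insert.hyps show ?case by simp
qed

lemma L2_integrable_mult:
  assumes f: "f \<in> L2" and g: "g \<in> L2" shows "integrable lebesgue (\<lambda>x. f x * cnj (g x))"
proof -
  note [measurable] = L2_measurable[OF f] L2_measurable[OF g]
  have "norm (f x * cnj (g x)) \<le> (norm (f x))\<^sup>2 + (norm (g x))\<^sup>2" for x
    using sum_squares_bound[of "norm (f x)" "norm (g x)"] mult_nonneg_nonneg[OF norm_ge_zero norm_ge_zero, of "f x" "g x"]
    unfolding norm_mult complex_mod_cnj by linarith
  then show ?thesis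
    by (intro Bochner_Integration.integrable_bound[OF Bochner_Integration.integrable_add[OF L2_integrable[OF f] L2_integrable[OF g]]]) auto
qed

text \<open>Pythagoras: the residual is orthogonal to the span of the first \<open>N\<close>
  functions, so other coefficients only add the squared norm of the difference. The finite sums will
  be the partial kernels applied to an indicator.\<close>

lemma L2_best_approx:
  fixes f :: "real^'n \<Rightarrow> complex" and u :: "nat \<Rightarrow> real^'n \<Rightarrow> complex"
  assumes f: "f \<in> L2" and u: "\<And>k. u k \<in> L2"
    and orth: "\<And>i j. L2_inner (u i) (u j) = (if i = j then 1 else 0)"
  shows "(LINT x|lebesgue. (norm (f x - (\<Sum>k<N. L2_inner f (u k) * u k x)))\<^sup>2)
       \<le> (LINT x|lebesgue. (norm (f x - (\<Sum>k<N. c k * u k x)))\<^sup>2)"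
proof -
  define a where "a k = L2_inner f (u k)" for k
  define p where "p x = f x - (\<Sum>k<N. a k * u k x)" for x
  define q where "q x = (\<Sum>k<N. (a k - c k) * u k x)" for x
  have p: "p \<in> L2" unfolding p_def by (intro L2_diff f L2_sum u) auto
  have q: "q \<in> L2" unfolding q_def by (intro L2_sum u) auto
  have pu: "(LINT x|lebesgue. p x * cnj (u i x)) = 0" if i: "i < N" for i
  proof -
    have "(LINT x|lebesgue. p x * cnj (u i x)) = (LINT x|lebesgue. f x * cnj (u i x) - (\<Sum>k<N. a k * (u k x * cnj (u i x))))"
      by (simp add: p_def left_diff_distrib sum_distrib_right mult.assoc)
    also have "\<dots> = (LINT x|lebesgue. f x * cnj (u i x)) - (LINT x|lebesgue. (\<Sum>k<N. a k * (u k x * cnj (u i x))))"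
      by (intro Bochner_Integration.integral_diff Bochner_Integration.integrable_sum integrable_mult_right L2_integrable_mult f u)
    also have "(LINT x|lebesgue. (\<Sum>k<N. a k * (u k x * cnj (u i x)))) = (\<Sum>k<N. a k * L2_inner (u k) (u i))"
      by (subst Bochner_Integration.integral_sum) (auto intro!: integrable_mult_right L2_integrable_mult u simp: L2_inner_def)
    also have "\<dots> = (\<Sum>k<N. if k = i then a k else 0)" by (intro sum.cong) (auto simp: orth)
    also have "\<dots> = a i" using i by simp
    finally show ?thesis by (simp add: a_def L2_inner_def)
  qed
  have "(LINT x|lebesgue. p x * cnj (q x)) = (LINT x|lebesgue. (\<Sum>k<N. cnj (a k - c k) * (p x * cnj (u k x))))"
    by (intro Bochner_Integration.integral_cong) (auto simp: q_def sum_distrib_left mult_ac)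
  also have "\<dots> = (\<Sum>k<N. cnj (a k - c k) * (LINT x|lebesgue. p x * cnj (u k x)))"
    by (subst Bochner_Integration.integral_sum) (auto intro!: integrable_mult_right L2_integrable_mult u p)
  also have "\<dots> = 0" by (simp add: pu)
  finally have pq: "(LINT x|lebesgue. p x * cnj (q x)) = 0" .
  have ipq: "integrable lebesgue (\<lambda>x. 2 * Re (p x * cnj (q x)))"
    by (intro integrable_mult_right integrable_Re L2_integrable_mult p q)
  have "(LINT x|lebesgue. (norm (f x - (\<Sum>k<N. c k * u k x)))\<^sup>2)
      = (LINT x|lebesgue. (norm (p x))\<^sup>2 + (norm (q x))\<^sup>2 + 2 * Re (p x * cnj (q x)))"
  proof (intro Bochner_Integration.integral_cong refl)
    fix x
    have "f x - (\<Sum>k<N. c k * u k x) = p x + q x"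
      by (simp add: p_def q_def left_diff_distrib sum_subtractf)
    then show "(norm (f x - (\<Sum>k<N. c k * u k x)))\<^sup>2 = (norm (p x))\<^sup>2 + (norm (q x))\<^sup>2 + 2 * Re (p x * cnj (q x))"
      by (simp add: cmod_power2) (simp add: power2_eq_square algebra_simps)
  qed
  also have "\<dots> = (LINT x|lebesgue. (norm (p x))\<^sup>2) + (LINT x|lebesgue. (norm (q x))\<^sup>2) + (LINT x|lebesgue. 2 * Re (p x * cnj (q x)))"
    using ipq L2_integrable[OF p] L2_integrable[OF q] by simp
  also have "(LINT x|lebesgue. 2 * Re (p x * cnj (q x))) = 2 * Re (LINT x|lebesgue. p x * cnj (q x))"
    by (simp only: integral_mult_right_zero integral_Re[OF L2_integrable_mult[OF p q]])
  also have "\<dots> = 0" by (simp only: pq) simp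
  finally have "(LINT x|lebesgue. (norm (p x))\<^sup>2) \<le> (LINT x|lebesgue. (norm (f x - (\<Sum>k<N. c k * u k x)))\<^sup>2)"
    by (simp add: integral_nonneg_AE)
  then show ?thesis by (simp add: p_def a_def)
qed

lemma L2_dilate:
  fixes f :: "real^'n \<Rightarrow> complex"
  assumes f: "f \<in> L2" and c: "c > 0"
  shows "(\<lambda>x. f (c *\<^sub>R x)) \<in> L2"
    and "(LINT x|lebesgue. (norm (f x))\<^sup>2) = c ^ CARD('n) * (LINT x|lebesgue. (norm (f (c *\<^sub>R x)))\<^sup>2)"
proof -
  note [measurable] = L2_measurable[OF f]
  \<comment> \<open>Change of variables for Lebesgue measurable functions, obtained from a diagonal
    map whose stretching factors all equal \<open>c\<close>.\<close>
  have eq: "(lebesgue :: (real^'n) measure) = density (distr lebesgue lebesgue ((*\<^sub>R) c)) (\<lambda>_. ennreal (c ^ CARD('n)))"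
  proof -
    have "lebesgue = density (distr lebesgue lebesgue (\<lambda>x::real^'n. 0 + (\<Sum>j\<in>Basis. (c * (x \<bullet> j)) *\<^sub>R j))) (\<lambda>_. ennreal (\<Prod>j\<in>(Basis :: (real^'n) set). \<bar>c\<bar>))"
      using c lebesgue_affine_euclidean[of "\<lambda>_. c" "0::real^'n"] by simp
    moreover have "(\<lambda>x::real^'n. 0 + (\<Sum>j\<in>Basis. (c * (x \<bullet> j)) *\<^sub>R j)) = (*\<^sub>R) c"
      by (auto simp: scaleR_scaleR[symmetric] scaleR_sum_right[symmetric] euclidean_representation simp del: scaleR_scaleR)
    ultimately show ?thesis using c by simp
  qed
  have m: "(\<lambda>x. f (c *\<^sub>R x)) \<in> borel_measurable lebesgue" by measurable
  have "integrable lebesgue (\<lambda>x. (norm (f x))\<^sup>2) \<longleftrightarrow> integrable lebesgue (\<lambda>x. c ^ CARD('n) * (norm (f (c *\<^sub>R x)))\<^sup>2)"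
    by (subst eq, subst integrable_density) (use c in \<open>auto simp: integrable_distr_eq\<close>)
  then have "integrable lebesgue (\<lambda>x. (norm (f (c *\<^sub>R x)))\<^sup>2)"
    using L2_integrable[OF f] c integrable_mult_right[of "inverse (c ^ CARD('n))" lebesgue "\<lambda>x. c ^ CARD('n) * (norm (f (c *\<^sub>R x)))\<^sup>2"]
    by (auto simp: mult.assoc[symmetric])
  with m show "(\<lambda>x. f (c *\<^sub>R x)) \<in> L2" by (simp add: L2_def)
  show "(LINT x|lebesgue. (norm (f x))\<^sup>2) = c ^ CARD('n) * (LINT x|lebesgue. (norm (f (c *\<^sub>R x)))\<^sup>2)"
    by (subst eq, subst integral_density) (use c in \<open>auto simp: integral_distr\<close>)
qed

lemma L2_norm_power2: "(L2_norm f)\<^sup>2 = (LINT x|lebesgue. (norm (f x))\<^sup>2)"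
  by (simp add: L2_norm_def integral_nonneg_AE)

lemma L2_norm_less_imp: "L2_norm f < d \<Longrightarrow> (LINT x|lebesgue. (norm (f x))\<^sup>2) < d\<^sup>2"
  unfolding L2_norm_power2[symmetric] by (intro power_strict_mono) (auto simp: L2_norm_def integral_nonneg_AE)

lemma
  assumes V: "multiresolution_analysis V"
  shows mra_subset_L2: "V i \<subseteq> L2"
    and mra_mono: "mono V"
    and mra_dilate_iff: "f \<in> L2 \<Longrightarrow> f \<in> V i \<longleftrightarrow> (\<lambda>x. f (2 *\<^sub>R x)) \<in> V (i + 1)"
    and mra_dense: "f \<in> L2 \<Longrightarrow> \<delta> > 0 \<Longrightarrow> \<exists>g\<in>(\<Union>i. V i). L2_norm (\<lambda>x. f x - g x) < \<delta>"
proof -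
  note V = V[unfolded multiresolution_analysis_def]
  show "V i \<subseteq> L2" using V[THEN conjunct1, THEN spec, of i] unfolding closed_L2_subspace_def by (rule conjunct1)
  show "mono V" using V by (elim conjE)
  show "f \<in> L2 \<Longrightarrow> f \<in> V i \<longleftrightarrow> (\<lambda>x. f (2 *\<^sub>R x)) \<in> V (i + 1)"
    using V[THEN conjunct2, THEN conjunct2, THEN conjunct1, THEN spec, of i] by (rule bspec)
  show "f \<in> L2 \<Longrightarrow> \<delta> > 0 \<Longrightarrow> \<exists>g\<in>(\<Union>i. V i). L2_norm (\<lambda>x. f x - g x) < \<delta>"
    using V[THEN conjunct2, THEN conjunct2, THEN conjunct2, THEN conjunct2, THEN conjunct2, THEN conjunct1] by simp
qed

text \<open>The dilation clause is read from right to left \<open>j\<close> times; each time the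
  halved function must first be known to be square integrable.\<close>

lemma multiresolution_analysis_dilate:
  fixes V :: "int \<Rightarrow> (real^'n \<Rightarrow> complex) set"
  assumes V: "multiresolution_analysis V" and f: "f \<in> V (int j)"
  shows "(\<lambda>x. f ((1/2) ^ j *\<^sub>R x)) \<in> V 0"
  using f
proof (induction j arbitrary: f)
  case 0 then show ?case by simp
next
  case (Suc j)
  have "f \<in> L2" using mra_subset_L2[OF V] Suc.prems by (rule subsetD)
  then have L: "(\<lambda>x. f ((1/2) *\<^sub>R x)) \<in> L2" by (intro L2_dilate) auto
  have "(\<lambda>x. f ((1/2) *\<^sub>R x)) \<in> V (int j) \<longleftrightarrow> (\<lambda>x. (\<lambda>x. f ((1/2) *\<^sub>R x)) (2 *\<^sub>R x)) \<in> V (int j + 1)"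
    using L by (rule mra_dilate_iff[OF V])
  moreover have "(\<lambda>x. (\<lambda>x. f ((1/2) *\<^sub>R x)) (2 *\<^sub>R x)) = f" by simp
  ultimately have "(\<lambda>x. f ((1/2) *\<^sub>R x)) \<in> V (int j)" using Suc.prems by (simp add: add.commute)
  from Suc.IH[OF this] show ?case by (simp add: mult.commute)
qed

lemma indicator_ball_L2: "(\<lambda>x::real^'n. indicator (ball 0 R) x :: complex) \<in> L2"
proof -
  have [measurable]: "ball (0::real^'n) R \<in> sets lebesgue" by simp
  have "(\<lambda>x::real^'n. (norm (indicator (ball 0 R) x :: complex))\<^sup>2) = indicator (ball 0 R)"
    by (auto simp: indicator_def)
  moreover have "integrable lebesgue (indicator (ball (0::real^'n) R) :: _ \<Rightarrow> real)"
    using emeasure_bounded_finite[of "ball (0::real^'n) R"] by (simp add: integrable_indicator_iff)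
  ultimately show ?thesis by (simp add: L2_def)
qed

text \<open>Rounding down moves each coordinate by at most 1, hence the point by at most n; the
  additional 1 makes the bound strict.\<close>

lemma int_lattice_dense: "\<exists>m\<in>int_lattice. dist m (y::real^'n) < real CARD('n) + 1"
proof -
  define m :: "real^'n" where "m = (\<chi> i. of_int \<lfloor>y $ i\<rfloor>)"
  have "norm (y - m) \<le> (\<Sum>i\<in>UNIV. \<bar>(y - m) $ i\<bar>)" by (rule norm_le_l1_cart)
  also have "\<dots> \<le> (\<Sum>i\<in>(UNIV::'n set). 1)"
  proof (rule sum_mono)
    fix i :: 'n
    show "\<bar>(y - m) $ i\<bar> \<le> 1" using floor_correct[of "y $ i"] by (simp add: m_def) linarith
  qed
  finally have "dist m y < real CARD('n) + 1" by (simp add: dist_norm norm_minus_commute)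
  moreover have "m \<in> int_lattice" by (simp add: m_def int_lattice_def)
  ultimately show ?thesis by blast
qed

section \<open>Projections of indicators of large balls\<close>

context scaling_kernel
begin

lemma \<Phi>_L2:
  assumes "\<phi> \<in> L2" shows "\<Phi> k \<in> L2"
proof -
  obtain C where C: "C > 0" "\<And>k x. norm (\<Phi> k x) \<le> C / (1 + dist x (e k)) ^ Suc CARD('n)"
    using \<Phi>_decay by blast
  have b: "norm ((norm (\<Phi> k x))\<^sup>2) \<le> norm (C * norm (\<Phi> k x))" for x
  proof -
    have "norm (\<Phi> k x) \<le> C / (1 + dist x (e k)) ^ Suc CARD('n)" by (rule C)
    also have "\<dots> \<le> C / 1" using C(1) by (intro divide_left_mono one_le_power) (auto intro!: mult_pos_pos zero_less_power add_pos_nonneg)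
    finally have "norm (\<Phi> k x) * norm (\<Phi> k x) \<le> C * norm (\<Phi> k x)" by (intro mult_right_mono) auto
    then show ?thesis using C(1) by (simp add: power2_eq_square)
  qed
  have "integrable lborel (\<lambda>x. (norm (\<Phi> k x))\<^sup>2)"
    by (rule Bochner_Integration.integrable_bound[OF integrable_mult_right[OF integrable_norm[OF integrable_\<Phi>[of k]], of C]])
      (use b in auto)
  then have "integrable lebesgue (\<lambda>x. (norm (\<Phi> k x))\<^sup>2)"
    by (subst integrable_completion) auto
  then show ?thesis by (simp add: L2_def measurable_completion)
qed

context
  fixes V :: "int \<Rightarrow> (real^'n \<Rightarrow> complex) set"
  assumes V: "multiresolution_analysis V" and sf: "scaling_function V \<phi>"
begin

lemma \<phi>_L2: "\<phi> \<in> L2"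
  using sf by (simp add: scaling_function_def)

lemma \<Phi>_orthonormal: "L2_inner (\<Phi> i) (\<Phi> j) = (if i = j then 1 else 0)"
proof -
  have "\<forall>m\<in>int_lattice. \<forall>m'\<in>int_lattice. L2_inner (\<lambda>x. \<phi> (x - m)) (\<lambda>x. \<phi> (x - m')) = (if m = m' then 1 else 0)"
    using sf by (simp add: scaling_function_def orthonormal_basis_of_def)
  moreover have "e i \<in> int_lattice" "e j \<in> int_lattice" "e i = e j \<longleftrightarrow> i = j"
    using e_bij by (auto simp: bij_betw_def inj_eq)
  ultimately show ?thesis by (simp add: \<Phi>_def[abs_def])
qed

text \<open>A finite set of lattice points is enlarged to an initial segment of the enumeration with
  zero coefficients, because partial kernels are indexed by initial segments.\<close>

lemma \<Phi>_approx:
  assumes G: "G \<in> V 0" and d: "d > 0"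
  shows "\<exists>N c. (LINT x|lebesgue. (norm (G x - (\<Sum>k<N. c k * \<Phi> k x)))\<^sup>2) < d\<^sup>2"
proof -
  have "\<forall>f\<in>V 0. \<forall>\<delta>>0. \<exists>S c. finite S \<and> S \<subseteq> int_lattice \<and> L2_norm (\<lambda>x. f x - (\<Sum>i\<in>S. c i * \<phi> (x - i))) < \<delta>"
    using sf by (simp add: scaling_function_def orthonormal_basis_of_def)
  from this[THEN bspec, OF G, THEN spec, THEN mp, OF d]
  obtain T c where T: "finite T" "T \<subseteq> int_lattice" and c: "L2_norm (\<lambda>x. G x - (\<Sum>i\<in>T. c i * \<phi> (x - i))) < d"
    by blast
  have inj: "inj e" and range: "range e = int_lattice" using e_bij by (auto simp: bij_betw_def)
  define I where "I = e -` T"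
  have "finite I" unfolding I_def using T(1) inj by (rule finite_vimageI)
  then obtain N where N: "I \<subseteq> {..<N}" using finite_nat_iff_bounded by blast
  have TI: "T = e ` I" using T(2) range by (auto simp: I_def)
  have "(\<Sum>i\<in>T. c i * \<phi> (x - i)) = (\<Sum>k<N. (if k \<in> I then c (e k) else 0) * \<Phi> k x)" for x
  proof -
    have "(\<Sum>i\<in>T. c i * \<phi> (x - i)) = (\<Sum>k\<in>I. c (e k) * \<Phi> k x)"
      unfolding TI using inj by (subst sum.reindex) (auto intro: inj_on_subset simp: \<Phi>_def)
    also have "\<dots> = (\<Sum>k<N. (if k \<in> I then c (e k) else 0) * \<Phi> k x)"
      using N by (intro sum.mono_neutral_cong_left) auto
    finally show ?thesis .
  qed
  with L2_norm_less_imp[OF c] show ?thesis by auto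
qed

text \<open>Dilating by \<open>2\<^sup>j\<close> turns approximation of a fixed indicator from \<open>V\<^sub>j\<close> into approximation of the
  indicator of a large ball from \<open>V\<^sub>0\<close>, so that only the kernel \<open>q\<^sub>0\<close> is needed.\<close>

lemma large_ball_approx:
  assumes d: "d > 0"
  shows "\<exists>J. \<forall>j\<ge>J. \<exists>N c. (LINT x|lebesgue. (norm (indicator (ball 0 (2 ^ j)) x - (\<Sum>k<N. c k * \<Phi> k x)))\<^sup>2) \<le> d * (2 ^ j) ^ CARD('n)"
proof -
  \<comment> \<open>Each of the two approximations then has squared error at most d / 4 times the
    volume factor; \<open>norm_add_power2_le\<close> doubles both, and the total is
    \<open>d\<close>.\<close>
  define s where "s = sqrt (d / 4)"
  have s: "s > 0" "s\<^sup>2 = d / 4" using d by (auto simp: s_def)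
  obtain h i where h: "h \<in> V i" "L2_norm (\<lambda>x. indicator (ball 0 1) x - h x) < s"
    using mra_dense[OF V indicator_ball_L2 s(1), of 1] by blast
  have "\<exists>N c. (LINT x|lebesgue. (norm (indicator (ball 0 (2 ^ j)) x - (\<Sum>k<N. c k * \<Phi> k x)))\<^sup>2) \<le> d * (2 ^ j) ^ CARD('n)"
    if j: "j \<ge> nat i" for j :: nat
  proof -
    have "i \<le> int j" using j by simp
    then have hj: "h \<in> V (int j)" using mra_mono[OF V] h(1) by (auto dest: monoD)
    define G where "G x = h ((1/2) ^ j *\<^sub>R x)" for x
    have G: "G \<in> V 0" unfolding G_def using multiresolution_analysis_dilate[OF V hj] .
    obtain N c where c: "(LINT x|lebesgue. (norm (G x - (\<Sum>k<N. c k * \<Phi> k x)))\<^sup>2) < s\<^sup>2"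
      using \<Phi>_approx[OF G s(1)] by blast
    let ?X = "\<lambda>x::real^'n. indicator (ball 0 (2 ^ j)) x :: complex"
    have hL: "h \<in> L2" using mra_subset_L2[OF V] hj by blast
    have GL: "G \<in> L2" using mra_subset_L2[OF V] G by blast
    have dL: "(\<lambda>x. indicator (ball 0 1) x - h x) \<in> L2" by (intro L2_diff indicator_ball_L2 hL)
    have X: "indicator (ball 0 1) ((1/2) ^ j *\<^sub>R x) = ?X x" for x :: "real^'n"
      by (simp add: indicator_def power_one_over divide_less_eq)
    \<comment> \<open>Dilation multiplies the squared error by 2^(j n), exactly the growth allowed
      on the right-hand side.\<close>
    have "(LINT x|lebesgue. (norm (indicator (ball 0 1) x - h x))\<^sup>2)
        = ((1/2) ^ j) ^ CARD('n) * (LINT x|lebesgue. (norm (?X x - G x))\<^sup>2)"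
      using L2_dilate(2)[OF dL, of "(1/2) ^ j"] by (simp add: X G_def)
    then have "((1/2) ^ j) ^ CARD('n) * (LINT x|lebesgue. (norm (?X x - G x))\<^sup>2) < d / 4"
      using L2_norm_less_imp[OF h(2)] s(2) by simp
    then have "(2 ^ j) ^ CARD('n) * (((1/2) ^ j) ^ CARD('n) * (LINT x|lebesgue. (norm (?X x - G x))\<^sup>2)) \<le> (2 ^ j) ^ CARD('n) * (d / 4)"
      by (intro mult_left_mono) auto
    moreover have "(2 ^ j) ^ CARD('n) * (((1/2) ^ j) ^ CARD('n) * z) = z" for z :: real
      by (simp add: mult.assoc[symmetric] power_mult_distrib[symmetric])
    ultimately have 1: "(LINT x|lebesgue. (norm (?X x - G x))\<^sup>2) \<le> (2 ^ j) ^ CARD('n) * (d / 4)" by simp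
    have "s\<^sup>2 \<le> (2 ^ j) ^ CARD('n) * (d / 4)"
      using mult_right_mono[of 1 "(2 ^ j) ^ CARD('n)" "d / 4"] d by (simp add: s one_le_power)
    then have 2: "(LINT x|lebesgue. (norm (G x - (\<Sum>k<N. c k * \<Phi> k x)))\<^sup>2) \<le> (2 ^ j) ^ CARD('n) * (d / 4)"
      using c by linarith
    have sL: "(\<lambda>x. \<Sum>k<N. c k * \<Phi> k x) \<in> L2" by (intro L2_sum \<Phi>_L2 \<phi>_L2) auto
    note i1 = L2_integrable[OF L2_diff[OF indicator_ball_L2[of "2 ^ j"] GL]]
    note i2 = L2_integrable[OF L2_diff[OF GL sL]]
    note i3 = L2_integrable[OF L2_diff[OF indicator_ball_L2[of "2 ^ j"] sL]]
    have "(LINT x|lebesgue. (norm (?X x - (\<Sum>k<N. c k * \<Phi> k x)))\<^sup>2)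
        \<le> (LINT x|lebesgue. 2 * (norm (?X x - G x))\<^sup>2 + 2 * (norm (G x - (\<Sum>k<N. c k * \<Phi> k x)))\<^sup>2)"
    proof (intro integral_mono i3 Bochner_Integration.integrable_add integrable_mult_right i1 i2)
      fix x
      show "(norm (?X x - (\<Sum>k<N. c k * \<Phi> k x)))\<^sup>2 \<le> 2 * (norm (?X x - G x))\<^sup>2 + 2 * (norm (G x - (\<Sum>k<N. c k * \<Phi> k x)))\<^sup>2"
        using norm_add_power2_le[of "?X x - G x" "G x - (\<Sum>k<N. c k * \<Phi> k x)"] by simp
    qed
    also have "\<dots> = 2 * (LINT x|lebesgue. (norm (?X x - G x))\<^sup>2) + 2 * (LINT x|lebesgue. (norm (G x - (\<Sum>k<N. c k * \<Phi> k x)))\<^sup>2)"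
      using i1 i2 by simp
    also have "\<dots> \<le> d * (2 ^ j) ^ CARD('n)" using 1 2 by (simp add: mult.commute)
    finally show ?thesis by blast
  qed
  then show ?thesis by blast
qed

text \<open>The orthogonal projection of the indicator onto \<open>V 0\<close>, given pointwise
  through the kernel.\<close>

definition ball_projection :: "real \<Rightarrow> real^'n \<Rightarrow> complex" where
  "ball_projection R x = (LINT y|lborel. q0_kernel \<phi> x y * indicator (ball 0 R) y)"

lemma partial_projection:
  "(LINT y|lborel. partial_kernel N x y * indicator (ball 0 R) y) = (\<Sum>k<N. L2_inner (indicator (ball 0 R)) (\<Phi> k) * \<Phi> k x)"
proof -
  have [measurable]: "ball (0::real^'n) R \<in> sets borel" by simp
  have i: "integrable lborel (\<lambda>y. indicator (ball 0 R) y * cnj (\<Phi> k y))" for k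
    by (rule Bochner_Integration.integrable_bound[OF integrable_\<Phi>[of k]]) (auto simp: indicator_def)
  have "(LINT y|lborel. partial_kernel N x y * indicator (ball 0 R) y) = (LINT y|lborel. (\<Sum>k<N. (indicator (ball 0 R) y * cnj (\<Phi> k y)) * \<Phi> k x))"
    unfolding partial_kernel_def sum_distrib_right by (intro Bochner_Integration.integral_cong sum.cong refl) (simp only: mult_ac)
  also have "\<dots> = (\<Sum>k<N. (LINT y|lborel. indicator (ball 0 R) y * cnj (\<Phi> k y)) * \<Phi> k x)"
    by (subst Bochner_Integration.integral_sum) (use i in auto)
  also have "\<dots> = (\<Sum>k<N. L2_inner (indicator (ball 0 R)) (\<Phi> k) * \<Phi> k x)"
  proof -
    have "L2_inner (indicator (ball 0 R)) (\<Phi> k) = (LINT y|lborel. indicator (ball 0 R) y * cnj (\<Phi> k y))" for k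
      unfolding L2_inner_def by (rule integral_completion) measurable
    then show ?thesis by (simp only:)
  qed
  finally show ?thesis .
qed

text \<open>Partial projections are best approximations, so from some \<open>N\<close> on they do as
  well as the approximants of \<open>large_ball_approx\<close>. Fatou's lemma carries the bound to
  their pointwise limit, without convergence in norm.\<close>

lemma projection_large_ball:
  assumes d: "d > 0"
  shows "\<exists>J. \<forall>j\<ge>J. (\<integral>\<^sup>+x. ennreal ((norm (indicator (ball 0 (2 ^ j)) x - ball_projection (2 ^ j) x))\<^sup>2) \<partial>lborel) \<le> ennreal (d * (2 ^ j) ^ CARD('n))"
proof -
  obtain J where J: "\<And>j. j \<ge> J \<Longrightarrow> \<exists>N c. (LINT x|lebesgue. (norm (indicator (ball 0 (2 ^ j)) x - (\<Sum>k<N. c k * \<Phi> k x)))\<^sup>2) \<le> d * (2 ^ j) ^ CARD('n)"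
    using large_ball_approx[OF d] by blast
  have "(\<integral>\<^sup>+x. ennreal ((norm (indicator (ball 0 (2 ^ j)) x - ball_projection (2 ^ j) x))\<^sup>2) \<partial>lborel) \<le> ennreal (d * (2 ^ j) ^ CARD('n))"
    if j: "j \<ge> J" for j
  proof -
    define X where "X = (\<lambda>x::real^'n. indicator (ball 0 (2 ^ j)) x :: complex)"
    have [measurable]: "ball (0::real^'n) (2 ^ j) \<in> sets borel" by simp
    have Xm[measurable]: "X \<in> borel_measurable borel" unfolding X_def by measurable
    have XL: "X \<in> L2" unfolding X_def by (rule indicator_ball_L2)
    obtain N0 c where c: "(LINT x|lebesgue. (norm (X x - (\<Sum>k<N0. c k * \<Phi> k x)))\<^sup>2) \<le> d * (2 ^ j) ^ CARD('n)"
      using J[OF j] unfolding X_def by blast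
    define T where "T N x = (\<Sum>k<N. L2_inner X (\<Phi> k) * \<Phi> k x)" for N x
    have Tm[measurable]: "T N \<in> borel_measurable borel" for N unfolding T_def by measurable
    have TL: "T N \<in> L2" for N unfolding T_def by (intro L2_sum \<Phi>_L2 \<phi>_L2) auto
    have "T N x = (LINT y|lborel. partial_kernel N x y * X y)" for N x
      unfolding T_def X_def by (rule partial_projection[symmetric])
    then have T_lim: "(\<lambda>N. T N x) \<longlonglongrightarrow> ball_projection (2 ^ j) x" for x
      using integral_partial_kernel_tendsto(3)[OF Xm, of x] by (simp add: ball_projection_def X_def indicator_def)
    have le: "(\<integral>\<^sup>+x. ennreal ((norm (X x - T N x))\<^sup>2) \<partial>lborel) \<le> ennreal (d * (2 ^ j) ^ CARD('n))" if N: "N \<ge> N0" for N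
    proof -
      \<comment> \<open>Padding with zeros turns an approximant of length \<open>N0\<close> into a
        competitor of length \<open>N\<close>.\<close>
      define c' where "c' k = (if k < N0 then c k else 0)" for k
      have "(\<Sum>k<N. c' k * \<Phi> k x) = (\<Sum>k<N0. c k * \<Phi> k x)" for x
        using N by (intro sum.mono_neutral_cong_right) (auto simp: c'_def)
      then have "(LINT x|lebesgue. (norm (X x - T N x))\<^sup>2) \<le> d * (2 ^ j) ^ CARD('n)"
        using L2_best_approx[OF XL \<Phi>_L2[OF \<phi>_L2] \<Phi>_orthonormal, of N c'] c unfolding T_def by simp
      moreover have int: "integrable lebesgue (\<lambda>x. (norm (X x - T N x))\<^sup>2)"
        by (intro L2_integrable L2_diff XL TL)
      then have int': "integrable lborel (\<lambda>x. (norm (X x - T N x))\<^sup>2)"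
        by (subst (asm) integrable_completion) auto
      have "(LINT x|lebesgue. (norm (X x - T N x))\<^sup>2) = (LINT x|lborel. (norm (X x - T N x))\<^sup>2)"
        by (rule integral_completion) measurable
      moreover have "(\<integral>\<^sup>+x. ennreal ((norm (X x - T N x))\<^sup>2) \<partial>lborel) = ennreal (LINT x|lborel. (norm (X x - T N x))\<^sup>2)"
        by (rule nn_integral_eq_integral[OF int']) simp
      ultimately show ?thesis by (simp add: ennreal_leI)
    qed
    have "ennreal ((norm (X x - ball_projection (2 ^ j) x))\<^sup>2) = liminf (\<lambda>N. ennreal ((norm (X x - T N x))\<^sup>2))" for x
      by (rule lim_imp_Liminf[symmetric])
        (intro trivial_limit_sequentially tendsto_ennrealI tendsto_power tendsto_norm tendsto_diff tendsto_const T_lim)+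
    then have "(\<integral>\<^sup>+x. ennreal ((norm (X x - ball_projection (2 ^ j) x))\<^sup>2) \<partial>lborel) = (\<integral>\<^sup>+x. liminf (\<lambda>N. ennreal ((norm (X x - T N x))\<^sup>2)) \<partial>lborel)"
      by simp
    also have "\<dots> \<le> liminf (\<lambda>N. \<integral>\<^sup>+x. ennreal ((norm (X x - T N x))\<^sup>2) \<partial>lborel)"
      by (rule nn_integral_liminf) measurable
    also have "\<dots> \<le> ennreal (d * (2 ^ j) ^ CARD('n))"
      using le by (intro Liminf_le) (auto simp: eventually_sequentially)
    finally show ?thesis by (simp add: X_def)
  qed
  then show ?thesis by blast
qed

end

end

section \<open>The kernel integrates to one\<close>

context scaling_kernel
begin

context
  fixes V :: "int \<Rightarrow> (real^'n \<Rightarrow> complex) set"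
  assumes V: "multiresolution_analysis V" and sf: "scaling_function V \<phi>"
begin

text \<open>The difference is an integral over the complement of the ball. With \<open>x\<close> in
  the ball of half the radius, \<open>y\<close> stays at distance at least R / 2, so decay of order
  n + 2 leaves an integrable function times 2 C / R.\<close>

lemma ball_projection_near_kernel_integral:
  assumes \<eta>: "\<eta> > 0"
  shows "\<exists>R0. \<forall>R\<ge>R0. \<forall>x. norm x \<le> R / 2 \<longrightarrow> norm (ball_projection R x - kernel_integral x) \<le> \<eta>"
proof -
  obtain C where C: "C \<ge> 0" "\<And>x y. norm (q0_kernel \<phi> x y) \<le> C / (1 + dist x y) ^ Suc (Suc CARD('n))"
    using q0_kernel_decay by blast
  define I where "I = 2 ^ (CARD('n) + 2) * unit_ball_vol (real CARD('n)) * 1 ^ CARD('n)"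
  have I: "I \<ge> 0" by (simp add: I_def)
  have "norm (ball_projection R x - kernel_integral x) \<le> \<eta>" if R: "R \<ge> 2 * C * I / \<eta> + 1" and x: "norm x \<le> R / 2" for R x
  proof -
    have "2 * C * I / \<eta> \<ge> 0" using C(1) I \<eta> by simp
    then have R0: "R > 0" using R by linarith
    have [measurable]: "ball (0::real^'n) R \<in> sets borel" by simp
    have i: "integrable lborel (\<lambda>y. q0_kernel \<phi> x y * indicator (ball 0 R) y)" "integrable lborel (\<lambda>y. q0_kernel \<phi> x y * 1)"
      by (rule integral_partial_kernel_tendsto; simp add: indicator_def)+
    have "ball_projection R x - kernel_integral x = (LINT y|lborel. q0_kernel \<phi> x y * indicator (ball 0 R) y - q0_kernel \<phi> x y * 1)"
      unfolding Bochner_Integration.integral_diff[OF i] by (simp add: ball_projection_def[OF V sf] kernel_integral_def)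
    then have "ennreal (norm (ball_projection R x - kernel_integral x)) \<le> (\<integral>\<^sup>+y. ennreal (norm (q0_kernel \<phi> x y * indicator (ball 0 R) y - q0_kernel \<phi> x y * 1)) \<partial>lborel)"
      using i by (simp only:) (intro integral_norm_bound_ennreal Bochner_Integration.integrable_diff)
    also have "\<dots> \<le> (\<integral>\<^sup>+y. ennreal (2 * C / R) * ennreal (1 / (1 + dist x y / 1) ^ Suc CARD('n)) \<partial>lborel)"
    proof (rule nn_integral_mono)
      fix y
      show "ennreal (norm (q0_kernel \<phi> x y * indicator (ball 0 R) y - q0_kernel \<phi> x y * 1)) \<le> ennreal (2 * C / R) * ennreal (1 / (1 + dist x y / 1) ^ Suc CARD('n))"
      proof (cases "y \<in> ball 0 R")
        case True then show ?thesis by simp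
      next
        case False
        have "norm y \<le> norm x + dist x y" by (metis dist_commute dist_norm norm_triangle_sub)
        then have d: "R / 2 \<le> 1 + dist x y" using False x by simp
        have p: "(1 + dist x y) ^ Suc CARD('n) > 0" by (intro zero_less_power) (simp add: add_pos_nonneg)
        have "norm (q0_kernel \<phi> x y) \<le> C / ((1 + dist x y) * (1 + dist x y) ^ Suc CARD('n))" using C(2)[of x y] by (simp only: power_Suc)
        also have "\<dots> \<le> C / (R / 2 * (1 + dist x y) ^ Suc CARD('n))"
          using C(1) d p R0 by (intro divide_left_mono mult_right_mono mult_pos_pos) (auto simp: add_pos_nonneg simp del: power_Suc)
        also have "\<dots> = 2 * C / R * (1 / (1 + dist x y / 1) ^ Suc CARD('n))" by (simp del: power_Suc)
        finally have "norm (q0_kernel \<phi> x y) \<le> 2 * C / R * (1 / (1 + dist x y / 1) ^ Suc CARD('n))" .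
        then have "ennreal (norm (q0_kernel \<phi> x y)) \<le> ennreal (2 * C / R * (1 / (1 + dist x y / 1) ^ Suc CARD('n)))" by (rule ennreal_leI)
        also have "\<dots> = ennreal (2 * C / R) * ennreal (1 / (1 + dist x y / 1) ^ Suc CARD('n))"
          using C(1) R0 by (intro ennreal_mult') auto
        finally show ?thesis using False by simp
      qed
    qed
    also have "\<dots> = ennreal (2 * C / R) * (\<integral>\<^sup>+y. ennreal (1 / (1 + dist x y / 1) ^ Suc CARD('n)) \<partial>lborel)"
      by (rule nn_integral_cmult) measurable
    also have "\<dots> \<le> ennreal (2 * C / R) * ennreal I"
      unfolding I_def by (intro mult_left_mono nn_integral_decay_le) (auto simp: emeasure_cball)
    also have "\<dots> = ennreal (2 * C / R * I)" using I by (intro ennreal_mult''[symmetric])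
    finally have "norm (ball_projection R x - kernel_integral x) \<le> 2 * C / R * I"
      using C(1) I R0 by (subst (asm) ennreal_le_iff) auto
    also have "\<dots> \<le> \<eta>"
    proof -
      have "2 * C * I / \<eta> \<le> R" using R by linarith
      then have "2 * C * I \<le> R * \<eta>" using \<eta> by (simp add: divide_le_eq)
      then show ?thesis using R0 by (simp add: divide_le_eq mult.commute)
    qed
    finally show ?thesis .
  qed
  then show ?thesis by blast
qed

text \<open>On the ball of half the radius the indicator is 1 and the truncated integral differs
  from the full one by at most \<eta>, so the mean-square bound for the projection passes to
  \<open>kernel_integral\<close>.\<close>

lemma kernel_integral_near_1:
  assumes d: "d > 0"
  shows "\<exists>J. \<forall>j\<ge>J. (\<integral>\<^sup>+x\<in>ball 0 (2 ^ j / 2). ennreal ((norm (1 - kernel_integral x))\<^sup>2) \<partial>lborel) \<le> ennreal (d * (2 ^ j) ^ CARD('n))"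
proof -
  define v where "v = unit_ball_vol (real CARD('n))"
  have v: "v > 0" by (simp add: v_def)
  \<comment> \<open>The uniform error contributes at most 2 \<eta>^2 v R^n = (d / 2) R^n, and the
    projection error another (d / 2) R^n.\<close>
  define \<eta> where "\<eta> = sqrt (d / (4 * v))"
  have \<eta>: "\<eta> > 0" "2 * \<eta>\<^sup>2 * v = d / 2" using d v by (auto simp: \<eta>_def)
  have "d / 4 > 0" using d by simp
  from projection_large_ball[OF V sf this] obtain J1 where
    J1: "\<And>j. j \<ge> J1 \<Longrightarrow> (\<integral>\<^sup>+x. ennreal ((norm (indicator (ball 0 (2 ^ j)) x - ball_projection (2 ^ j) x))\<^sup>2) \<partial>lborel) \<le> ennreal (d / 4 * (2 ^ j) ^ CARD('n))"
    by blast
  obtain R0 where R0: "\<And>R x. R \<ge> R0 \<Longrightarrow> norm x \<le> R / 2 \<Longrightarrow> norm (ball_projection R x - kernel_integral x) \<le> \<eta>"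
    using ball_projection_near_kernel_integral[OF \<eta>(1)] by blast
  obtain J2 where J2: "R0 < 2 ^ J2" using real_arch_pow[of 2 R0] by auto
  have gm[measurable]: "kernel_integral \<in> borel_measurable borel"
    using kernel_integral_continuous by (intro borel_measurable_continuous_onI continuous_at_imp_continuous_on) auto
  have "(\<integral>\<^sup>+x\<in>ball 0 (2 ^ j / 2). ennreal ((norm (1 - kernel_integral x))\<^sup>2) \<partial>lborel) \<le> ennreal (d * (2 ^ j) ^ CARD('n))"
    if j: "j \<ge> max J1 J2" for j
  proof -
    define R :: real where "R = 2 ^ j"
    have R: "R > 0" by (simp add: R_def)
    have "(2::real) ^ J2 \<le> 2 ^ j" using j by (intro power_increasing) auto
    then have RR0: "R \<ge> R0" using J2 unfolding R_def by linarith
    have [measurable]: "ball (0::real^'n) r \<in> sets borel" for r by simp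
    let ?h = "\<lambda>x. ennreal ((norm (indicator (ball 0 R) x - ball_projection R x))\<^sup>2)"
    have Pm[measurable]: "ball_projection R \<in> borel_measurable borel"
    proof (rule borel_measurable_LIMSEQ_metric)
      show "(\<lambda>N. LINT y|lborel. partial_kernel N x y * indicator (ball 0 R) y) \<longlonglongrightarrow> ball_projection R x" for x
        unfolding ball_projection_def[OF V sf] by (rule integral_partial_kernel_tendsto(3)) (auto simp: indicator_def)
      show "(\<lambda>x. LINT y|lborel. partial_kernel N x y * indicator (ball 0 R) y) \<in> borel_measurable borel" for N
        unfolding partial_projection[OF V sf] by measurable
    qed
    have "(\<integral>\<^sup>+x\<in>ball 0 (R / 2). ennreal ((norm (1 - kernel_integral x))\<^sup>2) \<partial>lborel)
        \<le> (\<integral>\<^sup>+x. ennreal 2 * ?h x + ennreal (2 * \<eta>\<^sup>2) * indicator (ball 0 (R / 2)) x \<partial>lborel)"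
    proof (rule nn_integral_mono)
      fix x
      show "ennreal ((norm (1 - kernel_integral x))\<^sup>2) * indicator (ball 0 (R / 2)) x \<le> ennreal 2 * ?h x + ennreal (2 * \<eta>\<^sup>2) * indicator (ball 0 (R / 2)) x"
      proof (cases "x \<in> ball 0 (R / 2)")
        case True
        then have x: "norm x \<le> R / 2" "x \<in> ball 0 R" using R by auto
        have "(norm (ball_projection R x - kernel_integral x))\<^sup>2 \<le> \<eta>\<^sup>2" using R0[OF RR0 x(1)] by (intro power_mono) auto
        then have "(norm (1 - kernel_integral x))\<^sup>2 \<le> 2 * (norm (1 - ball_projection R x))\<^sup>2 + 2 * \<eta>\<^sup>2"
          using norm_add_power2_le[of "1 - ball_projection R x" "ball_projection R x - kernel_integral x"] by simp
        then have "ennreal ((norm (1 - kernel_integral x))\<^sup>2) \<le> ennreal (2 * (norm (1 - ball_projection R x))\<^sup>2 + 2 * \<eta>\<^sup>2)" by (rule ennreal_leI)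
        also have "\<dots> = ennreal 2 * ennreal ((norm (1 - ball_projection R x))\<^sup>2) + ennreal (2 * \<eta>\<^sup>2)"
          by (subst ennreal_plus) (auto simp: ennreal_mult)
        finally show ?thesis using True x(2) by simp
      qed simp
    qed
    also have "\<dots> = ennreal 2 * (\<integral>\<^sup>+x. ?h x \<partial>lborel) + ennreal (2 * \<eta>\<^sup>2) * emeasure lborel (ball (0::real^'n) (R / 2))"
      by (subst nn_integral_add) (auto simp: nn_integral_cmult nn_integral_cmult_indicator)
    also have "\<dots> \<le> ennreal 2 * ennreal (d / 4 * R ^ CARD('n)) + ennreal (2 * \<eta>\<^sup>2) * ennreal (v * R ^ CARD('n))"
    proof (intro add_mono mult_left_mono)
      show "(\<integral>\<^sup>+x. ?h x \<partial>lborel) \<le> ennreal (d / 4 * R ^ CARD('n))" using J1[of j] j by (simp add: R_def)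
      have "emeasure lborel (ball (0::real^'n) (R / 2)) = ennreal (v * (R / 2) ^ CARD('n))"
        using emeasure_ball[of "R / 2" "0::real^'n"] R by (simp add: v_def)
      also have "\<dots> \<le> ennreal (v * R ^ CARD('n))" using v R by (intro ennreal_leI mult_left_mono power_mono) auto
      finally show "emeasure lborel (ball (0::real^'n) (R / 2)) \<le> ennreal (v * R ^ CARD('n))" .
    qed auto
    also have "\<dots> = ennreal (2 * (d / 4 * R ^ CARD('n)) + 2 * \<eta>\<^sup>2 * (v * R ^ CARD('n)))"
    proof -
      have "ennreal 2 * ennreal (d / 4 * R ^ CARD('n)) = ennreal (2 * (d / 4 * R ^ CARD('n)))"
        using d R by (intro ennreal_mult[symmetric]) auto
      moreover have "ennreal (2 * \<eta>\<^sup>2) * ennreal (v * R ^ CARD('n)) = ennreal (2 * \<eta>\<^sup>2 * (v * R ^ CARD('n)))"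
        using v R by (intro ennreal_mult[symmetric]) auto
      moreover have "0 \<le> 2 * (d / 4 * R ^ CARD('n))" "0 \<le> 2 * \<eta>\<^sup>2 * (v * R ^ CARD('n))"
        using d v R by simp_all
      ultimately show ?thesis by (simp only: ennreal_plus)
    qed
    also have "2 * (d / 4 * R ^ CARD('n)) + 2 * \<eta>\<^sup>2 * (v * R ^ CARD('n)) = d * R ^ CARD('n)"
    proof -
      have "2 * \<eta>\<^sup>2 * (v * R ^ CARD('n)) = (2 * \<eta>\<^sup>2 * v) * R ^ CARD('n)" by (simp only: mult.assoc)
      also have "\<dots> = d / 2 * R ^ CARD('n)" by (simp only: \<eta>(2))
      finally have eq: "2 * \<eta>\<^sup>2 * (v * R ^ CARD('n)) = d / 2 * R ^ CARD('n)" .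
      show ?thesis unfolding eq by simp
    qed
    finally show ?thesis by (simp add: R_def)
  qed
  then show ?thesis by blast
qed

text \<open>Volume comparison: balls of radius n + 1 about lattice points cover the ball of radius R
  / 8. Those meeting it have centres of norm at most R / 8 + n + 1, hence at most R / 4.\<close>

lemma lattice_points_in_ball:
  assumes R: "R \<ge> 8 * (real CARD('n) + 1)"
  shows "\<exists>F. finite F \<and> F \<subseteq> int_lattice \<and> (\<forall>m\<in>F. norm (m::real^'n) \<le> R / 4) \<and> (R / (8 * (real CARD('n) + 1))) ^ CARD('n) \<le> real (card F)"
proof -
  let ?n = "real CARD('n)"
  have cov0: "cball (0::real^'n) (R / 8) \<subseteq> (\<Union>m\<in>int_lattice. ball m (?n + 1))" using int_lattice_dense by fastforce
  obtain F' where F': "F' \<subseteq> int_lattice" "finite F'" "cball (0::real^'n) (R / 8) \<subseteq> (\<Union>m\<in>F'. ball m (?n + 1))"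
    by (rule compactE_image[OF compact_cball _ cov0]) auto
  define F where "F = {m\<in>F'. norm m \<le> R / 4}"
  have F: "finite F" using F' by (simp add: F_def)
  define v where "v = unit_ball_vol ?n"
  have v: "v > 0" by (simp add: v_def)
  have cov: "cball (0::real^'n) (R / 8) \<subseteq> (\<Union>m\<in>F. cball m (?n + 1))"
  proof
    fix y :: "real^'n" assume y: "y \<in> cball 0 (R / 8)"
    then obtain m where m: "m \<in> F'" "dist m y < ?n + 1" using F'(3) by auto
    have "norm m \<le> norm y + dist m y" by (metis dist_norm norm_triangle_sub)
    then have "norm m \<le> R / 4" using y m(2) R by simp
    then show "y \<in> (\<Union>m\<in>F. cball m (?n + 1))" using m by (auto simp: F_def)
  qed
  have "v * (R / 8) ^ CARD('n) = measure lebesgue (cball (0::real^'n) (R / 8))"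
    using R by (subst measure_lebesgue_cball) (auto simp: v_def)
  also have "\<dots> \<le> measure lebesgue (\<Union>m\<in>F. cball m (?n + 1))"
    using cov F by (intro measure_mono_fmeasurable) auto
  also have "\<dots> \<le> (\<Sum>m\<in>F. measure lebesgue (cball m (?n + 1)))" using F by (intro measure_UNION_le) auto
  also have "\<dots> = (\<Sum>m\<in>F. v * (?n + 1) ^ CARD('n))"
    by (intro sum.cong refl, subst measure_lebesgue_cball) (auto simp: v_def)
  finally have "v * (R / 8) ^ CARD('n) \<le> v * (real (card F) * (?n + 1) ^ CARD('n))" by (simp add: mult_ac)
  then have le: "(R / 8) ^ CARD('n) \<le> real (card F) * (?n + 1) ^ CARD('n)" using v by (simp only: mult_le_cancel_left_pos)
  have "(R / (8 * (?n + 1))) ^ CARD('n) = (R / 8) ^ CARD('n) / (?n + 1) ^ CARD('n)"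
    by (simp add: power_divide[symmetric])
  also have "\<dots> \<le> real (card F)" using le by (subst pos_divide_le_eq) (auto intro!: zero_less_power add_nonneg_pos)
  finally show ?thesis using F F'(1) by (intro exI[of _ F]) (auto simp: F_def)
qed

text \<open>A deviation of the periodic function \<open>kernel_integral\<close> from \<open>1\<close> would recur at a positive proportion of the
  lattice points and contradict the preceding bound.\<close>

lemma kernel_integral_eq_1: "kernel_integral x0 = 1"
proof (rule ccontr)
  assume ne: "kernel_integral x0 \<noteq> 1"
  define c where "c = norm (1 - kernel_integral x0) / 2"
  have c: "c > 0" using ne by (simp add: c_def)
  obtain r where r: "r > 0" "\<And>y. dist y x0 < r \<Longrightarrow> dist (kernel_integral y) (kernel_integral x0) < c"
    using kernel_integral_continuous[of x0] c unfolding continuous_at_eps_delta by blast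
  \<comment> \<open>At most 1/2, so that the balls about distinct points x0 + m are disjoint; at
    most \<open>r\<close>, so that the deviation persists on them.\<close>
  define \<rho> where "\<rho> = min r (1/2)"
  have \<rho>: "\<rho> > 0" "\<rho> \<le> 1/2" "\<rho> \<le> r" using r by (auto simp: \<rho>_def)
  have far: "norm (1 - kernel_integral y) \<ge> c" if "dist y x0 < \<rho>" for y
  proof -
    have "dist (kernel_integral y) (kernel_integral x0) < c" using that \<rho>(3) by (intro r(2)) simp
    then show ?thesis
      using norm_triangle_ineq[of "1 - kernel_integral y" "kernel_integral y - kernel_integral x0"] by (simp add: dist_norm c_def field_simps)
  qed
  let ?n = "real CARD('n)"
  define v where "v = unit_ball_vol ?n"
  have v: "v > 0" by (simp add: v_def)
  define w where "w = v * \<rho> ^ CARD('n)"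
  have w: "w > 0" using v \<rho> by (simp add: w_def)
  \<comment> \<open>Each ball contributes at least c^2 w and there are at least (R / (8 (n + 1)))^n
    of them, so the integral is at least \<kappa> R^n; the upper bound is then requested with
    \<kappa> / 2.\<close>
  define \<kappa> where "\<kappa> = c\<^sup>2 * w * (1 / (8 * (?n + 1))) ^ CARD('n)"
  have \<kappa>: "\<kappa> > 0" using c w by (auto simp: \<kappa>_def intro!: mult_pos_pos zero_less_power divide_pos_pos add_nonneg_pos)
  have "\<kappa> / 2 > 0" using \<kappa> by simp
  from kernel_integral_near_1[OF this] obtain J where J: "\<And>j. j \<ge> J \<Longrightarrow>
     (\<integral>\<^sup>+x\<in>ball 0 (2 ^ j / 2). ennreal ((norm (1 - kernel_integral x))\<^sup>2) \<partial>lborel) \<le> ennreal (\<kappa> / 2 * (2 ^ j) ^ CARD('n))" by blast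
  \<comment> \<open>\<open>R\<close> must be large enough to count lattice points and to keep the
    balls about x0 + m, with the norm of m at most R / 4, inside the ball of radius R / 2.\<close>
  obtain j0 where j0: "8 * (?n + 1) + 4 * (norm x0 + 1) < 2 ^ j0" using real_arch_pow[of 2] by auto
  define j where "j = max J j0"
  define R :: real where "R = 2 ^ j"
  have "(2::real) ^ j0 \<le> R" unfolding R_def j_def by (intro power_increasing) auto
  then have Rb: "8 * (?n + 1) + 4 * (norm x0 + 1) < R" using j0 by linarith
  have "8 * (?n + 1) \<ge> 0" "4 * (norm x0 + 1) > 0" by (auto intro!: mult_pos_pos add_nonneg_pos)
  then have R: "R \<ge> 8 * (?n + 1)" "R / 4 \<ge> norm x0 + 1" "R > 0" using Rb unfolding distrib_left by linarith+
  obtain F where F: "finite F" "F \<subseteq> int_lattice" "\<And>m. m \<in> F \<Longrightarrow> norm (m::real^'n) \<le> R / 4"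
    "(R / (8 * (?n + 1))) ^ CARD('n) \<le> real (card F)"
    using lattice_points_in_ball[OF R(1)] by blast
  have [measurable]: "ball (z::real^'n) s \<in> sets borel" for z s by simp
  have "ennreal (\<kappa> * R ^ CARD('n)) \<le> ennreal (real (card F) * (c\<^sup>2 * w))"
  proof (rule ennreal_leI)
    have "\<kappa> * R ^ CARD('n) = (R / (8 * (?n + 1))) ^ CARD('n) * (c\<^sup>2 * w)"
      by (simp add: \<kappa>_def power_divide)
    also have "\<dots> \<le> real (card F) * (c\<^sup>2 * w)" using w by (intro mult_right_mono F(4)) auto
    finally show "\<kappa> * R ^ CARD('n) \<le> real (card F) * (c\<^sup>2 * w)" .
  qed
  also have "\<dots> = (\<Sum>m\<in>F. ennreal (c\<^sup>2) * emeasure lborel (ball (x0 + m) \<rho>))"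
  proof -
    have "emeasure lborel (ball (x0 + m) \<rho>) = ennreal w" for m
      using emeasure_ball[of \<rho> "x0 + m"] \<rho> by (simp add: w_def v_def)
    then show ?thesis using w by (simp add: ennreal_mult[symmetric] ennreal_of_nat_eq_real_of_nat)
  qed
  also have "\<dots> = (\<integral>\<^sup>+y. (\<Sum>m\<in>F. ennreal (c\<^sup>2) * indicator (ball (x0 + m) \<rho>) y) \<partial>lborel)"
    by (subst nn_integral_sum) (auto simp: nn_integral_cmult_indicator)
  also have "\<dots> \<le> (\<integral>\<^sup>+x\<in>ball 0 (R / 2). ennreal ((norm (1 - kernel_integral x))\<^sup>2) \<partial>lborel)"
  proof (rule nn_integral_mono)
    fix y
    show "(\<Sum>m\<in>F. ennreal (c\<^sup>2) * indicator (ball (x0 + m) \<rho>) y) \<le> ennreal ((norm (1 - kernel_integral y))\<^sup>2) * indicator (ball 0 (R / 2)) y"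
    proof (cases "\<exists>m0\<in>F. y \<in> ball (x0 + m0) \<rho>")
      case True
      then obtain m0 where m0: "m0 \<in> F" "dist (x0 + m0) y < \<rho>" by auto
      have other: "y \<notin> ball (x0 + m) \<rho>" if "m \<in> F" "m \<noteq> m0" for m
      proof -
        have "1 \<le> dist m m0" using that m0 F(2) by (intro int_lattice_separated) auto
        also have "dist m m0 = dist (x0 + m) (x0 + m0)" by simp
        also have "\<dots> \<le> dist (x0 + m) y + dist (x0 + m0) y" by (rule dist_triangle2)
        finally show ?thesis using m0(2) \<rho>(2) by simp
      qed
      have "(\<Sum>m\<in>F. ennreal (c\<^sup>2) * indicator (ball (x0 + m) \<rho>) y) = (\<Sum>m\<in>F. if m = m0 then ennreal (c\<^sup>2) else 0)"
        using other m0 by (intro sum.cong refl) (auto simp: indicator_def)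
      also have "\<dots> = ennreal (c\<^sup>2)" using F(1) m0(1) by simp
      also have "\<dots> \<le> ennreal ((norm (1 - kernel_integral y))\<^sup>2)"
      proof -
        have "dist (y - m0) x0 < \<rho>" using m0(2) by (simp add: dist_norm norm_minus_commute algebra_simps)
        then have "c \<le> norm (1 - kernel_integral (y - m0))" by (rule far)
        also have "kernel_integral (y - m0) = kernel_integral y" using kernel_integral_periodic[of m0 "y - m0"] m0(1) F(2) by auto
        finally show ?thesis using c by (intro ennreal_leI power_mono) auto
      qed
      finally have le: "(\<Sum>m\<in>F. ennreal (c\<^sup>2) * indicator (ball (x0 + m) \<rho>) y) \<le> ennreal ((norm (1 - kernel_integral y))\<^sup>2)" .
      have "y \<in> ball 0 (R / 2)"
      proof -
        have "norm y \<le> norm (x0 + m0) + dist (x0 + m0) y" by (metis dist_commute dist_norm norm_triangle_sub)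
        also have "norm (x0 + m0) \<le> norm x0 + norm m0" by (rule norm_triangle_ineq)
        finally show ?thesis using F(3)[OF m0(1)] R(2) m0(2) \<rho>(2) by simp
      qed
      with le show ?thesis by simp
    next
      case False
      then have "(\<Sum>m\<in>F. ennreal (c\<^sup>2) * indicator (ball (x0 + m) \<rho>) y) = 0" by (auto simp: indicator_def)
      then show ?thesis by simp
    qed
  qed
  also have "\<dots> \<le> ennreal (\<kappa> / 2 * R ^ CARD('n))" using J[of j] by (simp add: R_def j_def)
  finally have "\<kappa> * R ^ CARD('n) \<le> \<kappa> / 2 * R ^ CARD('n)"
    using \<kappa> R by (subst (asm) ennreal_le_iff) auto
  then show False using \<kappa> R by simp
qed

end

end

theorem theorem1p3:
  fixes V :: "int \<Rightarrow> (real^'n \<Rightarrow> complex) set"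
    and \<phi> :: "real^'n \<Rightarrow> complex"
    and \<mu> :: "(real^'n) set \<Rightarrow> complex"
    and k :: real
  assumes "multiresolution_analysis V"
    and "scaling_function V \<phi>"
    and "continuous_on UNIV \<phi>"
    and "\<And>l::nat. ((\<lambda>x. of_real (norm x ^ l) * \<phi> x) \<longlongrightarrow> 0) at_infinity"
    and "complex_radon_measure \<mu>"
    and "k \<ge> 0"
    and "(\<integral>\<^sup>+x. ennreal ((1 + norm x) powr (- k)) \<partial>total_variation \<mu>) < \<infinity>"
  shows "(\<forall>x0 \<gamma>. has_lebesgue_density \<mu> x0 \<gamma>
            \<longrightarrow> ((\<lambda>j::int. q_measure \<phi> j \<mu> x0) \<longlongrightarrow> \<gamma>) at_top) \<and>
         (\<exists>f \<mu>s. lebesgue_decomposition \<mu> f \<mu>s) \<and>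
         (\<forall>f \<mu>s. lebesgue_decomposition \<mu> f \<mu>s
            \<longrightarrow> (AE x0 in lebesgue. has_lebesgue_density \<mu> x0 (f x0) \<and>
                   ((\<lambda>j::int. q_measure \<phi> j \<mu> x0) \<longlongrightarrow> f x0) at_top))"
proof -
  obtain e :: "nat \<Rightarrow> real^'n" where e: "bij_betw e UNIV int_lattice"
    using bij_betw_from_nat_into[OF countable_int_lattice infinite_int_lattice] by blast
  interpret scaling_kernel \<phi> e
    by standard (use assms(3) rapid_decay_bound[OF assms(3,4)] e in auto)
  have int1: "(LINT y|lborel. q0_kernel \<phi> x y) = 1" for x
    using kernel_integral_eq_1[OF assms(1,2)] by (simp add: kernel_integral_def)
  have lim: "((\<lambda>j::int. q_measure \<phi> j \<mu> x0) \<longlongrightarrow> \<gamma>) at_top" if dens: "has_lebesgue_density \<mu> x0 \<gamma>" for x0 \<gamma>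
  proof -
    obtain \<Lambda> \<sigma> h where "radon_density \<mu> \<Lambda> \<sigma> h" by (rule complex_radon_density[OF assms(5)])
    then interpret R: radon_density \<mu> \<Lambda> \<sigma> h .
    have "((\<lambda>c::real. radon_integral \<mu> (\<lambda>y. of_real (c ^ CARD('n)) * q0_kernel \<phi> (c *\<^sub>R x0) (c *\<^sub>R y))) \<longlongrightarrow> \<gamma>) at_top"
      by (rule R.scaled_kernel_tendsto[OF q0_kernel_borel q0_kernel_decay int1 assms(6,7) dens])
    \<comment> \<open>Convergence holds along all real scales; the dyadic ones tend to infinity with
      \<open>j\<close>.\<close>
    moreover have "filterlim (\<lambda>j::int. (2::real) powi j) at_top at_top"
      unfolding filterlim_at_top
    proof
      fix Z :: real
      obtain N where N: "Z < 2 ^ N" using real_arch_pow[of 2 Z] by auto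
      have "Z \<le> 2 powi j" if "j \<ge> int N" for j
      proof -
        have "(2::real) powi (int N) \<le> 2 powi j" using that by (intro power_int_increasing) auto
        then show ?thesis using N by simp
      qed
      then show "\<forall>\<^sub>F j in at_top. Z \<le> 2 powi j" unfolding eventually_at_top_linorder by blast
    qed
    ultimately have "((\<lambda>j::int. radon_integral \<mu> (\<lambda>y. of_real ((2 powi j) ^ CARD('n)) * q0_kernel \<phi> ((2 powi j) *\<^sub>R x0) ((2 powi j) *\<^sub>R y))) \<longlongrightarrow> \<gamma>) at_top"
      by (rule filterlim_compose)
    moreover have "2 powi (int CARD('n) * j) = (of_real ((2 powi j) ^ CARD('n)) :: complex)" for j
      by (simp add: power_int_mult mult.commute)
    ultimately show ?thesis unfolding q_measure_def q_kernel_def by simp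
  qed
  have "AE x0 in lebesgue. has_lebesgue_density \<mu> x0 (f x0) \<and> ((\<lambda>j::int. q_measure \<phi> j \<mu> x0) \<longlongrightarrow> f x0) at_top"
    if "lebesgue_decomposition \<mu> f \<mu>s" for f \<mu>s
    using AE_has_lebesgue_density[OF that] by eventually_elim (blast intro: lim)
  with lim lebesgue_decomposition_exists[OF assms(5)] show ?thesis by blast
qed

end
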